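(* Let $F$ be an algebraically closed field of characteristic $p>0$, let $g\in F[x,y,z]$ be homogeneous of degree $d$, and let $R=F[x,y,z]/(g)$ be a normal (standard-graded) two-dimensional hypersurface domain. If $p>d-3$, then every non-zero homogeneous element of $R$ of degree $\geq d-2$ is a test element for tight closure.
   Context: For a commutative noetherian domain $R$ containing a field of characteristic $p>0$ and an ideal $I\subseteq R$, the tight closure of $I$ is $I^*=\{f\in R : \text{there exists } c\neq 0 \text{ in } R \text{ with } c f^{q}\in I^{[q]} \text{ for all } q=p^e,\ e\ge 0\}$, where $I^{[q]}$ is the ideal generated by all $q$-th powers of elements of $I$. An element $w\in R$ is a test element for tight closure if for all ideals $I$ of $R$ and all elements $f\in R$: $f\in I^*$ if and only if $wf^q\in I^{[q]}$ for all $q=p^e$, $e\ge 0$. *)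

theory Defs
  imports
    "HOL-Algebra.Algebra"
    "HOL-Algebra.Algebraic_Closure_Type"
    "HOL-Library.Poly_Mapping"
    "HOL-Library.Numeral_Type"
    "HOL-Library.Extended_Nat"
begin

section \<open>Tight closure and test elements\<close>

text \<open>
  In this section \<open>R\<close> is meant to be a commutative noetherian domain containing a field of
  characteristic \<open>p > 0\<close>; the characteristic is passed as an explicit parameter.
\<close>

definition frobenius_power :: "('a, 'b) ring_scheme \<Rightarrow> 'a set \<Rightarrow> nat \<Rightarrow> 'a set" where
  "frobenius_power R I q = Idl\<^bsub>R\<^esub> ((\<lambda>a. a [^]\<^bsub>R\<^esub> q) ` I)"

definition tight_closure :: "('a, 'b) ring_scheme \<Rightarrow> nat \<Rightarrow> 'a set \<Rightarrow> 'a set" where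
  "tight_closure R p I =
     {f \<in> carrier R. \<exists>c \<in> carrier R - {\<zero>\<^bsub>R\<^esub>}.
        \<forall>e::nat. c \<otimes>\<^bsub>R\<^esub> f [^]\<^bsub>R\<^esub> (p ^ e) \<in> frobenius_power R I (p ^ e)}"

definition test_element :: "('a, 'b) ring_scheme \<Rightarrow> nat \<Rightarrow> 'a \<Rightarrow> bool" where
  "test_element R p w \<longleftrightarrow>
     w \<in> carrier R \<and>
     (\<forall>I. ideal I R \<longrightarrow>
       (\<forall>f \<in> carrier R.
          f \<in> tight_closure R p I \<longleftrightarrow>
          (\<forall>e::nat. w \<otimes>\<^bsub>R\<^esub> f [^]\<^bsub>R\<^esub> (p ^ e) \<in> frobenius_power R I (p ^ e))))"

section \<open>Normal domains\<close>

definition frac_rel :: "('a, 'b) ring_scheme \<Rightarrow> (('a \<times> 'a) \<times> ('a \<times> 'a)) set" where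
  "frac_rel R = {((a, b), (c, d)).
     a \<in> carrier R \<and> b \<in> carrier R - {\<zero>\<^bsub>R\<^esub>} \<and>
     c \<in> carrier R \<and> d \<in> carrier R - {\<zero>\<^bsub>R\<^esub>} \<and>
     a \<otimes>\<^bsub>R\<^esub> d = c \<otimes>\<^bsub>R\<^esub> b}"

definition mk_frac :: "('a, 'b) ring_scheme \<Rightarrow> 'a \<Rightarrow> 'a \<Rightarrow> ('a \<times> 'a) set" where
  "mk_frac R a b = frac_rel R `` {(a, b)}"

definition frac_field :: "('a, 'b) ring_scheme \<Rightarrow> ('a \<times> 'a) set ring" where
  "frac_field R = \<lparr>
     carrier = (carrier R \<times> (carrier R - {\<zero>\<^bsub>R\<^esub>})) // frac_rel R,
     monoid.mult = (\<lambda>A B. \<Union>(a, b)\<in>A. \<Union>(c, d)\<in>B. mk_frac R (a \<otimes>\<^bsub>R\<^esub> c) (b \<otimes>\<^bsub>R\<^esub> d)),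
     one = mk_frac R \<one>\<^bsub>R\<^esub> \<one>\<^bsub>R\<^esub>,
     ring.zero = mk_frac R \<zero>\<^bsub>R\<^esub> \<one>\<^bsub>R\<^esub>,
     add = (\<lambda>A B. \<Union>(a, b)\<in>A. \<Union>(c, d)\<in>B.
              mk_frac R (a \<otimes>\<^bsub>R\<^esub> d \<oplus>\<^bsub>R\<^esub> c \<otimes>\<^bsub>R\<^esub> b) (b \<otimes>\<^bsub>R\<^esub> d))\<rparr>"

definition frac_embed :: "('a, 'b) ring_scheme \<Rightarrow> 'a \<Rightarrow> ('a \<times> 'a) set" where
  "frac_embed R a = mk_frac R a \<one>\<^bsub>R\<^esub>"

context "domain" begin

lemma equiv_frac_rel: "equiv (carrier R \<times> (carrier R - {\<zero>})) (frac_rel R)"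
proof (rule equivI)
  show "frac_rel R \<subseteq> (carrier R \<times> (carrier R - {\<zero>})) \<times> (carrier R \<times> (carrier R - {\<zero>}))"
    by (auto simp: frac_rel_def)
  show "refl_on (carrier R \<times> (carrier R - {\<zero>})) (frac_rel R)"
    by (auto simp: refl_on_def frac_rel_def)
  show "sym (frac_rel R)"
    by (auto simp: sym_def frac_rel_def)
  show "trans (frac_rel R)"
  proof (rule transI, clarsimp simp: frac_rel_def)
    fix a b c d s t
    assume c: "a \<in> carrier R" "b \<in> carrier R" "c \<in> carrier R" "d \<in> carrier R" "s \<in> carrier R"
      "t \<in> carrier R" and d: "d \<noteq> \<zero>"
      and e: "a \<otimes> d = c \<otimes> b" "c \<otimes> t = s \<otimes> d"
    have "d \<otimes> (a \<otimes> t) = (a \<otimes> d) \<otimes> t" using c by algebra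
    also have "\<dots> = (c \<otimes> t) \<otimes> b" unfolding e(1) using c by algebra
    also have "\<dots> = d \<otimes> (s \<otimes> b)" unfolding e(2) using c by algebra
    finally show "a \<otimes> t = s \<otimes> b" using c d m_lcancel[of d "a \<otimes> t" "s \<otimes> b"] by simp
  qed
qed

lemma mk_frac_eq_iff:
  assumes "a \<in> carrier R" "b \<in> carrier R - {\<zero>}" "c \<in> carrier R" "d \<in> carrier R - {\<zero>}"
  shows "mk_frac R a b = mk_frac R c d \<longleftrightarrow> a \<otimes> d = c \<otimes> b"
  unfolding mk_frac_def using assms
  by (subst eq_equiv_class_iff[OF equiv_frac_rel]) (auto simp: frac_rel_def)

lemma carrier_frac_field:
  "carrier (frac_field R) = {mk_frac R a b | a b. a \<in> carrier R \<and> b \<in> carrier R - {\<zero>}}"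
  by (auto simp: frac_field_def mk_frac_def quotient_def)

lemma mem_mk_frac:
  assumes "a \<in> carrier R" "b \<in> carrier R - {\<zero>}"
  shows "(x, y) \<in> mk_frac R a b \<longleftrightarrow> x \<in> carrier R \<and> y \<in> carrier R - {\<zero>} \<and> a \<otimes> y = x \<otimes> b"
  using assms by (auto simp: mk_frac_def frac_rel_def)

lemma mk_frac_mult:
  assumes "a \<in> carrier R" "b \<in> carrier R - {\<zero>}" "c \<in> carrier R" "d \<in> carrier R - {\<zero>}"
  shows "mk_frac R a b \<otimes>\<^bsub>frac_field R\<^esub> mk_frac R c d = mk_frac R (a \<otimes> c) (b \<otimes> d)"
proof -
  have "mk_frac R (x \<otimes> s) (y \<otimes> t) = mk_frac R (a \<otimes> c) (b \<otimes> d)"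
    if m: "(x, y) \<in> mk_frac R a b" "(s, t) \<in> mk_frac R c d" for x y s t
  proof -
    have m': "x \<in> carrier R" "y \<in> carrier R - {\<zero>}" "a \<otimes> y = x \<otimes> b"
       "s \<in> carrier R" "t \<in> carrier R - {\<zero>}" "c \<otimes> t = s \<otimes> d"
      using m mem_mk_frac assms by auto
    have c: "x \<in> carrier R" "y \<in> carrier R" "s \<in> carrier R" "t \<in> carrier R"
      "a \<in> carrier R" "b \<in> carrier R" "c \<in> carrier R" "d \<in> carrier R" using m' assms by auto
    have "(x \<otimes> s) \<otimes> (b \<otimes> d) = (x \<otimes> b) \<otimes> (s \<otimes> d)" using c by algebra
    also have "\<dots> = (a \<otimes> y) \<otimes> (c \<otimes> t)" using m' by simp
    also have "\<dots> = (a \<otimes> c) \<otimes> (y \<otimes> t)" using c by algebra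
    finally show ?thesis using m' assms by (subst mk_frac_eq_iff) (auto simp: integral_iff)
  qed
  then have *: "mk_frac R (fst u \<otimes> fst v) (snd u \<otimes> snd v) = mk_frac R (a \<otimes> c) (b \<otimes> d)"
    if "u \<in> mk_frac R a b" "v \<in> mk_frac R c d" for u v
    using that by (metis prod.collapse)
  have ne: "(a, b) \<in> mk_frac R a b" "(c, d) \<in> mk_frac R c d"
    using assms by (auto simp: mem_mk_frac)
  have "mk_frac R a b \<otimes>\<^bsub>frac_field R\<^esub> mk_frac R c d =
    (\<Union>u\<in>mk_frac R a b. \<Union>v\<in>mk_frac R c d. mk_frac R (fst u \<otimes> fst v) (snd u \<otimes> snd v))"
    by (simp add: frac_field_def case_prod_unfold)
  also have "\<dots> = (\<Union>u\<in>mk_frac R a b. \<Union>v\<in>mk_frac R c d. mk_frac R (a \<otimes> c) (b \<otimes> d))"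
    by (intro SUP_cong refl *)
  also have "\<dots> = mk_frac R (a \<otimes> c) (b \<otimes> d)"
    using ne by blast
  finally show ?thesis .
qed

lemma mk_frac_add:
  assumes "a \<in> carrier R" "b \<in> carrier R - {\<zero>}" "c \<in> carrier R" "d \<in> carrier R - {\<zero>}"
  shows "mk_frac R a b \<oplus>\<^bsub>frac_field R\<^esub> mk_frac R c d = mk_frac R (a \<otimes> d \<oplus> c \<otimes> b) (b \<otimes> d)"
proof -
  have "mk_frac R (x \<otimes> t \<oplus> s \<otimes> y) (y \<otimes> t) = mk_frac R (a \<otimes> d \<oplus> c \<otimes> b) (b \<otimes> d)"
    if m: "(x, y) \<in> mk_frac R a b" "(s, t) \<in> mk_frac R c d" for x y s t
  proof -
    have m': "x \<in> carrier R" "y \<in> carrier R - {\<zero>}" "a \<otimes> y = x \<otimes> b"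
       "s \<in> carrier R" "t \<in> carrier R - {\<zero>}" "c \<otimes> t = s \<otimes> d"
      using m mem_mk_frac assms by auto
    have c: "x \<in> carrier R" "y \<in> carrier R" "s \<in> carrier R" "t \<in> carrier R"
      "a \<in> carrier R" "b \<in> carrier R" "c \<in> carrier R" "d \<in> carrier R" using m' assms by auto
    have "(x \<otimes> t \<oplus> s \<otimes> y) \<otimes> (b \<otimes> d) = (x \<otimes> b) \<otimes> (t \<otimes> d) \<oplus> (s \<otimes> d) \<otimes> (y \<otimes> b)"
      using c by algebra
    also have "\<dots> = (a \<otimes> y) \<otimes> (t \<otimes> d) \<oplus> (c \<otimes> t) \<otimes> (y \<otimes> b)" using m' by simp
    also have "\<dots> = (a \<otimes> d \<oplus> c \<otimes> b) \<otimes> (y \<otimes> t)" using c by algebra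
    finally show ?thesis using m' assms by (subst mk_frac_eq_iff) (auto simp: integral_iff)
  qed
  then have *: "mk_frac R (fst u \<otimes> snd v \<oplus> fst v \<otimes> snd u) (snd u \<otimes> snd v) = mk_frac R (a \<otimes> d \<oplus> c \<otimes> b) (b \<otimes> d)"
    if "u \<in> mk_frac R a b" "v \<in> mk_frac R c d" for u v
    using that by (metis prod.collapse)
  have ne: "(a, b) \<in> mk_frac R a b" "(c, d) \<in> mk_frac R c d"
    using assms by (auto simp: mem_mk_frac)
  have "mk_frac R a b \<oplus>\<^bsub>frac_field R\<^esub> mk_frac R c d =
    (\<Union>u\<in>mk_frac R a b. \<Union>v\<in>mk_frac R c d. mk_frac R (fst u \<otimes> snd v \<oplus> fst v \<otimes> snd u) (snd u \<otimes> snd v))"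
    by (simp add: frac_field_def case_prod_unfold)
  also have "\<dots> = (\<Union>u\<in>mk_frac R a b. \<Union>v\<in>mk_frac R c d. mk_frac R (a \<otimes> d \<oplus> c \<otimes> b) (b \<otimes> d))"
    by (intro SUP_cong refl *)
  also have "\<dots> = mk_frac R (a \<otimes> d \<oplus> c \<otimes> b) (b \<otimes> d)"
    using ne by blast
  finally show ?thesis .
qed

lemma frac_zero: "\<zero>\<^bsub>frac_field R\<^esub> = mk_frac R \<zero> \<one>" 
  and frac_one: "\<one>\<^bsub>frac_field R\<^esub> = mk_frac R \<one> \<one>"
  by (auto simp: frac_field_def)

lemma field_frac_field: "Ring.field (frac_field R)"
proof -
  have crI: "mk_frac R a b \<in> carrier (frac_field R)" if "a \<in> carrier R" "b \<in> carrier R" "b \<noteq> \<zero>" for a b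
    using that by (auto simp: carrier_frac_field)
  have crE: thesis if "x \<in> carrier (frac_field R)"
     "\<And>a b. x = mk_frac R a b \<Longrightarrow> a \<in> carrier R \<Longrightarrow> b \<in> carrier R \<Longrightarrow> b \<noteq> \<zero> \<Longrightarrow> thesis" for x thesis
    using that by (auto simp: carrier_frac_field)
  have nz: "b \<otimes> d \<noteq> \<zero>" if "b \<in> carrier R" "b \<noteq> \<zero>" "d \<in> carrier R" "d \<noteq> \<zero>" for b d
    using that by (auto simp: integral_iff)
  interpret S: cring "frac_field R"
  proof (rule cringI)
    show "abelian_group (frac_field R)"
    proof (rule abelian_groupI)
      fix x y assume "x \<in> carrier (frac_field R)" "y \<in> carrier (frac_field R)"
      then show "x \<oplus>\<^bsub>frac_field R\<^esub> y \<in> carrier (frac_field R)"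
        by (elim crE) (auto simp: mk_frac_add nz intro!: crI)
      show "x \<oplus>\<^bsub>frac_field R\<^esub> y = y \<oplus>\<^bsub>frac_field R\<^esub> x"
        using \<open>x \<in> _\<close> \<open>y \<in> _\<close>
        by (elim crE) (auto simp: mk_frac_add nz m_comm a_comm)
    next
      show "\<zero>\<^bsub>frac_field R\<^esub> \<in> carrier (frac_field R)" by (auto simp: frac_zero intro!: crI)
    next
      fix x y z assume "x \<in> carrier (frac_field R)" "y \<in> carrier (frac_field R)" "z \<in> carrier (frac_field R)"
      then show "x \<oplus>\<^bsub>frac_field R\<^esub> y \<oplus>\<^bsub>frac_field R\<^esub> z = x \<oplus>\<^bsub>frac_field R\<^esub> (y \<oplus>\<^bsub>frac_field R\<^esub> z)"
        apply (elim crE)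
        apply (simp add: mk_frac_add nz)
        apply (subst mk_frac_eq_iff; (auto simp: nz; fail)?)
        by algebra
    next
      fix x assume "x \<in> carrier (frac_field R)"
      then show "\<zero>\<^bsub>frac_field R\<^esub> \<oplus>\<^bsub>frac_field R\<^esub> x = x"
        by (elim crE) (auto simp: mk_frac_add nz frac_zero)
    next
      fix x assume "x \<in> carrier (frac_field R)"
      then obtain a b where ab: "x = mk_frac R a b" "a \<in> carrier R" "b \<in> carrier R" "b \<noteq> \<zero>" by (elim crE)
      have "mk_frac R (\<ominus> a) b \<oplus>\<^bsub>frac_field R\<^esub> x = \<zero>\<^bsub>frac_field R\<^esub>"
        using ab by (simp add: mk_frac_add nz frac_zero mk_frac_eq_iff l_minus l_neg)
      then show "\<exists>y\<in>carrier (frac_field R). y \<oplus>\<^bsub>frac_field R\<^esub> x = \<zero>\<^bsub>frac_field R\<^esub>"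
        using ab by (intro bexI[of _ "mk_frac R (\<ominus> a) b"] crI) auto
    qed
    show "Group.comm_monoid (frac_field R)"
    proof (rule comm_monoidI)
      fix x y assume "x \<in> carrier (frac_field R)" "y \<in> carrier (frac_field R)"
      then show "x \<otimes>\<^bsub>frac_field R\<^esub> y \<in> carrier (frac_field R)"
        by (elim crE) (auto simp: mk_frac_mult nz intro!: crI)
      show "x \<otimes>\<^bsub>frac_field R\<^esub> y = y \<otimes>\<^bsub>frac_field R\<^esub> x"
        using \<open>x \<in> _\<close> \<open>y \<in> _\<close>
        by (elim crE) (auto simp: mk_frac_mult nz m_comm)
    next
      show "\<one>\<^bsub>frac_field R\<^esub> \<in> carrier (frac_field R)" by (auto simp: frac_one intro!: crI)
    next
      fix x y z assume "x \<in> carrier (frac_field R)" "y \<in> carrier (frac_field R)" "z \<in> carrier (frac_field R)"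
      then show "x \<otimes>\<^bsub>frac_field R\<^esub> y \<otimes>\<^bsub>frac_field R\<^esub> z = x \<otimes>\<^bsub>frac_field R\<^esub> (y \<otimes>\<^bsub>frac_field R\<^esub> z)"
        by (elim crE) (auto simp: mk_frac_mult nz m_assoc)
    next
      fix x assume "x \<in> carrier (frac_field R)"
      then show "\<one>\<^bsub>frac_field R\<^esub> \<otimes>\<^bsub>frac_field R\<^esub> x = x"
        by (elim crE) (auto simp: mk_frac_mult nz frac_one)
    qed
    fix x y z assume "x \<in> carrier (frac_field R)" "y \<in> carrier (frac_field R)" "z \<in> carrier (frac_field R)"
    then show "(x \<oplus>\<^bsub>frac_field R\<^esub> y) \<otimes>\<^bsub>frac_field R\<^esub> z
        = x \<otimes>\<^bsub>frac_field R\<^esub> z \<oplus>\<^bsub>frac_field R\<^esub> y \<otimes>\<^bsub>frac_field R\<^esub> z"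
      apply (elim crE)
      apply (simp add: mk_frac_add mk_frac_mult nz)
      apply (subst mk_frac_eq_iff; (auto simp: nz; fail)?)
      by algebra
  qed
  show ?thesis
  proof (rule S.cring_fieldI2)
    show "\<zero>\<^bsub>frac_field R\<^esub> \<noteq> \<one>\<^bsub>frac_field R\<^esub>" by (simp add: frac_zero frac_one mk_frac_eq_iff)
    fix x assume "x \<in> carrier (frac_field R)" and x0: "x \<noteq> \<zero>\<^bsub>frac_field R\<^esub>"
    then obtain a b where ab: "x = mk_frac R a b" "a \<in> carrier R" "b \<in> carrier R" "b \<noteq> \<zero>" by (elim crE)
    then have "a \<noteq> \<zero>" using x0 by (auto simp: frac_zero mk_frac_eq_iff)
    then show "\<exists>y\<in>carrier (frac_field R). x \<otimes>\<^bsub>frac_field R\<^esub> y = \<one>\<^bsub>frac_field R\<^esub>"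
      using ab by (intro bexI[of _ "mk_frac R b a"] crI) (auto simp: mk_frac_mult frac_one mk_frac_eq_iff nz m_comm)
  qed
qed
end

text \<open>
  \<open>integral_over S A x\<close>: the element \<open>x\<close> of \<open>S\<close> is a root of a monic polynomial with
  coefficients in the subring \<open>A\<close>. Polynomials are coefficient lists, leading coefficient first.
\<close>

definition integral_over :: "('a, 'b) ring_scheme \<Rightarrow> 'a set \<Rightarrow> 'a \<Rightarrow> bool" where
  "integral_over S A x \<longleftrightarrow>
     (\<exists>f. polynomial\<^bsub>S\<^esub> A f \<and> f \<noteq> [] \<and> hd f = \<one>\<^bsub>S\<^esub> \<and> ring.eval S f x = \<zero>\<^bsub>S\<^esub>)"

definition normal_domain :: "('a, 'b) ring_scheme \<Rightarrow> bool" where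
  "normal_domain R \<longleftrightarrow>
     domain R \<and>
     (\<forall>x \<in> carrier (frac_field R).
        integral_over (frac_field R) (frac_embed R ` carrier R) x \<longrightarrow>
        x \<in> frac_embed R ` carrier R)"

section \<open>Krull dimension\<close>

definition krull_dim :: "('a, 'b) ring_scheme \<Rightarrow> enat" where
  "krull_dim R = Sup {enat n | n. \<exists>P :: nat \<Rightarrow> 'a set.
     (\<forall>i\<le>n. primeideal (P i) R) \<and> (\<forall>i<n. P i \<subset> P (Suc i))}"

section \<open>Hypersurface rings in three variables\<close>

text \<open>
  A polynomial in \<open>x, y, z\<close> is a finitely supported function from exponent vectors
  \<open>3 \<Rightarrow>\<^sub>0 nat\<close> to coefficients; the multiplication on this type is convolution.
\<close>

type_synonym 'a mpoly3 = "(3 \<Rightarrow>\<^sub>0 nat) \<Rightarrow>\<^sub>0 'a"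

definition monom_deg :: "(3 \<Rightarrow>\<^sub>0 nat) \<Rightarrow> nat" where
  "monom_deg m = (\<Sum>i\<in>UNIV. Poly_Mapping.lookup m i)"

text \<open>As usual, the zero polynomial is homogeneous of every degree.\<close>

definition homogeneous :: "nat \<Rightarrow> 'a::zero mpoly3 \<Rightarrow> bool" where
  "homogeneous k h \<longleftrightarrow> (\<forall>m \<in> Poly_Mapping.keys h. monom_deg m = k)"

definition mpoly3_ring :: "'a::comm_ring_1 mpoly3 ring" where
  "mpoly3_ring = ring_of_type_algebra"

definition hypersurface_ring :: "'a::comm_ring_1 mpoly3 \<Rightarrow> 'a mpoly3 set ring" where
  "hypersurface_ring g = mpoly3_ring Quot (PIdl\<^bsub>mpoly3_ring\<^esub> g)"

text \<open>
  The standard grading on \<open>F[x,y,z]/(g)\<close>, for homogeneous \<open>g\<close>: the degree \<open>k\<close> component is the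
  image of the homogeneous polynomials of degree \<open>k\<close>.
\<close>

definition graded_component :: "'a::comm_ring_1 mpoly3 \<Rightarrow> nat \<Rightarrow> 'a mpoly3 set set" where
  "graded_component g k =
     (\<lambda>h. PIdl\<^bsub>mpoly3_ring\<^esub> g +>\<^bsub>mpoly3_ring\<^esub> h) ` {h. homogeneous k h}"

end

theory Submission
  imports Defs "HOL-Library.Function_Algebras"
begin

text \<open>
  Write \<open>S = F[x,y,z]\<close>, let \<open>\<kappa>\<close> be the Cartier operator on \<open>S\<close> and put \<open>\<phi>(s) = \<kappa>(g\<^sup>p\<^sup>-\<^sup>1 s)\<close>. For an ideal
  \<open>I\<close> of \<open>R\<close> and \<open>f \<in> R\<close>, the set \<open>J\<close> of all \<open>s \<in> S\<close> with \<open>s f\<^sup>q \<in> I\<^sup>[\<^sup>q\<^sup>]\<close> for all \<open>q\<close> is an ideal containing \<open>g\<close>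
  that is stable under \<open>\<phi>\<close>, and \<open>f \<in> I\<^sup>*\<close> means that \<open>J\<close> contains some \<open>c \<notin> (g)\<close>. It has to be shown that \<open>J\<close> then
  contains all forms of degree at least \<open>d - 2\<close>.

  First, \<open>J\<close> contains the partial derivatives of \<open>g\<close>: by elimination it contains some \<open>r \<noteq> 0\<close> free of a given
  variable \<open>x\<^sub>l\<close>, and for \<open>s\<close> free of \<open>x\<^sub>l\<close> the formula for the logarithmic Cartier operator reads
  \<open>\<phi>(\<partial>\<^sub>l g s) = \<partial>\<^sub>l g \<kappa>(x\<^sub>l\<^sup>p\<^sup>-\<^sup>1 s)\<close>; iterating it turns \<open>r\<close> into a nonzero constant.

  Secondly, since \<open>R\<close> is normal and \<open>F\<close> is perfect, the curve is smooth, so \<open>(g, \<nabla>g)\<close> contains a power of the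
  irrelevant ideal. Syzygies of \<open>\<nabla>g\<close> modulo \<open>g\<close> satisfy \<open>a \<times> (x,y,z) = t \<nabla>g\<close>, and a dimension count shows that
  \<open>(g, \<nabla>g)\<close> contains all forms of degree at least \<open>3d - 5\<close> and \<open>2d - 2\<close>.

  Finally, \<open>\<phi>\<close> maps \<open>S\<^sub>k\<^sub>'\<close> onto \<open>S\<^sub>k\<close> for \<open>k \<ge> d - 2\<close> and \<open>k' = k + (p - 1)(k + 3 - d) > k\<close>. This is dual to Tango's
  theorem on the injectivity of Frobenius on \<open>H\<^sup>1\<close> of negative line bundles, and \<open>p > d - 3\<close> is what the degree
  bound requires. Descending induction on the degree finishes the proof.
\<close>

section \<open>Operators on polynomials defined monomial by monomial\<close>

lemma UNIV_3: "(UNIV :: 3 set) = {0, 1, 2}"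
proof -
  have "finite {0::3, 1, 2}" "card {0::3, 1, 2} = CARD(3)" by auto
  then show ?thesis by (metis card_subset_eq finite subset_UNIV)
qed

lemma neq_3: "(0::3) \<noteq> 1" "(0::3) \<noteq> 2" "(1::3) \<noteq> 2" "(1::3) \<noteq> 0" "(2::3) \<noteq> 0" "(2::3) \<noteq> 1"
  by auto

lemma sum_UNIV_3: "(\<Sum>i\<in>UNIV. f i) = f 0 + f 1 + f (2::3)"
  for f :: "3 \<Rightarrow> 'b::comm_monoid_add"
  unfolding UNIV_3 by (simp add: neq_3 add.assoc)

lemma distinct_triple_3:
  obtains i j where "UNIV = {i, j, l::3}" "i \<noteq> j" "i \<noteq> l" "j \<noteq> l"
proof -
  consider "l = 0" | "l = 1" | "l = 2" using UNIV_3 by auto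
  then show thesis
  proof cases
    case 1 then show ?thesis using that[of 1 2] UNIV_3 by auto
  next
    case 2 then show ?thesis using that[of 0 2] UNIV_3 by auto
  next
    case 3 then show ?thesis using that[of 0 1] UNIV_3 by auto
  qed
qed

lemma sum_triple:
  assumes "UNIV = {i, j, l::3}" "i \<noteq> j" "i \<noteq> l" "j \<noteq> l"
  shows "(\<Sum>k\<in>UNIV. f k) = f i + f j + (f l :: 'b::comm_monoid_add)"
  unfolding assms(1) using assms(2-4) by (simp add: add.assoc)

abbreviation cexp :: "(3 \<Rightarrow>\<^sub>0 nat) \<Rightarrow> 3 \<Rightarrow> nat" where
  "cexp \<equiv> Poly_Mapping.lookup"

text \<open>The index type is finite, so every function has finite support and
  \<open>Abs_poly_mapping\<close> yields no junk.\<close>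

definition vec3 :: "(3 \<Rightarrow> nat) \<Rightarrow> (3 \<Rightarrow>\<^sub>0 nat)" where
  "vec3 f = Abs_poly_mapping f"

lemma cexp_vec3 [simp]: "cexp (vec3 f) i = f i"
  by (simp add: vec3_def)

lemma cexp_eqI: "(\<And>i. cexp m i = cexp n i) \<Longrightarrow> m = n"
  by (rule poly_mapping_eqI)

lemma monom_deg_add [simp]: "monom_deg (m + n) = monom_deg m + monom_deg n"
  by (simp add: monom_deg_def lookup_add sum.distrib)

lemma monom_deg_zero [simp]: "monom_deg 0 = 0"
  by (simp add: monom_deg_def)

lemma monom_deg_single [simp]: "monom_deg (Poly_Mapping.single i n) = n"
  by (simp add: monom_deg_def lookup_single when_def)

abbreviation mon :: "(3 \<Rightarrow>\<^sub>0 nat) \<Rightarrow> 'a \<Rightarrow> 'a::zero mpoly3" where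
  "mon \<equiv> Poly_Mapping.single"

definition Var :: "3 \<Rightarrow> 'a::comm_ring_1 mpoly3" where
  "Var i = mon (Poly_Mapping.single i 1) 1"

abbreviation const :: "'a \<Rightarrow> 'a::zero mpoly3" where
  "const c \<equiv> mon 0 c"

text \<open>The coefficient is an argument of \<open>h\<close> because the operators below need not
  be linear over the field: the Cartier operator takes p-th roots of coefficients.\<close>

definition mext :: "((3 \<Rightarrow>\<^sub>0 nat) \<Rightarrow> 'a::zero \<Rightarrow> 'b::comm_monoid_add) \<Rightarrow> 'a mpoly3 \<Rightarrow> 'b" where
  "mext h f = (\<Sum>m\<in>Poly_Mapping.keys f. h m (Poly_Mapping.lookup f m))"

lemma mext_mon: "h m 0 = 0 \<Longrightarrow> mext h (mon m c) = h m c"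
  by (simp add: mext_def)

lemma mext_add:
  assumes "\<And>m. h m 0 = 0" "\<And>m a b. h m (a + b) = h m a + h m b"
  shows "mext h (f + g) = mext h f + mext h g"
  unfolding mext_def by (rule setsum_keys_plus_distrib) (auto simp: assms)

lemma mpoly3_sum_mon: "f = (\<Sum>m\<in>Poly_Mapping.keys f. mon m (Poly_Mapping.lookup f m))"
  by (rule poly_mapping_eqI)
     (auto simp: lookup_sum lookup_single when_def in_keys_iff sum.delta)

text \<open>Builds up one fixed \<open>g\<close> from its own monomials, so that properties of the
  exponents of \<open>g\<close> stay available in the step.\<close>

lemma sum_mon_induct [case_names zero add]:
  assumes "P 0" "\<And>m c f. m \<in> Poly_Mapping.keys g \<Longrightarrow> P f \<Longrightarrow> P (mon m (Poly_Mapping.lookup g m) + f)"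
  shows "P (g :: 'a::comm_monoid_add mpoly3)"
proof -
  have "P (\<Sum>m\<in>A. mon m (Poly_Mapping.lookup g m))" if "finite A" "A \<subseteq> Poly_Mapping.keys g" for A
    using that by (induction A rule: finite_induct) (auto intro: assms)
  from this[of "Poly_Mapping.keys g"] show ?thesis
    by (simp flip: mpoly3_sum_mon)
qed

lemma mpoly3_induct [case_names zero single add]:
  assumes "P 0" "\<And>m c. P (mon m c)" "\<And>f g. P f \<Longrightarrow> P g \<Longrightarrow> P (f + g)"
  shows "P (f::'a::comm_monoid_add mpoly3)"
  by (rule sum_mon_induct) (auto intro: assms)

lemma additive_uminus: 
  fixes T :: "'b::ab_group_add \<Rightarrow> 'c::ab_group_add"
  assumes "\<And>f g. T (f + g) = T f + T g"
  shows "T 0 = 0" "T (- f) = - T f" "T (f - g) = T f - T g" "T (sum h A) = (\<Sum>i\<in>A. T (h i))"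
proof -
  interpret additive T by standard (rule assms)
  show "T 0 = 0" "T (- f) = - T f" "T (f - g) = T f - T g" "T (sum h A) = (\<Sum>i\<in>A. T (h i))"
    by (simp_all add: zero minus diff sum)
qed

section \<open>Homogeneous components\<close>

text \<open>Degrees are integers, so that forms of negative degree (all zero) need no case distinctions.\<close>

definition ihom :: "int \<Rightarrow> 'a::zero mpoly3 \<Rightarrow> bool" where
  "ihom k f \<longleftrightarrow> (\<forall>m\<in>Poly_Mapping.keys f. int (monom_deg m) = k)"

lemma ihom_homogeneous: "ihom (int k) f \<longleftrightarrow> homogeneous k f"
  by (auto simp: ihom_def homogeneous_def)

lemma ihom_zero [simp]: "ihom k 0"
  by (simp add: ihom_def)

lemma ihom_neg: "ihom k f \<Longrightarrow> k < 0 \<Longrightarrow> f = 0"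
  by (metis ihom_def keys_eq_empty ex_in_conv of_nat_less_0_iff)

lemma ihom_add: "ihom k f \<Longrightarrow> ihom k g \<Longrightarrow> ihom k (f + g)"
  unfolding ihom_def using keys_add[of f g] by blast

lemma ihom_uminus: "ihom k f \<Longrightarrow> ihom k (- f)" for f :: "'a::ab_group_add mpoly3"
  by (simp add: ihom_def in_keys_iff)

lemma ihom_diff: "ihom k f \<Longrightarrow> ihom k g \<Longrightarrow> ihom k (f - g)" for f :: "'a::ab_group_add mpoly3"
  using ihom_add[of k f "- g"] ihom_uminus[of k g] by simp

lemma ihom_sum: "(\<And>i. i \<in> A \<Longrightarrow> ihom k (f i)) \<Longrightarrow> ihom k (sum f A)"
  by (induction A rule: infinite_finite_induct) (auto intro: ihom_add)

lemma ihom_mon: "k = int (monom_deg m) \<Longrightarrow> ihom k (mon m c)"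
  by (auto simp: ihom_def)

lemma ihom_const [simp]: "ihom 0 (const c)"
  by (rule ihom_mon) simp

lemma ihom_one [simp]: "ihom 0 (1 :: 'a::comm_ring_1 mpoly3)"
  using ihom_const[of "1::'a"] by (simp del: ihom_const)

lemma ihom_Var [simp]: "ihom 1 (Var i)"
  unfolding Var_def by (rule ihom_mon) simp

lemma ihom_mult: "ihom k f \<Longrightarrow> ihom l g \<Longrightarrow> ihom (k + l) (f * g)" 
  for f :: "'a::comm_ring_1 mpoly3"
  unfolding ihom_def using keys_mult[of f g] by fastforce

lemma ihom_mult': "ihom k f \<Longrightarrow> ihom l g \<Longrightarrow> n = k + l \<Longrightarrow> ihom n (f * g)" 
  for f :: "'a::comm_ring_1 mpoly3"
  using ihom_mult by blast

lemma ihom_power: "ihom k f \<Longrightarrow> ihom (int n * k) (f ^ n)" for f :: "'a::comm_ring_1 mpoly3"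
  by (induction n) (auto simp: algebra_simps intro: ihom_mult)

definition hcomp :: "int \<Rightarrow> 'a::comm_ring_1 mpoly3 \<Rightarrow> 'a mpoly3" where
  "hcomp k = mext (\<lambda>m c. if int (monom_deg m) = k then mon m c else 0)"

lemma hcomp_add: "hcomp k (f + g) = hcomp k f + hcomp k g"
  unfolding hcomp_def by (rule mext_add) (auto simp: single_add)

lemmas hcomp_additive [simp] = additive_uminus[of "hcomp k" for k, OF hcomp_add]

lemma hcomp_mon: "hcomp k (mon m c) = (if int (monom_deg m) = k then mon m c else 0)"
  unfolding hcomp_def by (rule mext_mon) auto

lemma ihom_hcomp [simp]: "ihom k (hcomp k f)"
  by (induction f rule: mpoly3_induct) (auto simp: hcomp_add hcomp_mon intro: ihom_add ihom_mon)

lemma hcomp_ihom: "ihom k f \<Longrightarrow> hcomp l f = (if l = k then f else 0)"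
proof -
  assume f: "ihom k f"
  have "hcomp l f = (\<Sum>m\<in>Poly_Mapping.keys f. if int (monom_deg m) = l then mon m (Poly_Mapping.lookup f m) else 0)"
    by (simp add: hcomp_def mext_def)
  also have "\<dots> = (\<Sum>m\<in>Poly_Mapping.keys f. if k = l then mon m (Poly_Mapping.lookup f m) else 0)"
    using f by (intro sum.cong) (auto simp: ihom_def)
  also have "\<dots> = (if l = k then f else 0)"
    by (auto simp flip: mpoly3_sum_mon)
  finally show ?thesis .
qed

text \<open>A homogeneous factor only shifts degrees. Comparing components by this rule turns
  inhomogeneous cofactors into homogeneous ones.\<close>

lemma hcomp_mult: "ihom d f \<Longrightarrow> hcomp k (f * h) = f * hcomp (k - d) h"
proof (induction h rule: mpoly3_induct)
  case (single m c)
  have "ihom (d + int (monom_deg m)) (f * mon m c)"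
    by (intro ihom_mult single ihom_mon) simp
  then show ?case by (auto simp: hcomp_ihom hcomp_mon)
qed (auto simp: hcomp_add algebra_simps)

lemma lookup_hcomp:
  "Poly_Mapping.lookup (hcomp k f) m = (if int (monom_deg m) = k then Poly_Mapping.lookup f m else 0)"
  by (induction f rule: mpoly3_induct) (auto simp: hcomp_add hcomp_mon lookup_add lookup_single when_def)

lemma hcomp_nonzero:
  assumes "f \<noteq> 0"
  obtains k where "hcomp k f \<noteq> 0"
proof -
  from assms obtain m where m: "m \<in> Poly_Mapping.keys f"
    by (metis keys_eq_empty ex_in_conv)
  have "hcomp (int (monom_deg m)) f \<noteq> 0"
    using m lookup_hcomp[of "int (monom_deg m)" f m] by (auto simp: in_keys_iff)
  then show ?thesis using that by blast
qed

section \<open>Partial derivatives\<close>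

text \<open>Truncated subtraction does no harm: where the exponent at \<open>l\<close> is zero, so
  is the new coefficient.\<close>

definition pd :: "3 \<Rightarrow> 'a::comm_ring_1 mpoly3 \<Rightarrow> 'a mpoly3" where
  "pd l = mext (\<lambda>m c. mon (m - Poly_Mapping.single l 1) (of_nat (cexp m l) * c))"

lemma pd_add: "pd l (f + g) = pd l f + pd l g"
  unfolding pd_def by (rule mext_add) (auto simp: single_add algebra_simps)

lemmas pd_additive [simp] = additive_uminus[of "pd l" for l, OF pd_add]

lemma pd_mon: "pd l (mon m c) = mon (m - Poly_Mapping.single l 1) (of_nat (cexp m l) * c)"
  unfolding pd_def by (rule mext_mon) auto

lemma mon_shift:
  "mon ((m - Poly_Mapping.single l 1) + n) (of_nat (cexp m l) * c) = 
   mon (m + n - Poly_Mapping.single l 1) (of_nat (cexp m l) * (c::'a::comm_ring_1))"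
proof (cases "cexp m l = 0")
  case False
  then have "(m - Poly_Mapping.single l 1) + n = m + n - Poly_Mapping.single l 1"
    by (intro cexp_eqI) (auto simp: lookup_add lookup_minus lookup_single when_def)
  then show ?thesis by simp
qed simp

lemma pd_mult_mon: "pd l (mon m c * mon n e) = pd l (mon m c) * mon n e + mon m c * pd l (mon n e)"
proof -
  have "pd l (mon m c) * mon n e = mon (m + n - Poly_Mapping.single l 1) (of_nat (cexp m l) * (c * e))"
    using mon_shift[of m l n "c * e"] by (simp add: pd_mon mult_single mult.assoc del: One_nat_def)
  moreover have "mon m c * pd l (mon n e) = mon (m + n - Poly_Mapping.single l 1) (of_nat (cexp n l) * (c * e))"
    using mon_shift[of n l m "c * e"] by (simp add: pd_mon mult_single mult.left_commute add.commute del: One_nat_def)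
  ultimately show ?thesis
    by (simp add: pd_mon mult_single lookup_add algebra_simps flip: single_add)
qed

lemma pd_mult: "pd l (f * g) = pd l f * g + f * pd l g"
proof (induction f rule: mpoly3_induct)
  case (single m c)
  then show ?case
    by (induction g rule: mpoly3_induct) (auto simp: pd_mult_mon pd_add algebra_simps)
qed (auto simp: pd_add algebra_simps)

lemma pd_const [simp]: "pd l (const c) = 0" "pd l 1 = 0" "pd l (of_nat n) = 0"
  using pd_mon[of l 0] by (simp_all flip: single_one single_of_nat)

lemma pd_power: "pd l (f ^ n) = of_nat n * f ^ (n - 1) * pd l f"
proof (induction n)
  case (Suc n)
  then show ?case by (cases n) (auto simp: pd_mult algebra_simps)
qed simp

lemma pd_Var: "pd l (Var i) = (if i = l then 1 else 0)"
  by (auto simp: Var_def pd_mon lookup_single)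

lemma ihom_pd: "ihom k f \<Longrightarrow> ihom (k - 1) (pd l f)"
proof -
  assume f: "ihom k f"
  have "ihom (k - 1) (mon (m - Poly_Mapping.single l 1) (of_nat (cexp m l) * c))" 
    if "int (monom_deg m) = k" for m and c :: 'a
  proof (cases "cexp m l = 0")
    case False
    then have "(m - Poly_Mapping.single l 1) + Poly_Mapping.single l 1 = m"
      by (intro cexp_eqI) (auto simp: lookup_add lookup_minus lookup_single when_def)
    then have "monom_deg m = monom_deg (m - Poly_Mapping.single l 1) + 1"
      by (metis monom_deg_add monom_deg_single)
    then show ?thesis using that by (intro ihom_mon) simp
  qed simp
  then show ?thesis unfolding pd_def mext_def using f
    by (intro ihom_sum) (auto simp: ihom_def)
qed

lemma euler_mon: "(\<Sum>i\<in>UNIV. Var i * pd i (mon m c)) = of_nat (monom_deg m) * mon m c"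
proof -
  have "Var i * pd i (mon m c) = mon m (of_nat (cexp m i) * c)" for i
  proof (cases "cexp m i = 0")
    case False
    then have "Poly_Mapping.single i 1 + (m - Poly_Mapping.single i 1) = m"
      by (intro cexp_eqI) (auto simp: lookup_add lookup_minus lookup_single when_def)
    then show ?thesis by (simp add: Var_def pd_mon mult_single)
  qed (simp add: Var_def pd_mon)
  then have "(\<Sum>i\<in>UNIV. Var i * pd i (mon m c)) = mon m (of_nat (monom_deg m) * c)"
    by (simp add: monom_deg_def sum_UNIV_3 algebra_simps flip: single_add)
  then show ?thesis by (simp add: mult_single flip: single_of_nat)
qed

lemma euler:
  assumes "homogeneous d f"
  shows "(\<Sum>i\<in>UNIV. Var i * pd i f) = of_nat d * f"
proof -
  let ?c = "Poly_Mapping.lookup f"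
  have "(\<Sum>i\<in>UNIV. Var i * pd i f) = (\<Sum>i\<in>UNIV. Var i * pd i (\<Sum>m\<in>Poly_Mapping.keys f. mon m (?c m)))"
    by (simp flip: mpoly3_sum_mon)
  also have "\<dots> = (\<Sum>m\<in>Poly_Mapping.keys f. \<Sum>i\<in>UNIV. Var i * pd i (mon m (?c m)))"
    by (subst sum.swap) (simp add: sum_distrib_left)
  also have "\<dots> = (\<Sum>m\<in>Poly_Mapping.keys f. of_nat d * mon m (?c m))"
    using assms by (intro sum.cong) (auto simp: euler_mon homogeneous_def)
  also have "\<dots> = of_nat d * f"
    by (simp flip: sum_distrib_left mpoly3_sum_mon)
  finally show ?thesis .
qed

section \<open>The Cartier operator\<close>

locale pos_char =
  fixes p :: nat and ty :: "'a::alg_closed_field itself"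
  assumes CHAR_eq: "CHAR('a) = p" and p_pos: "p > 0"
begin

lemma prime_p: "Factorial_Ring.prime p"
  using prime_CHAR_semidom[where ?'a = 'a] CHAR_eq p_pos by simp

lemma p_ge_2: "p \<ge> 2"
  using prime_p by (rule prime_ge_2_nat)

lemma frob_add: "(a + b) ^ p = a ^ p + b ^ p" for a b :: 'a
  by (rule freshmans_dream) (use prime_p CHAR_eq in auto)

lemma CHAR_mpoly3: "CHAR('a mpoly3) = p"
proof -
  have "const c = 0 \<longleftrightarrow> c = 0" for c :: 'a
    by (metis single_zero lookup_single_eq)
  then have "of_nat n = (0 :: 'a mpoly3) \<longleftrightarrow> of_nat n = (0::'a)" for n
    by (metis single_of_nat)
  then have "CHAR('a mpoly3) dvd n \<longleftrightarrow> p dvd n" for n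
    by (simp add: of_nat_eq_0_iff_char_dvd CHAR_eq)
  then show ?thesis by (metis dvd_antisym dvd_refl)
qed

lemma mfrob_add: "(a + b) ^ p = a ^ p + b ^ p" for a b :: "'a mpoly3"
  by (rule freshmans_dream) (use prime_p CHAR_mpoly3 in auto)

lemma frob_inj: "a ^ p = b ^ p \<Longrightarrow> a = b" for a b :: 'a
proof -
  assume "a ^ p = b ^ p"
  moreover have "((a - b) + b) ^ p = (a - b) ^ p + b ^ p" by (rule frob_add)
  ultimately show "a = b" by simp
qed

text \<open>The inverse of Frobenius. Roots exist because the field is algebraically closed and are
  unique by \<open>frob_inj\<close>, so \<open>proot\<close> is additive and multiplicative.\<close>

definition proot :: "'a \<Rightarrow> 'a" where
  "proot a = (SOME b. b ^ p = a)"

lemma proot_power [simp]: "proot a ^ p = a"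
  unfolding proot_def by (rule someI_ex) (rule nth_root_exists[OF p_pos])

lemma proot_eqI: "b ^ p = a \<Longrightarrow> proot a = b"
  by (rule frob_inj) simp

lemma proot_simps [simp]: "proot (b ^ p) = b" "proot 0 = 0" 
  "proot (a + b) = proot a + proot b" "proot (a * b) = proot a * proot b"
  using p_pos by (auto intro!: proot_eqI simp: frob_add power_mult_distrib)

lemma frob_of_nat: "(of_nat n :: 'a) ^ p = of_nat n"
  by (induction n) (use p_pos in \<open>auto simp: frob_add\<close>)

text \<open>Over its p-th powers, the polynomial ring is free on the monomials with all exponents
  below \<open>p\<close>. This operator takes the p-th root of the coordinate at the largest of
  them; it is the Cartier operator on top differential forms.\<close>

definition cartier :: "'a mpoly3 \<Rightarrow> 'a mpoly3" where
  "cartier = mext (\<lambda>m c. if \<forall>i. cexp m i mod p = p - 1 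
                        then mon (vec3 (\<lambda>i. cexp m i div p)) (proot c) else 0)"

lemma cartier_add: "cartier (f + g) = cartier f + cartier g"
  unfolding cartier_def by (rule mext_add) (auto simp: single_add)

lemmas cartier_additive [simp] = additive_uminus[of cartier, OF cartier_add]

lemma cartier_mon: "cartier (mon m c) = (if \<forall>i. cexp m i mod p = p - 1 
    then mon (vec3 (\<lambda>i. cexp m i div p)) (proot c) else 0)"
  unfolding cartier_def by (rule mext_mon) auto

lemma mon_power: "mon m c ^ n = mon (vec3 (\<lambda>i. n * cexp m i)) (c ^ n)" for c :: 'a
proof (induction n)
  case 0
  have "vec3 (\<lambda>i. 0) = 0" by (rule cexp_eqI) simp
  then show ?case by simp
next
  case (Suc n)
  have "m + vec3 (\<lambda>i. n * cexp m i) = vec3 (\<lambda>i. Suc n * cexp m i)" 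
    by (rule cexp_eqI) (simp add: lookup_add)
  then show ?case using Suc by (simp add: mult_single)
qed

text \<open>A p-th power of a monomial leaves all exponents unchanged modulo \<open>p\<close> and
  only shifts the quotients.\<close>

lemma cartier_power_mult: "cartier (h ^ p * f) = h * cartier f"
proof (induction h rule: mpoly3_induct)
  case (single m c)
  show ?case
  proof (induction f rule: mpoly3_induct)
    case (single n e)
    have "m + vec3 (\<lambda>i. cexp n i div p) = vec3 (\<lambda>i. cexp (vec3 (\<lambda>i. p * cexp m i) + n) i div p)"
      by (rule cexp_eqI) (use p_pos in \<open>simp add: lookup_add\<close>)
    then show ?case 
      by (simp add: mon_power mult_single cartier_mon lookup_add)
  qed (auto simp: cartier_add algebra_simps)
qed (auto simp: cartier_add mfrob_add algebra_simps zero_power[OF p_pos])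

text \<open>Exact forms are killed: an exponent congruent to \<open>p - 1\<close> after
  differentiation was divisible by \<open>p\<close> before, and then the coefficient is
  zero.\<close>

lemma cartier_pd: "cartier (pd l f) = 0"
proof (induction f rule: mpoly3_induct)
  case (single m c)
  show ?case
  proof (cases "\<forall>i. cexp (m - Poly_Mapping.single l 1) i mod p = p - 1")
    case True
    have "(cexp m l - 1) mod p = p - 1" using spec[OF True, of l] by (simp add: lookup_minus)
    show ?thesis
    proof (cases "cexp m l = 0")
      case False
      then obtain n where n: "cexp m l = Suc n" by (metis not0_implies_Suc)
      then have "n mod p = p - 1" using \<open>(cexp m l - 1) mod p = p - 1\<close> by simp
      then have "p dvd Suc n" using p_pos by (simp add: mod_Suc dvd_eq_mod_eq_0)
      then have "of_nat (cexp m l) = (0::'a)" using n CHAR_eq of_nat_eq_0_iff_char_dvd by metis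
      then show ?thesis by (simp add: pd_mon)
    qed (simp add: pd_mon)
  qed (auto simp: pd_mon cartier_mon)
qed (auto simp: pd_add cartier_add)

definition allX :: "'a mpoly3" where
  "allX = mon (vec3 (\<lambda>_. p - 1)) 1"

text \<open>As \<open>cartier allX = 1\<close>, p-th powers can be taken out. This explicit preimage
  starts the induction in \<open>cartier_power_surj\<close>.\<close>

lemma cartier_surj: "cartier (w ^ p * allX) = w"
proof -
  have "vec3 (\<lambda>i. (p - 1) div p) = 0" using p_pos by (intro cexp_eqI) simp
  moreover have "(p - 1) mod p = p - 1" using p_pos by simp
  ultimately have "cartier allX = 1" using proot_simps(1)[of 1]
    by (simp add: allX_def cartier_mon del: proot_simps(1))
  then show ?thesis by (simp add: cartier_power_mult)
qed

lemma ihom_allX: "ihom (3 * (int p - 1)) allX"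
  unfolding allX_def by (rule ihom_mon) (use p_pos in \<open>simp add: monom_deg_def sum_UNIV_3\<close>)

end

section \<open>Ideals as plain sets, and polynomials free of given variables\<close>

definition mideal :: "'b::comm_ring_1 set \<Rightarrow> bool" where
  "mideal J \<longleftrightarrow> 0 \<in> J \<and> (\<forall>a\<in>J. \<forall>b\<in>J. a + b \<in> J) \<and> (\<forall>a\<in>J. \<forall>r. r * a \<in> J)"

lemma mideal_zero: "mideal J \<Longrightarrow> 0 \<in> J"
  and mideal_add: "mideal J \<Longrightarrow> a \<in> J \<Longrightarrow> b \<in> J \<Longrightarrow> a + b \<in> J"
  and mideal_mult: "mideal J \<Longrightarrow> a \<in> J \<Longrightarrow> r * a \<in> J"
  and mideal_mult_right: "mideal J \<Longrightarrow> a \<in> J \<Longrightarrow> a * r \<in> J"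
  unfolding mideal_def by (auto simp: mult.commute)

lemma mideal_diff: "mideal J \<Longrightarrow> a \<in> J \<Longrightarrow> b \<in> J \<Longrightarrow> a - b \<in> J"
  using mideal_add[of J a "(-1) * b"] mideal_mult[of J b "-1"] by simp

lemma mideal_sum: "mideal J \<Longrightarrow> (\<And>i. i \<in> A \<Longrightarrow> f i \<in> J) \<Longrightarrow> sum f A \<in> J"
  by (induction A rule: infinite_finite_induct) (auto intro: mideal_zero mideal_add)

definition free_of :: "3 set \<Rightarrow> 'a::zero mpoly3 \<Rightarrow> bool" where
  "free_of L s \<longleftrightarrow> (\<forall>m\<in>Poly_Mapping.keys s. \<forall>i\<in>L. cexp m i = 0)"

lemma free_of_mult: "free_of L f \<Longrightarrow> free_of L g \<Longrightarrow> free_of L (f * g)"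
  for f :: "'a::comm_ring_1 mpoly3"
  unfolding free_of_def using keys_mult[of f g] by (fastforce simp: lookup_add)

lemma free_of_mon: "(\<And>i. i \<in> L \<Longrightarrow> cexp m i = 0) \<Longrightarrow> free_of L (mon m c)"
  by (auto simp: free_of_def)

lemma pd_free_of: "free_of {l} s \<Longrightarrow> pd l s = 0"
  unfolding pd_def mext_def by (rule sum.neutral) (auto simp: free_of_def)

lemma lookup_mon_mult: "Poly_Mapping.lookup (mon u c * r) (u + m) = c * Poly_Mapping.lookup r m"
  for r :: "'a::comm_ring_1 mpoly3"
proof (induction r rule: mpoly3_induct)
  case (single n e)
  then show ?case by (simp add: mult_single lookup_single when_def)
qed (auto simp: lookup_add algebra_simps)

text \<open>The expression \<open>((f + h)\<^sup>p - f\<^sup>p - h\<^sup>p) / p\<close> has integer coefficients; its formal derivative is the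
  defect of additivity of \<open>f \<mapsto> f\<^sup>p\<^sup>-\<^sup>1 \<partial>f\<close>.\<close>

lemma power_pred_pd_additive:
  fixes f h :: "'a::comm_ring_1 mpoly3"
  assumes "Factorial_Ring.prime p"
  shows "\<exists>P. (f + h) ^ (p - 1) * pd l (f + h) = f ^ (p - 1) * pd l f + h ^ (p - 1) * pd l h + pd l P"
proof -
  have p: "p \<ge> 2" using assms by (rule prime_ge_2_nat)
  \<comment> \<open>The coefficients of \<open>P\<close>: the inner binomial coefficients are
    divisible by \<open>p\<close>.\<close>
  define b where "b i = (p choose i) div p" for i
  have pb: "p * b i = p choose i" if "0 < i" "i < p" for i
    unfolding b_def using that assms by (auto intro!: dvd_mult_div_cancel dvd_choose_prime)
  have b1: "b (Suc i) * Suc i = (p - 1) choose i" if "Suc i < p" for i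
  proof -
    have "p * (b (Suc i) * Suc i) = Suc i * (p choose Suc i)"
      using pb[of "Suc i"] that by (metis mult.assoc mult.commute zero_less_Suc)
    also have "\<dots> = p * ((p - 1) choose i)" by (rule binomial_absorption)
    finally show ?thesis using p by simp
  qed
  have b2: "b i * (p - i) = (p - 1) choose i" if "0 < i" "i < p" for i
  proof -
    have "p * (b i * (p - i)) = (p - i) * (p choose i)"
      using pb[of i] that by (metis mult.assoc mult.commute)
    also have "\<dots> = p * ((p - 1) choose i)" by (rule binomial_absorb_comp)
    finally show ?thesis using p by simp
  qed
  define c where "c i = (of_nat ((p - 1) choose i) * f ^ i * h ^ (p - 1 - i) :: 'a mpoly3)" for i
  define P where "P = (\<Sum>i\<in>{1..<p}. of_nat (b i) * (f ^ i * h ^ (p - i)))"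
  have bin: "(f + h) ^ (p - 1) = (\<Sum>i\<in>{0..<p}. c i)"
    unfolding c_def binomial_ring using p by (intro sum.cong) auto
  have s1: "{0..<p} = insert 0 {1..<p}" and s2: "{0..<p} = insert (p - 1) {0..<p-1}"
    using p by auto
  \<comment> \<open>The product rule gives every term one part with \<open>pd l f\<close> and one
    with \<open>pd l h\<close>; \<open>b1\<close> and \<open>b2\<close> turn the factors into
    binomial coefficients for the exponent \<open>p - 1\<close>.\<close>
  have "pd l P = (\<Sum>i\<in>{1..<p}. of_nat (b i) * pd l (f ^ i * h ^ (p - i)))"
    by (simp add: P_def pd_mult)
  also have "\<dots> = (\<Sum>i\<in>{1..<p}. c (i - 1) * pd l f + c i * pd l h)"
  proof (rule sum.cong[OF refl])
    fix i assume i: "i \<in> {1..<p}"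
    then obtain j where j: "i = Suc j" by (cases i) auto
    have "of_nat (b i) * pd l (f ^ i * h ^ (p - i)) = 
       of_nat (b (Suc j) * Suc j) * f ^ j * h ^ (p - i) * pd l f + of_nat (b i * (p - i)) * f ^ i * h ^ (p - i - 1) * pd l h"
    proof -
      have d1: "pd l (f ^ i) = of_nat (Suc j) * f ^ j * pd l f"
        by (simp only: pd_power j diff_Suc_1)
      have d2: "pd l (h ^ (p - i)) = of_nat (p - i) * h ^ (p - i - 1) * pd l h"
        by (rule pd_power)
      show ?thesis unfolding pd_mult d1 d2 of_nat_mult unfolding j
        by (simp only: distrib_left ac_simps)
    qed
    also have "\<dots> = c j * pd l f + c i * pd l h"
      using b1[of j] b2[of i] i j by (simp add: c_def del: of_nat_mult)
    finally show "of_nat (b i) * pd l (f ^ i * h ^ (p - i)) = c (i - 1) * pd l f + c i * pd l h"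
      using j by simp
  qed
  also have "\<dots> = (\<Sum>i\<in>{1..<p}. c (i - 1)) * pd l f + (\<Sum>i\<in>{1..<p}. c i) * pd l h"
    by (simp add: sum.distrib sum_distrib_right)
  also have "(\<Sum>i\<in>{1..<p}. c (i - 1)) = (\<Sum>i\<in>{0..<p-1}. c i)"
    by (rule sum.reindex_bij_witness[of _ Suc "\<lambda>i. i - 1"]) auto
  \<comment> \<open>Each of the two sums is the expansion of \<open>(f + h) ^ (p - 1)\<close> short
    of one end term.\<close>
  also have "\<dots> = (f + h) ^ (p - 1) - f ^ (p - 1)"
    unfolding bin s2 by (simp add: c_def)
  also have "(\<Sum>i\<in>{1..<p}. c i) = (f + h) ^ (p - 1) - h ^ (p - 1)"
    unfolding bin s1 by (simp add: c_def)
  finally have "(f + h) ^ (p - 1) * pd l (f + h) = f ^ (p - 1) * pd l f + h ^ (p - 1) * pd l h + pd l P"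
    by (simp add: pd_add algebra_simps)
  then show ?thesis by blast
qed

section \<open>The logarithmic Cartier formula and the descent to constants\<close>

context pos_char begin

text \<open>For a monomial \<open>f\<close>, the product \<open>f ^ (p - 1) * pd l f\<close> equals
  \<open>(pd l f) ^ p * Var l ^ (p - 1)\<close>: the exponents agree, and Frobenius fixes the
  integer factor.\<close>

lemma cartier_log_mon:
  assumes "free_of {l} s"
  shows "cartier (mon m c ^ (p - 1) * pd l (mon m c) * s) = pd l (mon m c) * cartier (Var l ^ (p - 1) * s)"
proof (cases "cexp m l = 0")
  case False
  let ?n = "m - Poly_Mapping.single l 1" and ?k = "of_nat (cexp m l) :: 'a"
  have Var: "Var l ^ (p - 1) = mon (vec3 (\<lambda>i. if i = l then p - 1 else 0)) (1::'a)"
    unfolding Var_def mon_power by (simp add: lookup_single when_def if_distrib eq_commute[of l] cong: if_cong)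
  have e: "vec3 (\<lambda>i. (p - 1) * cexp m i) + ?n = vec3 (\<lambda>i. p * cexp ?n i) + vec3 (\<lambda>i. if i = l then p - 1 else 0)"
  proof (rule cexp_eqI)
    fix i
    obtain q where "p = Suc q" using p_pos by (cases p) auto
    moreover obtain k where "cexp m l = Suc k" using False by (cases "cexp m l") auto
    ultimately show "cexp (vec3 (\<lambda>i. (p - 1) * cexp m i) + ?n) i = 
       cexp (vec3 (\<lambda>i. p * cexp ?n i) + vec3 (\<lambda>i. if i = l then p - 1 else 0)) i"
      by (auto simp: lookup_add lookup_minus lookup_single when_def)
  qed
  have "c ^ (p - 1) * (?k * c) = (?k * c) ^ p"
    using power_minus_mult[OF p_pos, of c]
    by (simp add: power_mult_distrib frob_of_nat mult.left_commute)
  then have "mon m c ^ (p - 1) * pd l (mon m c) = mon ?n (?k * c) ^ p * Var l ^ (p - 1)"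
    by (simp add: pd_mon mon_power mult_single Var e del: One_nat_def)
  then show ?thesis by (simp add: cartier_power_mult mult.assoc pd_mon)
qed (simp add: pd_mon)

text \<open>Extends from monomials to sums: the defect of additivity is a derivative
  \<open>pd l P\<close>. It remains a derivative after multiplication by \<open>s\<close>, a
  constant for \<open>pd l\<close>, and is therefore killed.\<close>

lemma cartier_log:
  assumes "free_of {l} s"
  shows "cartier (g ^ (p - 1) * pd l g * s) = pd l g * cartier (Var l ^ (p - 1) * s)"
proof (induction g rule: mpoly3_induct)
  case (single m c)
  then show ?case using assms by (rule cartier_log_mon)
next
  case (add f h)
  obtain P where P: "(f + h) ^ (p - 1) * pd l (f + h) = f ^ (p - 1) * pd l f + h ^ (p - 1) * pd l h + pd l P"
    using power_pred_pd_additive[OF prime_p] by blast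
  have "pd l P * s = pd l (P * s)" using pd_free_of[OF assms] by (simp add: pd_mult)
  then show ?case using add unfolding P by (simp add: distrib_right cartier_add cartier_pd pd_add)
qed simp

lemma lookup_cartier: "Poly_Mapping.lookup (cartier f) n = proot (Poly_Mapping.lookup f (vec3 (\<lambda>i. p * cexp n i + (p - 1))))"
proof (induction f rule: mpoly3_induct)
  case (single m c)
  have "m = vec3 (\<lambda>i. p * cexp n i + (p - 1)) \<longleftrightarrow> (\<forall>i. cexp m i mod p = p - 1) \<and> vec3 (\<lambda>i. cexp m i div p) = n"
    (is "?l \<longleftrightarrow> ?r1 \<and> ?r2")
  proof
    assume m: ?l
    show "?r1 \<and> ?r2"
    proof
      have "(p * k + (p - 1)) mod p = p - 1" for k 
        by (subst mod_mult_self4) (use p_pos in simp)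
      then show ?r1 unfolding m cexp_vec3 by blast
      have "(p * k + (p - 1)) div p = k" for k 
        by (subst div_mult_self4) (use p_pos in auto)
      then show ?r2 by (intro cexp_eqI) (simp only: m cexp_vec3)
    qed
  next
    assume r: "?r1 \<and> ?r2"
    show ?l
    proof (rule cexp_eqI)
      fix i
      have "cexp m i = p * (cexp m i div p) + cexp m i mod p" by simp
      moreover have "cexp m i div p = cexp n i" using r by auto
      ultimately show "cexp m i = cexp (vec3 (\<lambda>i. p * cexp n i + (p - 1))) i" using r by simp
    qed
  qed
  then show ?case by (auto simp: cartier_mon lookup_single when_def)
qed (auto simp: cartier_add lookup_add)

text \<open>Polynomials free of \<open>L\<close> lack the exponents \<open>p - 1\<close> in
  \<open>L\<close> that \<open>cartier\<close> asks for; this monomial supplies them.\<close>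

definition cut :: "3 set \<Rightarrow> 'a mpoly3" where
  "cut L = mon (vec3 (\<lambda>i. if i \<in> L then p - 1 else 0)) 1"

text \<open>Multiplication by a monomial brings a chosen monomial of \<open>r\<close> into the
  residue class that \<open>cartier\<close> keeps, and \<open>cartier\<close> then divides degrees
  by \<open>p\<close>. Repetition ends with a nonzero constant. The predicate \<open>P\<close>
  stands for membership in an ideal or in a colon ideal.\<close>

lemma cartier_descent:
  assumes "P r" "free_of L r" "r \<noteq> 0"
    and mult: "\<And>s t. P s \<Longrightarrow> free_of L t \<Longrightarrow> P (s * t)"
    and cart: "\<And>s. P s \<Longrightarrow> free_of L s \<Longrightarrow> P (cartier (cut L * s))"
  shows "P 1"
proof -
  have "P 1" if "P r" "free_of L r" "r \<noteq> 0" "\<forall>m\<in>Poly_Mapping.keys r. monom_deg m \<le> N" for N r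
    using that
  proof (induction N arbitrary: r rule: less_induct)
    case (less N)
    obtain m where m: "m \<in> Poly_Mapping.keys r" using \<open>r \<noteq> 0\<close> by (metis keys_eq_empty ex_in_conv)
    show ?case
    proof (cases "N = 0")
      case True
      have "n = 0" if "n \<in> Poly_Mapping.keys r" for n
        using less.prems(4) that True by (intro cexp_eqI) (auto simp: monom_deg_def)
      then have "Poly_Mapping.keys r = {0}" using m by auto
      then have r: "r = const (Poly_Mapping.lookup r 0)" "Poly_Mapping.lookup r 0 \<noteq> 0"
        using mpoly3_sum_mon[of r] by (auto simp flip: in_keys_iff)
      have "P (r * const (inverse (Poly_Mapping.lookup r 0)))"
        by (intro mult less.prems free_of_mon) simp
      also have "r * const (inverse (Poly_Mapping.lookup r 0)) = const (Poly_Mapping.lookup r 0 * inverse (Poly_Mapping.lookup r 0))"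
        by (subst r(1)) (simp add: mult_single)
      also have "\<dots> = 1" using r(2) by simp
      finally show ?thesis .
    next
      case False
      \<comment> \<open>Raises every exponent of \<open>m\<close> to one congruent to
        \<open>p - 1\<close>. As \<open>r\<close> is free of \<open>L\<close>, the part of
        \<open>u\<close> in \<open>L\<close> is \<open>cut L\<close>, and the rest \<open>t\<close>
        is free of \<open>L\<close>.\<close>
      define u where "u = vec3 (\<lambda>i. p - 1 - cexp m i mod p)"
      define t :: "'a mpoly3" where "t = mon (vec3 (\<lambda>i. if i \<in> L then 0 else p - 1 - cexp m i mod p)) 1"
      define r' where "r' = cartier (mon u 1 * r)"
      have "vec3 (\<lambda>i. if i \<in> L then p - 1 else 0) + vec3 (\<lambda>i. if i \<in> L then 0 else p - 1 - cexp m i mod p) = u"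
        using less.prems(2) m by (intro cexp_eqI) (auto simp: u_def lookup_add free_of_def)
      then have "cut L * t = mon u 1"
        by (simp add: cut_def t_def mult_single)
      then have r': "r' = cartier (cut L * (r * t))" 
        by (metis r'_def mult.commute mult.left_commute)
      have t: "free_of L t" unfolding t_def by (rule free_of_mon) simp
      \<comment> \<open>Exponents of \<open>u\<close> are at most \<open>p - 1\<close>. This bound
        yields both the smaller degree and the freeness of \<open>r'\<close>.\<close>
      have key: "\<exists>n'\<in>Poly_Mapping.keys r. \<forall>i. p * cexp n i \<le> cexp n' i" if "n \<in> Poly_Mapping.keys r'" for n
      proof -
        from that have "vec3 (\<lambda>i. p * cexp n i + (p - 1)) \<in> Poly_Mapping.keys (mon u 1 * r)"
          unfolding r'_def in_keys_iff lookup_cartier by auto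
        then obtain n' where n': "n' \<in> Poly_Mapping.keys r" "vec3 (\<lambda>i. p * cexp n i + (p - 1)) = u + n'"
          using keys_mult[of "mon u 1" r] by auto
        have "p * cexp n i \<le> cexp n' i" for i
        proof -
          have "p * cexp n i + (p - 1) = cexp (u + n') i" by (simp flip: n'(2))
          then show ?thesis by (simp add: u_def lookup_add)
        qed
        then show ?thesis using n' by blast
      qed
      \<comment> \<open>No cancellation can occur, since each coefficient of \<open>r'\<close> comes
        from a single coefficient of \<open>r\<close>.\<close>
      have "r' \<noteq> 0"
      proof -
        have "u + m = vec3 (\<lambda>i. p * cexp (vec3 (\<lambda>i. cexp m i div p)) i + (p - 1))"
        proof (rule cexp_eqI)
          fix i
          have "cexp m i = p * (cexp m i div p) + cexp m i mod p" "cexp m i mod p < p" using p_pos by auto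
          then show "cexp (u + m) i = cexp (vec3 (\<lambda>i. p * cexp (vec3 (\<lambda>i. cexp m i div p)) i + (p - 1))) i"
            unfolding u_def lookup_add cexp_vec3 by arith
        qed
        then have "Poly_Mapping.lookup r' (vec3 (\<lambda>i. cexp m i div p)) = proot (Poly_Mapping.lookup r m)"
          using lookup_mon_mult[of u 1 r m] by (simp add: r'_def lookup_cartier)
        moreover have "proot (Poly_Mapping.lookup r m) \<noteq> 0"
          using m p_pos by (metis in_keys_iff proot_power power_0_left neq0_conv)
        ultimately show ?thesis by auto
      qed
      moreover have "free_of L r'"
        unfolding free_of_def
      proof (intro ballI)
        fix n i assume n: "n \<in> Poly_Mapping.keys r'" and i: "i \<in> L"
        obtain n' where "n' \<in> Poly_Mapping.keys r" "p * cexp n i \<le> cexp n' i" using key[OF n] by blast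
        then show "cexp n i = 0" using less.prems(2) i p_pos by (auto simp: free_of_def)
      qed
      moreover have "monom_deg n \<le> N div p" if "n \<in> Poly_Mapping.keys r'" for n
      proof -
        obtain n' where n': "n' \<in> Poly_Mapping.keys r" "\<forall>i. p * cexp n i \<le> cexp n' i" using key \<open>n \<in> _\<close> by blast
        have "p * monom_deg n \<le> monom_deg n'"
          unfolding monom_deg_def sum_distrib_left by (rule sum_mono) (use n' in auto)
        also have "\<dots> \<le> N" using n' less.prems(4) by blast
        finally show ?thesis using p_pos by (simp add: less_eq_div_iff_mult_less_eq mult.commute)
      qed
      moreover have "P r'" unfolding r'
        by (intro cart mult less.prems t free_of_mult)
      moreover have "N div p < N" using False p_ge_2 by (intro div_less_dividend) auto
      ultimately show ?thesis using less.IH by blast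
    qed
  qed
  moreover have "\<forall>m\<in>Poly_Mapping.keys r. monom_deg m \<le> Max (monom_deg ` Poly_Mapping.keys r)" by simp
  ultimately show ?thesis using assms(1-3) by blast
qed

text \<open>Settles the case \<open>g = 0\<close>, where the ideal is stable under
  \<open>cartier\<close> itself.\<close>

lemma cartier_stable_one:
  assumes "mideal J" "\<And>s. s \<in> J \<Longrightarrow> cartier s \<in> J" "r \<in> J" "r \<noteq> 0"
  shows "1 \<in> J"
  by (rule cartier_descent[of "\<lambda>s. s \<in> J" r "{}"])
     (use assms in \<open>auto simp: free_of_def intro: mideal_mult mideal_mult_right\<close>)

text \<open>By \<open>cartier_log\<close> the factor \<open>pd l g\<close> passes through the
  operator, so \<open>cartier_descent\<close> applies to the condition
  \<open>pd l g * s \<in> J\<close>.\<close>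

lemma cartier_stable_pd:
  assumes "mideal J" "\<And>s. s \<in> J \<Longrightarrow> cartier (g ^ (p - 1) * s) \<in> J" "r \<in> J" "r \<noteq> 0" "free_of {l} r"
  shows "pd l g \<in> J"
proof -
  have "cut {l} = Var l ^ (p - 1)"
    unfolding Var_def mon_power cut_def by (simp add: lookup_single when_def if_distrib eq_commute[of l] cong: if_cong)
  then have "pd l g * cartier (cut {l} * s) \<in> J" if "pd l g * s \<in> J" "free_of {l} s" for s
    using that assms(2)[of "pd l g * s"] cartier_log[of l s g] by (simp add: mult.assoc)
  then have "pd l g * 1 \<in> J"
    using assms(1,3-5)
    by (intro cartier_descent[of "\<lambda>s. pd l g * s \<in> J" r "{l}"])
       (auto simp: mult.assoc[symmetric] intro: mideal_mult mideal_mult_right)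
  then show ?thesis by simp
qed

end

section \<open>Counting dimensions\<close>

context vector_space begin

text \<open>\<open>dim\<close> is informative only for spaces with a finite basis, so finiteness is
  recorded separately. The spanning set need not lie in \<open>V\<close>, which lets the property
  pass to subsets.\<close>

definition fdim :: "'b set \<Rightarrow> bool" where
  "fdim V \<longleftrightarrow> (\<exists>B. finite B \<and> V \<subseteq> local.span B)"

lemma fdim_mono: "V \<subseteq> W \<Longrightarrow> local.fdim W \<Longrightarrow> local.fdim V"
  unfolding fdim_def by blast

lemma fdim_basis:
  assumes "local.fdim V" "B \<subseteq> V" "local.independent B"
  obtains C where "B \<subseteq> C" "C \<subseteq> V" "local.independent C" "V \<subseteq> local.span C" "finite C"
proof -
  obtain C where C: "B \<subseteq> C" "C \<subseteq> V" "local.independent C" "V \<subseteq> local.span C"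
    using maximal_independent_subset_extend[OF assms(2,3)] .
  moreover obtain D where D: "finite D" "V \<subseteq> local.span D"
    using assms(1) unfolding fdim_def by blast
  moreover have "finite C"
    using independent_span_bound[OF D(1) C(3)] order_trans[OF C(2) D(2)] by simp
  ultimately show ?thesis using that by blast
qed

lemma fdim_basis_exists:
  assumes "local.fdim V"
  obtains C where "C \<subseteq> V" "local.independent C" "V \<subseteq> local.span C" "finite C"
  using fdim_basis[OF assms empty_subsetI independent_empty] .

lemma fdim_dim_mono:
  assumes "V \<subseteq> W" "local.fdim W"
  shows "local.dim V \<le> local.dim W"
proof -
  obtain B where B: "B \<subseteq> V" "local.independent B" "V \<subseteq> local.span B" "finite B"
    using fdim_basis_exists[OF fdim_mono[OF assms]] .
  obtain C where C: "B \<subseteq> C" "C \<subseteq> W" "local.independent C" "W \<subseteq> local.span C" "finite C"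
    using fdim_basis[of W B] assms B by auto
  have "local.dim V = card B" "local.dim W = card C" using B C basis_card_eq_dim[of B V] basis_card_eq_dim[of C W] by simp_all
  then show ?thesis using card_mono[OF C(5,1)] by simp
qed

lemma fdim_dim_eq:
  assumes "V \<subseteq> W" "local.fdim W" "local.subspace V" "local.dim W \<le> local.dim V"
  shows "V = W"
proof -
  obtain B where B: "B \<subseteq> V" "local.independent B" "V \<subseteq> local.span B" "finite B"
    using fdim_basis_exists[OF fdim_mono[OF assms(1,2)]] .
  obtain C where C: "B \<subseteq> C" "C \<subseteq> W" "local.independent C" "W \<subseteq> local.span C" "finite C"
    using fdim_basis[of W B] assms B by auto
  have "local.dim V = card B" "local.dim W = card C" using B C basis_card_eq_dim[of B V] basis_card_eq_dim[of C W] by simp_all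
  then have "B = C" using card_seteq[OF C(5,1)] assms(4) by simp
  then show ?thesis using C B assms(1,3) span_minimal[of B V] by blast
qed

lemma independent_span_disjoint:
  assumes "local.independent (B \<union> D)" "B \<inter> D = {}" "finite B" "finite D" "x \<in> local.span B" "x \<in> local.span D"
  shows "x = 0"
proof -
  obtain u where u: "x = (\<Sum>v\<in>B. u v *s v)" using assms(3,5) by (auto simp: span_finite)
  obtain w where w: "x = (\<Sum>v\<in>D. w v *s v)" using assms(4,6) by (auto simp: span_finite)
  define c where "c v = (if v \<in> B then u v else - w v)" for v
  have "(\<Sum>v\<in>B \<union> D. c v *s v) = (\<Sum>v\<in>B. c v *s v) + (\<Sum>v\<in>D. c v *s v)"
    using assms by (intro sum.union_disjoint) auto
  also have "(\<Sum>v\<in>B. c v *s v) = x" by (simp add: u c_def)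
  also have "(\<Sum>v\<in>D. c v *s v) = (\<Sum>v\<in>D. - (w v *s v))" 
    using assms(2) by (intro sum.cong) (auto simp: c_def)
  also have "\<dots> = - x" by (simp add: w sum_negf)
  finally have "(\<Sum>v\<in>B \<union> D. c v *s v) = 0" by simp
  then have "c v = 0" if "v \<in> B" for v
    using independentD[OF assms(1), of "B \<union> D" c v] assms(3,4) that by auto
  then show ?thesis unfolding u by (intro sum.neutral) (auto simp: c_def)
qed

text \<open>A basis \<open>B\<close> of the kernel is extended to a basis \<open>C\<close> of
  \<open>V\<close>; the added vectors span a complement on which \<open>T\<close> is
  injective.\<close>

lemma rank_nullity:
  assumes T: "Vector_Spaces.linear scale scale T" and V: "local.subspace V" "local.fdim V"
  shows "local.dim V = local.dim (T ` V) + local.dim {v \<in> V. T v = 0}"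
proof -
  interpret T: Vector_Spaces.linear scale scale T by (rule T)
  let ?K = "{v \<in> V. T v = 0}"
  have K: "local.subspace ?K"
    using V(1) by (auto simp: subspace_def T.add T.scale)
  obtain B where B: "B \<subseteq> ?K" "local.independent B" "?K \<subseteq> local.span B" "finite B"
    using fdim_basis_exists[OF fdim_mono[OF _ V(2), of ?K]] by blast
  obtain C where C: "B \<subseteq> C" "C \<subseteq> V" "local.independent C" "V \<subseteq> local.span C" "finite C"
    using fdim_basis[of V B] V(2) B by auto
  let ?D = "C - B"
  have D: "?D \<subseteq> V" using C by auto
  have spanD: "local.span ?D \<subseteq> V" using D V(1) by (rule span_minimal)
  have inj: "inj_on T (local.span ?D)"
    unfolding T.inj_on_iff_eq_0[OF subspace_span]
  proof (intro ballI impI)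
    fix x assume x: "x \<in> local.span ?D" "T x = 0"
    then have "x \<in> local.span B" using spanD B(3) by auto
    then show "x = 0"
      using independent_span_disjoint[of B ?D x] x(1) C B(4) by (simp add: Un_absorb1)
  qed
  have ind: "local.independent (T ` ?D)"
    using T.independent_injective_image[OF independent_mono[OF C(3)] inj] by auto
  have "T ` V \<subseteq> local.span (T ` ?D)"
  proof
    fix y assume "y \<in> T ` V"
    then have "y \<in> T ` local.span C" using C(4) by auto
    then have "y \<in> local.span (T ` C)" by (simp add: T.span_image)
    moreover have "T ` C \<subseteq> local.span (T ` ?D)"
    proof
      fix z assume "z \<in> T ` C"
      then obtain v where v: "v \<in> C" "z = T v" by auto
      show "z \<in> local.span (T ` ?D)"
      proof (cases "v \<in> B")
        case True
        then have "z = 0" using B(1) v by auto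
        then show ?thesis by (simp add: span_zero)
      next
        case False
        then show ?thesis using v by (intro span_base) auto
      qed
    qed
    ultimately show "y \<in> local.span (T ` ?D)" using span_minimal[OF _ subspace_span] by blast
  qed
  then have "local.dim (T ` V) = card (T ` ?D)"
    using D ind by (intro dim_unique[OF _ _ ind]) auto
  also have "\<dots> = card ?D"
    using inj span_superset by (intro card_image) (rule inj_on_subset)
  also have "\<dots> = card C - card B"
    using C(1) B(4) by (rule card_Diff_subset[rotated])
  finally have "local.dim (T ` V) = local.dim V - local.dim ?K" "local.dim ?K \<le> local.dim V"
    using B C basis_card_eq_dim[of B ?K] basis_card_eq_dim[of C V] card_mono[OF C(5,1)] by auto
  then show ?thesis by simp
qed

lemma dim_image_inj:
  assumes "Vector_Spaces.linear scale scale T" "local.subspace V" "local.fdim V" "\<And>v. v \<in> V \<Longrightarrow> T v = 0 \<Longrightarrow> v = 0"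
  shows "local.dim (T ` V) = local.dim V"
proof -
  have "{v \<in> V. T v = 0} \<subseteq> {0}" using assms(4) by auto
  then have "local.dim {v \<in> V. T v = 0} \<le> card ({} :: 'b set)" by (intro dim_le_card) auto
  then show ?thesis using rank_nullity[OF assms(1-3)] by simp
qed

lemma fdim_image:
  assumes "Vector_Spaces.linear scale scale T" "local.fdim V"
  shows "local.fdim (T ` V)"
proof -
  interpret T: Vector_Spaces.linear scale scale T by (rule assms)
  obtain B where "finite B" "V \<subseteq> local.span B" using assms(2) unfolding fdim_def by blast
  then have "finite (T ` B)" "T ` V \<subseteq> local.span (T ` B)" using T.spans_image by auto
  then show ?thesis unfolding fdim_def by blast
qed

end

text \<open>Tuples of polynomials are functions on \<open>nat\<close> that vanish from some index on, so that free modules of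
  different ranks are subspaces of one vector space.\<close>

definition fscale :: "'a::field \<Rightarrow> (nat \<Rightarrow> 'a mpoly3) \<Rightarrow> nat \<Rightarrow> 'a mpoly3" where
  "fscale c f = (\<lambda>i. const c * f i)"

interpretation FV: vector_space fscale
  by unfold_locales
     (auto simp: fscale_def fun_eq_iff algebra_simps single_add mult_single mult.assoc[symmetric])

definition poly_fun :: "(nat \<Rightarrow> (3 \<Rightarrow>\<^sub>0 nat) set) \<Rightarrow> (nat \<Rightarrow> 'a::field mpoly3) set" where
  "poly_fun M = {f. \<forall>i. Poly_Mapping.keys (f i) \<subseteq> M i}"

text \<open>Linearity over the polynomial ring; multipliers that are constants give linearity over
  the field.\<close>

definition slinear :: "((nat \<Rightarrow> 'a::field mpoly3) \<Rightarrow> (nat \<Rightarrow> 'a mpoly3)) \<Rightarrow> bool" where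
  "slinear T \<longleftrightarrow> (\<forall>f h. T (\<lambda>i. f i + h i) = (\<lambda>i. T f i + T h i)) \<and> (\<forall>s f. T (\<lambda>i. s * f i) = (\<lambda>i. s * T f i))"

lemma slinear_linear: "slinear T \<Longrightarrow> Vector_Spaces.linear fscale fscale T"
proof -
  assume T: "slinear T"
  have "T (f + h) = T f + T h" for f h
    using T unfolding slinear_def plus_fun_def by blast
  moreover have "T (fscale c f) = fscale c (T f)" for c f
    using T unfolding slinear_def fscale_def by blast
  ultimately show ?thesis
    using FV.vector_space_axioms by (simp add: Vector_Spaces.linear_iff)
qed

lemma subspace_poly_fun: "FV.subspace (poly_fun M :: (nat \<Rightarrow> 'a::field mpoly3) set)"
proof (rule FV.subspaceI)
  show "0 \<in> poly_fun M" by (simp add: poly_fun_def)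
next
  fix f h :: "nat \<Rightarrow> 'a mpoly3" assume "f \<in> poly_fun M" "h \<in> poly_fun M"
  then have "Poly_Mapping.keys (f i + h i) \<subseteq> M i" for i
    using keys_add[of "f i" "h i"] unfolding poly_fun_def by blast
  then show "f + h \<in> poly_fun M" by (simp add: poly_fun_def)
next
  fix c and f :: "nat \<Rightarrow> 'a mpoly3" assume f: "f \<in> poly_fun M"
  have "Poly_Mapping.keys (const c * f i) \<subseteq> M i" for i
  proof -
    have "m \<in> Poly_Mapping.keys (f i)" if "m \<in> Poly_Mapping.keys (const c * f i)" for m
      using that lookup_mon_mult[of 0 c "f i" m] by (auto simp: in_keys_iff)
    then show ?thesis using f by (auto simp: poly_fun_def)
  qed
  then show "fscale c f \<in> poly_fun M" by (simp add: poly_fun_def fscale_def)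
qed

lemma 
  assumes fin: "\<And>i. finite (M i)" and r: "\<And>i. i \<ge> r \<Longrightarrow> M i = {}"
  shows fdim_poly_fun: "FV.fdim (poly_fun M :: (nat \<Rightarrow> 'a::field mpoly3) set)"
    and dim_poly_fun: "FV.dim (poly_fun M :: (nat \<Rightarrow> 'a::field mpoly3) set) = (\<Sum>i<r. card (M i))"
proof -
  define e :: "nat \<times> (3 \<Rightarrow>\<^sub>0 nat) \<Rightarrow> nat \<Rightarrow> 'a mpoly3" 
    where "e = (\<lambda>(i, m) j. if j = i then mon m 1 else 0)"
  define I where "I = (SIGMA i:{..<r}. M i)"
  have finI: "finite I" using fin by (auto simp: I_def)
  have inj: "inj e"
  proof (rule injI)
    fix x y assume "e x = e y"
    then have "e x (fst x) = e y (fst x)" by simp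
    then have "mon (snd x) (1::'a) = (if fst x = fst y then mon (snd y) 1 else 0)"
      by (auto simp: e_def case_prod_unfold)
    then show "x = y"
      by (cases x; cases y) (auto split: if_splits dest: arg_cong[where f = Poly_Mapping.keys])
  qed
  have eI: "e ` I \<subseteq> poly_fun M"
    by (auto simp: e_def I_def poly_fun_def split: if_splits)
  have lin: "(\<Sum>x\<in>I. fscale (c x) (e x)) j = (\<Sum>m\<in>M j. mon m (c (j, m)))" for c j
  proof -
    have "(\<Sum>x\<in>I. fscale (c x) (e x)) j = (\<Sum>x\<in>I. fscale (c x) (e x) j)"
      by (induction I rule: infinite_finite_induct) auto
    also have "\<dots> = (\<Sum>i<r. \<Sum>m\<in>M i. fscale (c (i, m)) (e (i, m)) j)"
      unfolding I_def using fin by (subst sum.Sigma) auto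
    also have "\<dots> = (\<Sum>i<r. if i = j then \<Sum>m\<in>M j. mon m (c (j, m)) else 0)"
    proof (rule sum.cong[OF refl])
      fix i
      have "fscale (c (i, m)) (e (i, m)) j = (if i = j then mon m (c (j, m)) else 0)" for m
        by (simp add: fscale_def e_def mult_single)
      then show "(\<Sum>m\<in>M i. fscale (c (i, m)) (e (i, m)) j) = (if i = j then \<Sum>m\<in>M j. mon m (c (j, m)) else 0)"
        by simp
    qed
    also have "\<dots> = (\<Sum>m\<in>M j. mon m (c (j, m)))"
      using r[of j] by (simp add: sum.delta')
    finally show ?thesis .
  qed
  have span: "poly_fun M \<subseteq> FV.span (e ` I)"
  proof
    fix f :: "nat \<Rightarrow> 'a mpoly3" assume f: "f \<in> poly_fun M"
    have "f = (\<Sum>x\<in>I. fscale (Poly_Mapping.lookup (f (fst x)) (snd x)) (e x))"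
    proof
      fix j
      have "f j = (\<Sum>m\<in>Poly_Mapping.keys (f j). mon m (Poly_Mapping.lookup (f j) m))"
        by (rule mpoly3_sum_mon)
      also have "\<dots> = (\<Sum>m\<in>M j. mon m (Poly_Mapping.lookup (f j) m))"
        using f fin[of j] by (intro sum.mono_neutral_left) (auto simp: poly_fun_def in_keys_iff)
      finally show "f j = (\<Sum>x\<in>I. fscale (Poly_Mapping.lookup (f (fst x)) (snd x)) (e x)) j"
        by (simp add: lin)
    qed
    also have "\<dots> \<in> FV.span (e ` I)"
      by (intro FV.span_sum FV.span_scale FV.span_base) auto
    finally show "f \<in> FV.span (e ` I)" .
  qed
  have ind: "FV.independent (e ` I)"
  proof (rule FV.independent_if_scalars_zero)
    fix c x assume s: "(\<Sum>x\<in>e ` I. fscale (c x) x) = 0" and "x \<in> e ` I"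
    then obtain i m where x: "x = e (i, m)" "(i, m) \<in> I" by auto
    have "(\<Sum>x\<in>I. fscale (c (e x)) (e x)) = 0"
      using s sum.reindex[OF inj_on_subset[OF inj subset_UNIV], of "\<lambda>x. fscale (c x) x" I] by (simp add: o_def)
    then have "(\<Sum>m\<in>M i. mon m (c (e (i, m)))) = 0"
      using lin[of "\<lambda>x. c (e x)" i] by simp
    moreover have "Poly_Mapping.lookup (\<Sum>n\<in>M i. mon n (h n)) m = h m" for h :: "_ \<Rightarrow> 'a"
      using x(2) fin[of i] by (simp add: lookup_sum lookup_single when_def I_def)
    ultimately have "c (e (i, m)) = 0" by (metis lookup_zero)
    then show "c x = 0" by (simp only: x(1))
  qed (rule finite_imageI[OF finI])
  show "FV.fdim (poly_fun M :: (nat \<Rightarrow> 'a mpoly3) set)" unfolding FV.fdim_def using span finI by blast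
  have "FV.dim (poly_fun M :: (nat \<Rightarrow> 'a mpoly3) set) = card (e ` I)"
    using FV.dim_unique[OF eI span ind] by simp
  also have "\<dots> = card I" using inj_on_subset[OF inj subset_UNIV] by (rule card_image)
  also have "\<dots> = (\<Sum>i<r. card (M i))" unfolding I_def using fin by simp
  finally show "FV.dim (poly_fun M :: (nat \<Rightarrow> 'a mpoly3) set) = (\<Sum>i<r. card (M i))" .
qed

section \<open>Counting monomials\<close>

definition mons :: "int \<Rightarrow> (3 \<Rightarrow>\<^sub>0 nat) set" where
  "mons k = {m. int (monom_deg m) = k}"

text \<open>The polynomial agrees with the number of monomials for all \<open>k \<ge> - 2\<close>, but not below.\<close>

definition hilb :: "int \<Rightarrow> int" where
  "hilb k = (k + 1) * (k + 2) div 2"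

lemma ihom_keys: "ihom k f \<longleftrightarrow> Poly_Mapping.keys f \<subseteq> mons k"
  by (auto simp: ihom_def mons_def)

lemma monom_deg_3: "monom_deg m = cexp m 0 + cexp m 1 + cexp m 2"
  by (simp add: monom_deg_def sum_UNIV_3)

lemma cexp_eqI3: "cexp m 0 = cexp n 0 \<Longrightarrow> cexp m 1 = cexp n 1 \<Longrightarrow> cexp m 2 = cexp n 2 \<Longrightarrow> m = n"
proof (rule cexp_eqI)
  fix i :: 3
  assume "cexp m 0 = cexp n 0" "cexp m 1 = cexp n 1" "cexp m 2 = cexp n 2"
  moreover have "i \<in> {0, 1, 2}" using UNIV_3 by auto
  ultimately show "cexp m i = cexp n i" by auto
qed

lemma bij_mons: "bij_betw (\<lambda>m. (cexp m 0, cexp m 1)) (mons (int k)) (SIGMA i:{..k}. {..k - i})"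
proof (rule bij_betw_byWitness[where f' = "\<lambda>(i, j). vec3 (\<lambda>l. if l = 0 then i else if l = 1 then j else k - i - j)"])
  show "\<forall>m\<in>mons (int k). (\<lambda>(i, j). vec3 (\<lambda>l. if l = 0 then i else if l = 1 then j else k - i - j)) (cexp m 0, cexp m 1) = m"
    by (auto simp: mons_def monom_deg_3 neq_3 intro!: cexp_eqI3)
qed (auto simp: mons_def monom_deg_3 neq_3)

lemma card_mons_nat: "finite (mons (int k))" "int (card (mons (int k))) = hilb (int k)"
proof -
  show "finite (mons (int k))" using bij_betw_finite[OF bij_mons] by auto
  have "card (mons (int k)) = (\<Sum>i\<le>k. k - i + 1)"
    using bij_betw_same_card[OF bij_mons] by simp
  also have "\<dots> = (\<Sum>i\<le>k. Suc i)"
    by (rule sum.reindex_bij_witness[of _ "\<lambda>i. k - i" "\<lambda>i. k - i"]) auto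
  finally have "card (mons (int k)) = (\<Sum>i\<le>k. Suc i)" .
  moreover have "2 * (\<Sum>i\<le>k. Suc i) = (k + 1) * (k + 2)" by (induction k) auto
  ultimately have "2 * int (card (mons (int k))) = (int k + 1) * (int k + 2)"
    by (metis of_nat_mult of_nat_numeral of_nat_add of_nat_1)
  then show "int (card (mons (int k))) = hilb (int k)" unfolding hilb_def by simp
qed

lemma finite_mons [simp]: "finite (mons k)"
proof (cases "k \<ge> 0")
  case True
  then show ?thesis using card_mons_nat(1)[of "nat k"] by simp
next
  case False
  then have "mons k = {}" by (auto simp: mons_def)
  then show ?thesis by simp
qed

lemma card_mons: "k \<ge> - 2 \<Longrightarrow> int (card (mons k)) = hilb k"
proof (cases "k \<ge> 0")
  case True
  then show ?thesis using card_mons_nat(2)[of "nat k"] by simp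
next
  case False
  assume "k \<ge> - 2"
  moreover have "mons k = {}" using False by (auto simp: mons_def)
  moreover have "k = - 1 \<or> k = - 2" using False \<open>k \<ge> - 2\<close> by auto
  ultimately show ?thesis by (auto simp: hilb_def)
qed

lemma hilb_double: "2 * hilb k = (k + 1) * (k + 2)"
proof -
  have "even ((k + 1) * (k + 2))" by simp
  then show ?thesis unfolding hilb_def by simp
qed

section \<open>The Koszul complex of the variables\<close>

lemma free_of_add: "free_of L f \<Longrightarrow> free_of L h \<Longrightarrow> free_of L (f + h)"
  unfolding free_of_def using keys_add[of f h] by blast

lemma free_of_Var: "l \<noteq> i \<Longrightarrow> free_of {l} (Var i)"
  unfolding Var_def by (rule free_of_mon) (simp add: lookup_single)

lemma split_free_of:
  fixes f :: "'a::comm_ring_1 mpoly3"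
  obtains f0 f1 where "f = f0 + Var l * f1" "free_of {l} f0"
proof -
  have "\<exists>f0 f1. f = f0 + Var l * f1 \<and> free_of {l} f0"
  proof (induction f rule: mpoly3_induct)
    case (single m c)
    show ?case
    proof (cases "cexp m l = 0")
      case True
      then show ?thesis by (intro exI[of _ "mon m c"] exI[of _ 0]) (auto intro: free_of_mon)
    next
      case False
      then have "Poly_Mapping.single l 1 + (m - Poly_Mapping.single l 1) = m"
        by (intro cexp_eqI) (auto simp: lookup_add lookup_minus lookup_single when_def)
      then have "mon m c = 0 + Var l * mon (m - Poly_Mapping.single l 1) c"
        by (simp add: Var_def mult_single)
      then show ?thesis by (metis free_of_def ex_in_conv keys_zero)
    qed
  next
    case (add f h)
    then obtain f0 f1 h0 h1 where "f = f0 + Var l * f1" "free_of {l} f0" "h = h0 + Var l * h1" "free_of {l} h0"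
      by blast
    then show ?case
      by (intro exI[of _ "f0 + h0"] exI[of _ "f1 + h1"]) (auto simp: algebra_simps intro: free_of_add)
  qed (auto simp: free_of_def intro!: exI[of _ 0])
  then show ?thesis using that by blast
qed

lemma free_of_Var_mult:
  assumes "free_of {l} (Var l * b)"
  shows "Var l * b = (0 :: 'a::comm_ring_1 mpoly3)"
proof (rule ccontr)
  assume "Var l * b \<noteq> 0"
  then obtain m where m: "m \<in> Poly_Mapping.keys (Var l * b)" by (metis keys_eq_empty ex_in_conv)
  then obtain n where "m = Poly_Mapping.single l 1 + n"
    using keys_mult[of "Var l" b] by (auto simp: Var_def split: if_splits)
  then have "cexp m l > 0" by (simp add: lookup_add)
  then show False using assms m by (auto simp: free_of_def)
qed

lemma Var_nonzero [simp]: "Var i \<noteq> (0 :: 'a::comm_ring_1 mpoly3)"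
  by (metis Var_def keys_single keys_zero insert_not_empty zero_neq_one)

lemma Var_dvd_mult:
  assumes "i \<noteq> j" "Var i dvd Var j * (a :: 'a::field mpoly3)"
  shows "Var i dvd a"
proof -
  obtain a0 a1 where a: "a = a0 + Var i * a1" "free_of {i} a0" using split_free_of .
  obtain b where b: "Var j * a = Var i * b" using assms(2) by (elim dvdE)
  then have eq: "Var j * a0 = Var i * (b - Var j * a1)" using a by (simp add: algebra_simps)
  moreover have "free_of {i} (Var j * a0)" using a assms by (intro free_of_mult free_of_Var)
  ultimately have "Var j * a0 = 0" using free_of_Var_mult by metis
  then show ?thesis using a by auto
qed

text \<open>Exactness of the Koszul complex at the vectors parallel to the vector of variables:
  \<open>Var 0\<close> divides \<open>a\<close>, and the quotient is the common factor.\<close>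

lemma koszul_2:
  fixes a b c :: "'a::field mpoly3"
  assumes "a * Var 1 = b * Var 0" "a * Var 2 = c * Var 0"
  shows "\<exists>t. a = t * Var 0 \<and> b = t * Var 1 \<and> c = t * Var 2"
proof -
  have "Var 0 dvd Var 1 * a" using assms(1) by (metis dvd_triv_right mult.commute)
  then obtain t where t: "a = t * Var 0" using Var_dvd_mult[of 0 1 a] neq_3 by (metis dvdE mult.commute)
  have "b * Var 0 = (t * Var 1) * Var 0" "c * Var 0 = (t * Var 2) * Var 0" 
    using assms t by (simp_all add: mult_ac)
  then show ?thesis using t by auto
qed

text \<open>Exactness one place further: a syzygy of the variables is a cross product with the
  vector of variables. The parts free of \<open>Var 2\<close> form a syzygy of two variables, and
  the remaining parts determine \<open>c\<close>.\<close>

lemma koszul_1: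
  fixes a b c :: "'a::field mpoly3"
  assumes "a * Var 0 + b * Var 1 + c * Var 2 = 0"
  shows "\<exists>p q r. a = q * Var 2 - r * Var 1 \<and> b = r * Var 0 - p * Var 2 \<and> c = p * Var 1 - q * Var 0"
proof -
  obtain a0 a1 where a: "a = a0 + Var 2 * a1" "free_of {2} a0" using split_free_of .
  obtain b0 b1 where b: "b = b0 + Var 2 * b1" "free_of {2} b0" using split_free_of .
  have eq: "a0 * Var 0 + b0 * Var 1 = Var 2 * - (c + a1 * Var 0 + b1 * Var 1)"
  proof -
    have "(a0 * Var 0 + b0 * Var 1) + Var 2 * (c + a1 * Var 0 + b1 * Var 1) = 0"
      using assms unfolding a b by (simp add: algebra_simps)
    then show ?thesis by (simp only: mult_minus_right eq_neg_iff_add_eq_0)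
  qed
  have "free_of {2} (a0 * Var 0 + b0 * Var 1)"
    using a b neq_3 by (intro free_of_add free_of_mult free_of_Var) auto
  then have z: "Var 2 * - (c + a1 * Var 0 + b1 * Var 1) = 0" using free_of_Var_mult eq by metis
  then have "c + a1 * Var 0 + b1 * Var 1 = 0" by (metis mult_eq_0_iff Var_nonzero neg_equal_0_iff_equal)
  then have c: "c = - (a1 * Var 0 + b1 * Var 1)" by (simp only: eq_neg_iff_add_eq_0 add.assoc)
  have ab: "a0 * Var 0 + b0 * Var 1 = 0" using eq z by simp
  then have ab: "a0 * Var 0 = - (b0 * Var 1)" by (simp add: add_eq_0_iff2)
  have "Var 1 dvd Var 0 * a0" using ab by (metis dvd_triv_right dvd_minus_iff mult.commute)
  then obtain e where e: "a0 = Var 1 * e" using Var_dvd_mult[of 1 0 a0] neq_3 by (metis dvdE)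
  have "Var 1 * b0 = Var 1 * (- (Var 0 * e))" using ab e by (simp add: algebra_simps)
  then have b0: "b0 = - (Var 0 * e)" by (metis mult_left_cancel Var_nonzero)
  show ?thesis
    by (rule exI[of _ "- b1"], rule exI[of _ a1], rule exI[of _ "- e"]) (simp add: a b c e b0 algebra_simps)
qed

section \<open>Prime forms\<close>

text \<open>The quotient by \<open>g\<close> is a graded domain, expressed by divisibility so that
  all arguments can stay in the polynomial ring.\<close>

locale prime_form =
  fixes g :: "'a::field mpoly3" and d :: int
  assumes ihom_g: "ihom d g" and g_nonzero: "g \<noteq> 0"
    and g_prime: "\<And>a b. g dvd a * b \<Longrightarrow> g dvd a \<or> g dvd b"
    and g_nonunit: "\<not> g dvd 1"
begin

text \<open>A nonzero form of degree zero is a constant and thus a unit.\<close>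

lemma d_pos: "d \<ge> 1"
proof (rule ccontr)
  assume "\<not> d \<ge> 1"
  moreover have "d \<ge> 0" using ihom_neg[OF ihom_g] g_nonzero by force
  ultimately have "ihom 0 g" using ihom_g by (cases "d = 0") auto
  have "m = 0" if "m \<in> Poly_Mapping.keys g" for m
  proof (rule cexp_eqI)
    fix i
    have "cexp m i \<le> monom_deg m" unfolding monom_deg_def by (rule member_le_sum) auto
    then show "cexp m i = cexp 0 i" using that \<open>ihom 0 g\<close> by (auto simp: ihom_def)
  qed
  then have "Poly_Mapping.keys g \<subseteq> {0}" by auto
  then have "Poly_Mapping.keys g = {0}" using g_nonzero by (metis keys_eq_empty subset_singletonD)
  then have g: "g = const (Poly_Mapping.lookup g 0)" "Poly_Mapping.lookup g 0 \<noteq> 0"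
    using mpoly3_sum_mon[of g] by (auto simp flip: in_keys_iff)
  then have "g * const (inverse (Poly_Mapping.lookup g 0)) = const (Poly_Mapping.lookup g 0 * inverse (Poly_Mapping.lookup g 0))"
    by (metis mult_single add_0)
  also have "\<dots> = 1" using g(2) by simp
  finally show False using g_nonunit by (metis dvd_triv_left)
qed

lemma hcomp_g_mult: "hcomp k (g * h) = g * hcomp (k - d) h"
  by (rule hcomp_mult[OF ihom_g])

lemma dvd_cancel: "g dvd v * w \<Longrightarrow> \<not> g dvd v \<Longrightarrow> g dvd w"
  using g_prime by blast

text \<open>Two different variables have only units as common divisors.\<close>

lemma not_dvd_Var: obtains i where "\<not> g dvd Var i"
proof (rule ccontr)
  assume "\<not> thesis"
  then have dv: "g dvd Var i" for i using that by blast
  obtain h where h: "Var 0 = g * h" using dv[of 0] by (elim dvdE)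
  obtain h' where h': "Var 1 = g * h'" using dv[of 1] by (elim dvdE)
  have "Var 1 * h = Var 0 * h'" by (simp add: h h' mult_ac)
  then have "Var 0 dvd h" using Var_dvd_mult[of 0 1 h] neq_3 by simp
  then obtain k where "h = Var 0 * k" by (elim dvdE)
  then have "Var 0 * 1 = Var 0 * (g * k)" using h by (simp add: mult_ac)
  then have "g * k = 1" by (metis mult_left_cancel Var_nonzero)
  then show False using g_nonunit by (metis dvd_triv_left)
qed

text \<open>The cross product divided by \<open>g\<close> is a syzygy of the variables, so by
  \<open>koszul_1\<close> it comes from some \<open>(p, q, r)\<close>. Subtracting \<open>g\<close>
  times that vector makes the cross product vanish exactly, and \<open>koszul_2\<close>
  applies.\<close>

lemma koszul_mod:
  assumes "g dvd a * Var 1 - b * Var 0" "g dvd c * Var 0 - a * Var 2" "g dvd b * Var 2 - c * Var 1"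
  shows "\<exists>p q r t. a = g * p + t * Var 0 \<and> b = g * q + t * Var 1 \<and> c = g * r + t * Var 2"
proof -
  obtain \<gamma> \<beta> \<alpha> where e: "a * Var 1 - b * Var 0 = g * \<gamma>" "c * Var 0 - a * Var 2 = g * \<beta>" "b * Var 2 - c * Var 1 = g * \<alpha>"
    using assms by (elim dvdE)
  have "g * (\<alpha> * Var 0 + \<beta> * Var 1 + \<gamma> * Var 2) = (g * \<alpha>) * Var 0 + (g * \<beta>) * Var 1 + (g * \<gamma>) * Var 2"
    by (simp add: algebra_simps)
  also have "\<dots> = (b * Var 2 - c * Var 1) * Var 0 + (c * Var 0 - a * Var 2) * Var 1 + (a * Var 1 - b * Var 0) * Var 2"
    by (simp only: e)
  also have "\<dots> = 0" by (simp add: algebra_simps)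
  finally have "\<alpha> * Var 0 + \<beta> * Var 1 + \<gamma> * Var 2 = 0" using g_nonzero by simp
  then obtain p q r where pqr: "\<alpha> = q * Var 2 - r * Var 1" "\<beta> = r * Var 0 - p * Var 2" "\<gamma> = p * Var 1 - q * Var 0"
    using koszul_1 by blast
  have "(a - g * p) * Var 1 = (b - g * q) * Var 0"
    using e(1) unfolding pqr by (simp add: algebra_simps)
  moreover have "(a - g * p) * Var 2 = (c - g * r) * Var 0"
    using e(2) unfolding pqr by (simp add: algebra_simps)
  ultimately obtain t where "a - g * p = t * Var 0" "b - g * q = t * Var 1" "c - g * r = t * Var 2"
    using koszul_2 by blast
  then show ?thesis by (metis diff_eq_eq add.commute)
qed

text \<open>The ring \<open>S/(g)\<close> has depth two, so multiples of \<open>v\<close> can be detected after multiplication with a power of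
  the irrelevant ideal.\<close>

lemma depth_two_step:
  assumes v: "\<not> g dvd v" and w: "\<And>i. \<exists>a. g dvd w * Var i - a * v"
  shows "\<exists>t. g dvd w - t * v"
proof -
  obtain a b c where abc: "g dvd w * Var 0 - a * v" "g dvd w * Var 1 - b * v" "g dvd w * Var 2 - c * v"
    using w by metis
  \<comment> \<open>Comparing two expressions for \<open>w * Var i * Var j\<close> modulo
    \<open>g\<close> and cancelling \<open>v\<close> shows that the cofactors are parallel to the
    variables.\<close>
  have *: "g dvd r * Var j - s * Var i" if "g dvd w * Var i - r * v" "g dvd w * Var j - s * v" for r s i j
  proof -
    have "g dvd (w * Var j - s * v) * Var i - (w * Var i - r * v) * Var j"
      by (rule dvd_diff[OF dvd_mult2[OF that(2)] dvd_mult2[OF that(1)]])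
    also have "(w * Var j - s * v) * Var i - (w * Var i - r * v) * Var j = v * (r * Var j - s * Var i)"
      by (simp add: algebra_simps)
    finally show ?thesis using v dvd_cancel by blast
  qed
  obtain p q r t where t: "a = g * p + t * Var 0" "b = g * q + t * Var 1" "c = g * r + t * Var 2"
    using koszul_mod[OF *[OF abc(1,2)] *[OF abc(3,1)] *[OF abc(2,3)]] by blast
  have **: "g dvd Var i * (w - t * v)" if "g dvd w * Var i - s * v" "s = g * u + t * Var i" for i s u
  proof -
    have "g dvd (w * Var i - s * v) + g * (u * v)" using that(1) by (intro dvd_add) auto
    also have "(w * Var i - s * v) + g * (u * v) = Var i * (w - t * v)" 
      unfolding that(2) by (simp add: algebra_simps)
    finally show ?thesis .
  qed
  obtain i where i: "\<not> g dvd Var i" by (rule not_dvd_Var)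
  have "i \<in> {0, 1, 2}" using UNIV_3 by auto
  then have "g dvd Var i * (w - t * v)"
    using **[OF abc(1) t(1)] **[OF abc(2) t(2)] **[OF abc(3) t(3)] by auto
  then show ?thesis using i dvd_cancel by blast
qed

text \<open>The degree of the monomials is lowered one at a time, with \<open>depth_two_step\<close>
  applied to \<open>w * mon m 1\<close>.\<close>

lemma depth_two:
  assumes v: "\<not> g dvd v" and w: "\<And>m. m \<in> mons (int M) \<Longrightarrow> \<exists>a. g dvd w * mon m 1 - a * v"
  shows "\<exists>t. g dvd w - t * v"
  using w
proof (induction M)
  case 0
  then show ?case using 0[of 0] by (simp add: mons_def)
next
  case (Suc M)
  have "\<exists>a. g dvd w * mon m 1 - a * v" if m: "m \<in> mons (int M)" for m
  proof (rule depth_two_step[OF v])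
    fix i :: 3
    have "m + Poly_Mapping.single i 1 \<in> mons (int (Suc M))" using m by (simp add: mons_def)
    from Suc.prems[OF this] show "\<exists>a. g dvd w * mon m 1 * Var i - a * v"
      by (simp add: Var_def mult.assoc mult_single)
  qed
  then show ?case by (rule Suc.IH)
qed

section \<open>Elimination\<close>

definition mons_le :: "int \<Rightarrow> (3 \<Rightarrow>\<^sub>0 nat) set" where
  "mons_le k = {m. int (monom_deg m) \<le> k}"

lemma mons_le_UN: "mons_le k = (\<Union>j\<in>{0..k}. mons j)"
  by (auto simp: mons_le_def mons_def)

lemma card_mons_le: "finite (mons_le k)" 
  "k \<ge> 0 \<Longrightarrow> 6 * int (card (mons_le k)) = (k + 1) * (k + 2) * (k + 3)"
proof -
  show "finite (mons_le k)" unfolding mons_le_UN by (rule finite_UN_I[OF _ finite_mons]) simp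
  assume "k \<ge> 0"
  have "card (mons_le k) = (\<Sum>j\<in>{0..k}. card (mons j))"
    unfolding mons_le_UN by (intro card_UN_disjoint ballI impI finite_mons) (auto simp: mons_def)
  then have "6 * int (card (mons_le k)) = (\<Sum>j\<in>{0..k}. 6 * hilb j)"
    by (simp add: card_mons sum_distrib_left)
  also have "\<dots> = (k + 1) * (k + 2) * (k + 3)" using \<open>k \<ge> 0\<close>
  proof (induction k rule: int_ge_induct)
    case base
    then show ?case by (simp add: hilb_def)
  next
    case (step k)
    have "{0..k + 1} = insert (k + 1) {0..k}" using step by auto
    then have "(\<Sum>j\<in>{0..k + 1}. 6 * hilb j) = 3 * (2 * hilb (k + 1)) + (\<Sum>j\<in>{0..k}. 6 * hilb j)" by simp
    then show ?case unfolding step.IH hilb_double by (simp add: algebra_simps)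
  qed
  finally show "6 * int (card (mons_le k)) = (k + 1) * (k + 2) * (k + 3)" .
qed

text \<open>Homogenization: a power of \<open>Var l\<close> fills up the degree.\<close>

lemma bij_mons_free:
  "bij_betw (\<lambda>m. m + Poly_Mapping.single l (k - monom_deg m)) {m \<in> mons_le (int k). cexp m l = 0} (mons (int k))"
proof (rule bij_betw_byWitness[where f' = "\<lambda>m. m - Poly_Mapping.single l (cexp m l)"])
  have split: "m = (m - Poly_Mapping.single l (cexp m l)) + Poly_Mapping.single l (cexp m l)" for m
    by (rule cexp_eqI) (auto simp: lookup_add lookup_minus lookup_single when_def)
  have deg: "monom_deg m = monom_deg (m - Poly_Mapping.single l (cexp m l)) + cexp m l" for m
    by (metis split monom_deg_add monom_deg_single)
  show "\<forall>m\<in>mons (int k). (m - Poly_Mapping.single l (cexp m l)) + Poly_Mapping.single l (k - monom_deg (m - Poly_Mapping.single l (cexp m l))) = m"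
  proof
    fix m assume "m \<in> mons (int k)"
    then have "k = monom_deg m" by (simp add: mons_def)
    then have "k - monom_deg (m - Poly_Mapping.single l (cexp m l)) = cexp m l" using deg[of m] by simp
    then show "(m - Poly_Mapping.single l (cexp m l)) + Poly_Mapping.single l (k - monom_deg (m - Poly_Mapping.single l (cexp m l))) = m"
      by (simp flip: split)
  qed
  show "(\<lambda>m. m - Poly_Mapping.single l (cexp m l)) ` mons (int k) \<subseteq> {m \<in> mons_le (int k). cexp m l = 0}"
  proof (intro image_subsetI)
    fix m assume "m \<in> mons (int k)"
    then show "m - Poly_Mapping.single l (cexp m l) \<in> {m \<in> mons_le (int k). cexp m l = 0}"
      using deg[of m] by (simp add: mons_def mons_le_def lookup_minus)
  qed
  show "\<forall>m\<in>{m \<in> mons_le (int k). cexp m l = 0}. 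
     (m + Poly_Mapping.single l (k - monom_deg m)) - Poly_Mapping.single l (cexp (m + Poly_Mapping.single l (k - monom_deg m)) l) = m"
    by (auto simp: lookup_add)
qed (auto simp: mons_def mons_le_def)

lemma dim_image_le:
  assumes "slinear T" "FV.subspace V" "FV.fdim V"
  shows "FV.dim (T ` V) \<le> FV.dim V"
  using FV.rank_nullity[OF slinear_linear[OF assms(1)] assms(2,3)] by linarith

lemma mons_le_keys_mult:
  "Poly_Mapping.keys a \<subseteq> mons_le k \<Longrightarrow> Poly_Mapping.keys b \<subseteq> mons_le l \<Longrightarrow> Poly_Mapping.keys (a * b) \<subseteq> mons_le (k + l)"
  for a b :: "'a mpoly3"
proof
  fix m assume a: "Poly_Mapping.keys a \<subseteq> mons_le k" and b: "Poly_Mapping.keys b \<subseteq> mons_le l"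
    and "m \<in> Poly_Mapping.keys (a * b)"
  then obtain m1 m2 where m: "m = m1 + m2" "m1 \<in> Poly_Mapping.keys a" "m2 \<in> Poly_Mapping.keys b"
    using keys_mult[of a b] by blast
  then show "m \<in> mons_le (k + l)" using subsetD[OF a m(2)] subsetD[OF b m(3)] by (simp add: mons_le_def)
qed

text \<open>The component of \<open>g * w\<close> in degree \<open>j + d\<close> is \<open>g\<close>
  times that of \<open>w\<close> in degree \<open>j\<close>, so a component of \<open>w\<close>
  above the bound would survive.\<close>

lemma mons_le_quotient:
  assumes "Poly_Mapping.keys (g * w) \<subseteq> mons_le k"
  shows "Poly_Mapping.keys w \<subseteq> mons_le (k - d)"
proof (rule ccontr)
  assume "\<not> ?thesis"
  then obtain m where m: "m \<in> Poly_Mapping.keys w" "m \<notin> mons_le (k - d)" by blast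
  then have deg: "int (monom_deg m) > k - d" by (simp add: mons_le_def)
  let ?j = "int (monom_deg m)"
  have "hcomp (?j + d) (g * w) = 0"
  proof (rule poly_mapping_eqI)
    fix n
    have "n \<notin> Poly_Mapping.keys (g * w)" if "int (monom_deg n) = ?j + d"
      using assms deg that by (auto simp: mons_le_def)
    then show "Poly_Mapping.lookup (hcomp (?j + d) (g * w)) n = Poly_Mapping.lookup 0 n"
      by (auto simp: lookup_hcomp in_keys_iff)
  qed
  then have "hcomp ?j w = 0" using g_nonzero by (simp add: hcomp_g_mult)
  then have "Poly_Mapping.lookup w m = 0" using lookup_hcomp[of ?j w m] by simp
  then show False using m by (simp add: in_keys_iff)
qed

text \<open>Otherwise the polynomials of degree at most \<open>N\<close> free of \<open>x\<^sub>l\<close>, a space of dimension about \<open>N\<^sup>2 / 2\<close>, would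
  embed into the corresponding part of \<open>S/(g, c)\<close>, whose dimension grows only linearly in \<open>N\<close>.\<close>

lemma elimination:
  assumes c: "\<not> g dvd c"
  shows "\<exists>r u v. r \<noteq> 0 \<and> free_of {l} r \<and> r = u * g + v * c"
proof (rule ccontr)
  assume "\<not> ?thesis"
  then have no: "r = 0" if "free_of {l} r" "r = u * g + v * c" for r u v using that by blast
  define e where "e = int (Max (monom_deg ` Poly_Mapping.keys c))"
  have e: "Poly_Mapping.keys c \<subseteq> mons_le e" "e \<ge> 0"
    by (auto simp: mons_le_def e_def)
  \<comment> \<open>Large enough for \<open>N + 1 > 2 * d * e\<close>, and for all degrees that
    occur to be nonnegative.\<close>
  define N where "N = 2 * d * e + d + e"
  have N: "N \<ge> d + e" "N \<ge> 0" using d_pos e by (auto simp: N_def)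
  define A where "A = {m \<in> mons_le N. cexp m l = 0}"
  have cardA: "int (card A) = hilb N" "finite A"
  proof -
    have "card A = card (mons N)"
      using bij_betw_same_card[OF bij_mons_free[of l "nat N"]] N(2) by (simp add: A_def)
    then show "int (card A) = hilb N" using card_mons[of N] N(2) by simp
    show "finite A" unfolding A_def using card_mons_le(1) by simp
  qed
  \<comment> \<open>The entries 0, 1, 2 hold \<open>u\<close>, \<open>v\<close>, \<open>r\<close> of
    an expression \<open>u * g + v * c + r\<close> of degree at most \<open>N\<close>.\<close>
  define M where "M = (\<lambda>i::nat. if i = 0 then mons_le (N - d) else if i = 1 then mons_le (N - e) else if i = 2 then A else {})"
  define M1 where "M1 = (\<lambda>i::nat. if i = 0 then mons_le N else {})"
  define M2 where "M2 = (\<lambda>i::nat. if i = 0 then mons_le (N - d - e) else {})"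
  let ?V = "poly_fun M :: (nat \<Rightarrow> 'a mpoly3) set"
  let ?V1 = "poly_fun M1 :: (nat \<Rightarrow> 'a mpoly3) set"
  let ?V2 = "poly_fun M2 :: (nat \<Rightarrow> 'a mpoly3) set"
  have finM: "finite (M i)" "finite (M1 i)" "finite (M2 i)" for i
    using cardA(2) card_mons_le(1) by (auto simp: M_def M1_def M2_def)
  have zeroM: "i \<ge> 3 \<Longrightarrow> M i = {}" "i \<ge> 1 \<Longrightarrow> M1 i = {}" "i \<ge> 1 \<Longrightarrow> M2 i = {}" for i
    by (auto simp: M_def M1_def M2_def)
  note fd = fdim_poly_fun[of M 3, OF finM(1) zeroM(1)] fdim_poly_fun[of M1 1, OF finM(2) zeroM(2)] fdim_poly_fun[of M2 1, OF finM(3) zeroM(3)]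
  have dims: "FV.dim ?V = card (mons_le (N - d)) + card (mons_le (N - e)) + card A"
    "FV.dim ?V1 = card (mons_le N)" "FV.dim ?V2 = card (mons_le (N - d - e))"
    using dim_poly_fun[of M 3, OF finM(1) zeroM(1)] dim_poly_fun[of M1 1, OF finM(2) zeroM(2)] dim_poly_fun[of M2 1, OF finM(3) zeroM(3)]
    by (simp_all add: M_def M1_def M2_def numeral_eq_Suc)
  define T where "T f = (\<lambda>i::nat. if i = 0 then f 0 * g + f 1 * c + f 2 else 0)" for f :: "nat \<Rightarrow> 'a mpoly3"
  define T' where "T' f = (\<lambda>i::nat. if i = 0 then - (f 0 * c) else if i = 1 then g * f 0 else 0)" for f :: "nat \<Rightarrow> 'a mpoly3"
  have sl: "slinear T" "slinear T'"
    by (auto simp: slinear_def T_def T'_def fun_eq_iff algebra_simps)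
  have "Poly_Mapping.keys g \<subseteq> mons_le d" using ihom_g by (auto simp: ihom_def mons_le_def)
  then have TV: "T ` ?V \<subseteq> ?V1"
  proof (intro image_subsetI)
    fix f assume f: "f \<in> ?V"
    have "Poly_Mapping.keys (f i) \<subseteq> M i" for i using f by (simp add: poly_fun_def)
    from this[of 0] this[of 1] this[of 2]
    have "Poly_Mapping.keys (f 0) \<subseteq> mons_le (N - d)" "Poly_Mapping.keys (f 1) \<subseteq> mons_le (N - e)" "Poly_Mapping.keys (f 2) \<subseteq> A"
      by (simp_all add: M_def)
    then have "Poly_Mapping.keys (f 0 * g) \<subseteq> mons_le N" "Poly_Mapping.keys (f 1 * c) \<subseteq> mons_le N" "Poly_Mapping.keys (f 2) \<subseteq> mons_le N"
      using mons_le_keys_mult[of "f 0" "N - d" g d] mons_le_keys_mult[of "f 1" "N - e" c e] e(1) \<open>Poly_Mapping.keys g \<subseteq> mons_le d\<close>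
      by (auto simp: A_def)
    then have "Poly_Mapping.keys (f 0 * g + f 1 * c + f 2) \<subseteq> mons_le N"
      using keys_add[of "f 0 * g + f 1 * c" "f 2"] keys_add[of "f 0 * g" "f 1 * c"] by blast
    then show "T f \<in> ?V1" by (auto simp: poly_fun_def T_def M1_def)
  qed
  \<comment> \<open>By \<open>no\<close> the entry \<open>r\<close> is zero. Since \<open>g\<close>
    is prime and does not divide \<open>c\<close>, relations between \<open>g\<close> and
    \<open>c\<close> are multiples of \<open>(- c, g)\<close>.\<close>
  have ker: "{f \<in> ?V. T f = 0} \<subseteq> T' ` ?V2"
  proof
    fix f assume "f \<in> {f \<in> ?V. T f = 0}"
    then have f: "\<And>i. Poly_Mapping.keys (f i) \<subseteq> M i" and T0: "T f 0 = 0" by (auto simp: poly_fun_def)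
    have f3: "f i = 0" if "i \<ge> 3" for i using f[of i] zeroM(1)[OF that] by simp
    have eq: "f 2 = (- f 0) * g + (- f 1) * c" using T0 by (simp add: T_def algebra_simps add_eq_0_iff)
    have "free_of {l} (f 2)" using f[of 2] by (auto simp: M_def A_def free_of_def)
    then have f2: "f 2 = 0" using eq by (rule no)
    then have eq: "f 0 * g = - (f 1 * c)" using T0 by (simp add: T_def eq_neg_iff_add_eq_0)
    then have "g dvd c * f 1" by (metis dvd_triv_right dvd_minus_iff mult.commute)
    then obtain w where w: "f 1 = g * w" using c dvd_cancel by (metis dvdE)
    have "g * f 0 = g * (- (w * c))" using eq w by (simp add: algebra_simps)
    then have f0: "f 0 = - (w * c)" using g_nonzero by (metis mult_left_cancel)
    have "Poly_Mapping.keys w \<subseteq> mons_le (N - e - d)"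
      using f[of 1] unfolding w by (intro mons_le_quotient) (simp add: M_def)
    then have "(\<lambda>i::nat. if i = 0 then w else 0) \<in> ?V2" by (auto simp: poly_fun_def M2_def algebra_simps)
    moreover have "f = T' (\<lambda>i::nat. if i = 0 then w else 0)"
    proof
      fix i :: nat
      consider "i = 0" | "i = 1" | "i = 2" | "i \<ge> 3" by linarith
      then show "f i = T' (\<lambda>i::nat. if i = 0 then w else 0) i"
        using f0 w f2 f3 by cases (auto simp: T'_def)
    qed
    ultimately show "f \<in> T' ` ?V2" by blast
  qed
  have "FV.dim ?V = FV.dim (T ` ?V) + FV.dim {f \<in> ?V. T f = 0}"
    by (rule FV.rank_nullity[OF slinear_linear[OF sl(1)] subspace_poly_fun fd(1)])
  also have "\<dots> \<le> FV.dim ?V1 + FV.dim (T' ` ?V2)"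
    by (intro add_mono FV.fdim_dim_mono TV ker fd FV.fdim_image slinear_linear sl)
  also have "\<dots> \<le> FV.dim ?V1 + FV.dim ?V2"
    by (intro add_mono order_refl dim_image_le sl subspace_poly_fun fd)
  finally have "6 * int (card (mons_le (N - d))) + 6 * int (card (mons_le (N - e))) + 6 * int (card A) \<le> 
    6 * int (card (mons_le N)) + 6 * int (card (mons_le (N - d - e)))"
    unfolding dims by linarith
  moreover have "6 * hilb N = 3 * ((N + 1) * (N + 2))" using hilb_double[of N] by simp
  ultimately have ineq: "(N - d + 1) * (N - d + 2) * (N - d + 3) + (N - e + 1) * (N - e + 2) * (N - e + 3) + 3 * ((N + 1) * (N + 2)) \<le>
     (N + 1) * (N + 2) * (N + 3) + (N - d - e + 1) * (N - d - e + 2) * (N - d - e + 3)"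
    using N d_pos e by (simp add: card_mons_le cardA)
  \<comment> \<open>The cubic and quadratic terms in \<open>N\<close> cancel, so a linear bound is
    left against the quadratic number of monomials in \<open>A\<close>.\<close>
  have "(N + 1) * (N + 2) * (N + 3) + (N - d - e + 1) * (N - d - e + 2) * (N - d - e + 3) 
    - (N - d + 1) * (N - d + 2) * (N - d + 3) - (N - e + 1) * (N - e + 2) * (N - e + 3) = 6 * (d * e) * (N + 2) - 3 * (d * e) * (d + e)"
    by (simp add: algebra_simps)
  moreover have "3 * (d * e) * (d + e) \<ge> 0" using d_pos e by simp
  ultimately have "3 * ((N + 1) * (N + 2)) \<le> 6 * (d * e) * (N + 2)" using ineq by linarith
  then have "(N + 1) * (N + 2) \<le> (2 * d * e) * (N + 2)" by (simp add: mult.assoc)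
  then have "N + 1 \<le> 2 * d * e" using N by simp
  then show False using d_pos e by (simp add: N_def)
qed

end

section \<open>The degree bound for the Jacobian ideal\<close>

text \<open>A vector of three forms together with one scalar form. The degree \<open>- 1\<close>
  forces entries to be zero, so vectors alone and scalars alone are special cases.\<close>

definition vsp :: "int \<Rightarrow> int \<Rightarrow> (nat \<Rightarrow> 'a::field mpoly3) set" where
  "vsp \<alpha> \<beta> = poly_fun (\<lambda>i. if i < 3 then mons \<alpha> else if i = 3 then mons \<beta> else {})"

lemma vsp_mem: "f \<in> vsp \<alpha> \<beta> \<longleftrightarrow> ihom \<alpha> (f 0) \<and> ihom \<alpha> (f 1) \<and> ihom \<alpha> (f 2) \<and> ihom \<beta> (f 3) \<and> (\<forall>i\<ge>4. f i = 0)"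
proof
  assume f: "f \<in> vsp \<alpha> \<beta>"
  then have *: "Poly_Mapping.keys (f i) \<subseteq> (if i < 3 then mons \<alpha> else if i = 3 then mons \<beta> else {})" for i
    by (simp add: vsp_def poly_fun_def)
  have "f i = 0" if "i \<ge> 4" for i using *[of i] that by simp
  then show "ihom \<alpha> (f 0) \<and> ihom \<alpha> (f 1) \<and> ihom \<alpha> (f 2) \<and> ihom \<beta> (f 3) \<and> (\<forall>i\<ge>4. f i = 0)"
    using *[of 0] *[of 1] *[of 2] *[of 3] by (simp add: ihom_keys)
next
  assume f: "ihom \<alpha> (f 0) \<and> ihom \<alpha> (f 1) \<and> ihom \<alpha> (f 2) \<and> ihom \<beta> (f 3) \<and> (\<forall>i\<ge>4. f i = 0)"
  have "Poly_Mapping.keys (f i) \<subseteq> (if i < 3 then mons \<alpha> else if i = 3 then mons \<beta> else {})" for i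
  proof -
    consider "i = 0" | "i = 1" | "i = 2" | "i = 3" | "i \<ge> 4" by linarith
    then show ?thesis using f by cases (auto simp flip: ihom_keys)
  qed
  then show "f \<in> vsp \<alpha> \<beta>" by (simp add: vsp_def poly_fun_def)
qed

lemma fdim_vsp: "FV.fdim (vsp \<alpha> \<beta> :: (nat \<Rightarrow> 'a::field mpoly3) set)"
  unfolding vsp_def by (rule fdim_poly_fun[of _ 4]) auto

lemma subspace_vsp: "FV.subspace (vsp \<alpha> \<beta> :: (nat \<Rightarrow> 'a::field mpoly3) set)"
  unfolding vsp_def by (rule subspace_poly_fun)

lemma dim_vsp: 
  assumes "\<alpha> \<ge> - 2" "\<beta> \<ge> - 2"
  shows "int (FV.dim (vsp \<alpha> \<beta> :: (nat \<Rightarrow> 'a::field mpoly3) set)) = 3 * hilb \<alpha> + hilb \<beta>"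
proof -
  have "FV.dim (vsp \<alpha> \<beta> :: (nat \<Rightarrow> 'a::field mpoly3) set) = (\<Sum>i<(4::nat). card (if i < 3 then mons \<alpha> else if i = 3 then mons \<beta> else {}))"
    unfolding vsp_def by (rule dim_poly_fun) auto
  also have "\<dots> = 3 * card (mons \<alpha>) + card (mons \<beta>)"
    by (simp add: numeral_eq_Suc)
  finally show ?thesis using card_mons assms by simp
qed

lemma ihom_neg1: "ihom (- 1) f \<longleftrightarrow> f = 0"
  using ihom_neg[of "- 1" f] by auto

lemma slinear_zero:
  fixes T :: "(nat \<Rightarrow> 'a::field mpoly3) \<Rightarrow> (nat \<Rightarrow> 'a mpoly3)"
  assumes "slinear T"
  shows "T 0 = 0"
proof -
  have "T (\<lambda>i. 0 * (0 :: nat \<Rightarrow> 'a mpoly3) i) = (\<lambda>i. 0 * T 0 i)" 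
    using assms unfolding slinear_def by blast
  then show ?thesis by (simp add: zero_fun_def)
qed

lemma subspace_dvd:
  assumes "slinear T"
  shows "FV.subspace {f. \<forall>i. g dvd T f i}"
proof (rule FV.subspaceI)
  show "0 \<in> {f. \<forall>i. g dvd T f i}" using slinear_zero[OF assms] by simp
next
  fix x y assume "x \<in> {f. \<forall>i. g dvd T f i}" "y \<in> {f. \<forall>i. g dvd T f i}"
  moreover have "T (x + y) = (\<lambda>i. T x i + T y i)"
    using assms unfolding slinear_def plus_fun_def by blast
  ultimately show "x + y \<in> {f. \<forall>i. g dvd T f i}" by simp
next
  fix c x assume "x \<in> {f. \<forall>i. g dvd T f i}"
  moreover have "T (fscale c x) = (\<lambda>i. const c * T x i)"
    using assms unfolding slinear_def fscale_def by blast
  ultimately show "fscale c x \<in> {f. \<forall>i. g dvd T f i}" by simp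
qed

lemma subspace_ker: "slinear T \<Longrightarrow> FV.subspace V \<Longrightarrow> FV.subspace {v \<in> V. T v = 0}"
proof -
  assume T: "slinear T" and V: "FV.subspace V"
  have "{v \<in> V. T v = 0} = V \<inter> {f. \<forall>i. 0 dvd T f i}" by (auto simp: fun_eq_iff)
  then show ?thesis using FV.subspace_inter[OF V subspace_dvd[OF T, of 0]] by simp
qed

section \<open>Syzygies of the gradient of a prime form\<close>

context prime_form begin

definition jac :: "'a mpoly3 set" where
  "jac = {s. \<exists>a b c e. s = a * pd 0 g + b * pd 1 g + c * pd 2 g + e * g}"

lemma euler_g: "Var 0 * pd 0 g + Var 1 * pd 1 g + Var 2 * pd 2 g = of_nat (nat d) * g"
  using euler[of "nat d" g] ihom_g d_pos by (simp add: sum_UNIV_3 flip: ihom_homogeneous)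

text \<open>By Euler's formula both \<open>(a, b, c)\<close> and the vector of variables are
  orthogonal to the gradient modulo \<open>g\<close>, so their cross product \<open>U\<close> is
  parallel to the gradient. Depth two provides the factor \<open>t\<close>.\<close>

lemma syzygy_parallel:
  assumes M: "\<And>m. m \<in> mons (int M) \<Longrightarrow> mon m 1 \<in> jac" and i0: "\<not> g dvd pd i0 g"
    and abc: "g dvd a * pd 0 g + b * pd 1 g + c * pd 2 g"
  shows "\<exists>t. g dvd (b * Var 2 - c * Var 1) - t * pd 0 g \<and> g dvd (c * Var 0 - a * Var 2) - t * pd 1 g \<and>
    g dvd (a * Var 1 - b * Var 0) - t * pd 2 g"
proof -
  define U where "U i = (if i = 0 then b * Var 2 - c * Var 1 else if i = 1 then c * Var 0 - a * Var 2 
    else a * Var 1 - b * Var 0)" for i :: 3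
  let ?s = "a * pd 0 g + b * pd 1 g + c * pd 2 g"
  let ?e = "Var 0 * pd 0 g + Var 1 * pd 1 g + Var 2 * pd 2 g"
  have e: "g dvd ?e" unfolding euler_g by simp
  have U: "U 0 = b * Var 2 - c * Var 1" "U 1 = c * Var 0 - a * Var 2" "U 2 = a * Var 1 - b * Var 0"
    unfolding U_def using neq_3 by simp_all
  have d: "g dvd v * ?s - w * ?e" for v w using abc e by (simp add: dvd_diff)
  \<comment> \<open>The expansion of a double cross product; \<open>?s\<close> and \<open>?e\<close>
    are the two scalar products.\<close>
  have "U 0 * pd 1 g - U 1 * pd 0 g = Var 2 * ?s - c * ?e" "U 1 * pd 2 g - U 2 * pd 1 g = Var 0 * ?s - a * ?e"
    "U 2 * pd 0 g - U 0 * pd 2 g = Var 1 * ?s - b * ?e"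
    unfolding U by (simp_all add: algebra_simps)
  then have cyc: "g dvd U 0 * pd 1 g - U 1 * pd 0 g" "g dvd U 1 * pd 2 g - U 2 * pd 1 g"
     "g dvd U 2 * pd 0 g - U 0 * pd 2 g" using d by metis+
  note cyc' = cyc[THEN dvd_minus_iff[THEN iffD2], unfolded minus_diff_eq]
  have cross: "g dvd U i * pd j g - U j * pd i g" for i j
  proof -
    have "i = 0 \<or> i = 1 \<or> i = 2" "j = 0 \<or> j = 1 \<or> j = 2" using UNIV_3 by auto
    then show ?thesis using cyc cyc' by auto
  qed
  have "\<exists>t. g dvd U i0 - t * pd i0 g"
  proof (rule depth_two[OF i0, of M])
    fix m assume "m \<in> mons (int M)"
    then obtain q0 q1 q2 q where q: "mon m 1 = q0 * pd 0 g + q1 * pd 1 g + q2 * pd 2 g + q * g"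
      using M unfolding jac_def by blast
    \<comment> \<open>Writing \<open>m\<close> through the gradient and exchanging indices by
      \<open>cross\<close> shows that \<open>U i0 * mon m 1\<close> is a multiple of
      \<open>pd i0 g\<close> modulo \<open>g\<close>.\<close>
    have "U i0 * mon m 1 - (q0 * U 0 + q1 * U 1 + q2 * U 2) * pd i0 g = 
      q0 * (U i0 * pd 0 g - U 0 * pd i0 g) + q1 * (U i0 * pd 1 g - U 1 * pd i0 g) + q2 * (U i0 * pd 2 g - U 2 * pd i0 g) + U i0 * q * g"
      unfolding q by (simp add: algebra_simps)
    moreover have "g dvd \<dots>" using cross by (intro dvd_add dvd_mult) auto
    ultimately show "\<exists>a. g dvd U i0 * mon m 1 - a * pd i0 g" by metis
  qed
  then obtain t where t: "g dvd U i0 - t * pd i0 g" by blast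
  have "g dvd U j - t * pd j g" for j
  proof -
    have "pd i0 g * (U j - t * pd j g) = (U j * pd i0 g - U i0 * pd j g) + pd j g * (U i0 - t * pd i0 g)"
      by (simp add: algebra_simps)
    moreover have "g dvd \<dots>" using cross t by (intro dvd_add dvd_mult)
    ultimately show ?thesis using dvd_cancel[OF _ i0] by metis
  qed
  then show ?thesis using U by metis
qed

lemma hcomp_dvd: "g dvd f \<Longrightarrow> g dvd hcomp k f"
  by (elim dvdE) (simp add: hcomp_g_mult)

definition EE :: "nat \<Rightarrow> 'a mpoly3" where
  "EE i = (if i = 0 then Var 0 else if i = 1 then Var 1 else Var 2)"

lemma EE_simps: "EE 0 = Var 0" "EE 1 = Var 1" "EE (Suc 0) = Var 1" "EE 2 = Var 2"
  by (auto simp: EE_def)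

lemma ihom_EE: "ihom 1 (EE i)"
  by (simp add: EE_def)

lemma ihom_pd_g: "ihom (d - 1) (pd i g)"
  by (rule ihom_pd[OF ihom_g])

lemma slinearI:
  assumes "\<And>f h i. T (\<lambda>i. f i + h i) i = T f i + T h i" "\<And>s f i. T (\<lambda>i. s * f i) i = s * T f i"
  shows "slinear T"
  using assms by (simp add: slinear_def fun_eq_iff)

text \<open>The vectors \<open>a\<close> with \<open>a \<times> (x, y, z) = 0\<close> modulo \<open>g\<close> are the \<open>g v + t (x, y, z)\<close>, and \<open>(v, t)\<close> gives \<open>0\<close> for all
  multiples of \<open>(- (x, y, z), g)\<close>.\<close>

lemma dim_parallel:
  assumes \<alpha>: "\<alpha> \<ge> d - 1"
    and N: "N \<subseteq> vsp \<alpha> (- 1)"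
      "\<And>f. f \<in> N \<Longrightarrow> g dvd f 0 * Var 1 - f 1 * Var 0 \<and> g dvd f 2 * Var 0 - f 0 * Var 2 \<and> g dvd f 1 * Var 2 - f 2 * Var 1"
  shows "int (FV.dim N) \<le> 3 * hilb (\<alpha> - d) + hilb (\<alpha> - 1) - hilb (\<alpha> - d - 1)"
proof -
  define V where "V = (vsp (\<alpha> - d) (\<alpha> - 1) :: (nat \<Rightarrow> 'a mpoly3) set)"
  define V' where "V' = (vsp (- 1) (\<alpha> - d - 1) :: (nat \<Rightarrow> 'a mpoly3) set)"
  define T where "T f = (\<lambda>i. if i < 3 then g * f i + f 3 * EE i else 0)" for f :: "nat \<Rightarrow> 'a mpoly3"
  define T' where "T' f = (\<lambda>i. if i < 3 then - (f 3 * EE i) else if i = 3 then g * f 3 else 0)" for f :: "nat \<Rightarrow> 'a mpoly3"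
  have sl: "slinear T" "slinear T'"
    by (auto intro!: slinearI simp: T_def T'_def algebra_simps)
  have V: "FV.subspace V" "FV.fdim V" "FV.subspace V'" "FV.fdim V'"
    unfolding V_def V'_def by (rule subspace_vsp fdim_vsp)+
  have NT: "N \<subseteq> T ` V"
  proof
    fix f assume f: "f \<in> N"
    obtain p q r t where pqr: "f 0 = g * p + t * Var 0" "f 1 = g * q + t * Var 1" "f 2 = g * r + t * Var 2"
      using koszul_mod[of "f 0" "f 1" "f 2"] N(2)[OF f] by blast
    \<comment> \<open>The cofactors from \<open>koszul_mod\<close> may be inhomogeneous; their
      components of the right degree serve as well.\<close>
    define F where "F = (\<lambda>i::nat. if i = 0 then hcomp (\<alpha> - d) p else if i = 1 then hcomp (\<alpha> - d) q else 
       if i = 2 then hcomp (\<alpha> - d) r else if i = 3 then hcomp (\<alpha> - 1) t else 0)"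
    have hc: "h = g * hcomp (\<alpha> - d) s + hcomp (\<alpha> - 1) t * Var i" if "h = g * s + t * Var i" "ihom \<alpha> h" for h s i
    proof -
      have "hcomp \<alpha> h = h" using that(2) by (simp add: hcomp_ihom)
      moreover have "hcomp \<alpha> (t * Var i) = hcomp (\<alpha> - 1) t * Var i"
        using hcomp_mult[OF ihom_Var, of \<alpha> i t] by (simp add: mult.commute)
      ultimately show ?thesis unfolding that(1) by (simp add: hcomp_add hcomp_g_mult)
    qed
    have fi: "ihom \<alpha> (f 0)" "ihom \<alpha> (f 1)" "ihom \<alpha> (f 2)" "f 3 = 0" "\<forall>i\<ge>4. f i = 0"
      using subsetD[OF N(1) f] by (auto simp: vsp_mem ihom_neg1)
    have "F \<in> V" by (simp add: V_def vsp_mem F_def)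
    moreover have "f = T F"
    proof
      fix i :: nat
      consider "i = 0" | "i = 1" | "i = 2" | "i = 3" | "i \<ge> 4" by linarith
      then show "f i = T F i"
        using hc[OF pqr(1) fi(1)] hc[OF pqr(2) fi(2)] hc[OF pqr(3) fi(3)] fi(4,5)
        by cases (auto simp: T_def F_def EE_simps)
    qed
    ultimately show "f \<in> T ` V" by blast
  qed
  have ker: "T' ` V' \<subseteq> {f \<in> V. T f = 0}"
  proof
    fix h assume "h \<in> T' ` V'"
    then obtain f where f: "ihom (\<alpha> - d - 1) (f 3)" "h = T' f" by (auto simp: V'_def vsp_mem)
    have "ihom (\<alpha> - d) (- (f 3 * EE i))" for i
      by (intro ihom_uminus ihom_mult'[OF f(1) ihom_EE]) simp
    moreover have "ihom (\<alpha> - 1) (g * f 3)"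
      by (rule ihom_mult'[OF ihom_g f(1)]) simp
    ultimately have "h \<in> V" by (simp add: f(2) T'_def V_def vsp_mem)
    moreover have "T h = 0" by (auto simp: T_def T'_def f(2) fun_eq_iff algebra_simps)
    ultimately show "h \<in> {f \<in> V. T f = 0}" by simp
  qed
  have "FV.dim (T' ` V') = FV.dim V'"
  proof (rule FV.dim_image_inj[OF slinear_linear[OF sl(2)] V(3,4)])
    fix v assume v: "v \<in> V'" "T' v = 0"
    then have "T' v 3 = 0" by simp
    then have "v 3 = 0" using g_nonzero by (simp add: T'_def)
    show "v = 0"
    proof
      fix i :: nat
      consider "i = 0" | "i = 1" | "i = 2" | "i = 3" | "i \<ge> 4" by linarith
      then show "v i = 0 i" using v(1) \<open>v 3 = 0\<close> by cases (auto simp: V'_def vsp_mem ihom_neg1)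
    qed
  qed
  then have k: "FV.dim V' \<le> FV.dim {f \<in> V. T f = 0}"
    using FV.fdim_dim_mono[OF ker FV.fdim_mono[OF _ V(2)]] by auto
  have "FV.dim N \<le> FV.dim (T ` V)"
    by (rule FV.fdim_dim_mono[OF NT FV.fdim_image[OF slinear_linear[OF sl(1)] V(2)]])
  moreover have "FV.dim V = FV.dim (T ` V) + FV.dim {f \<in> V. T f = 0}"
    by (rule FV.rank_nullity[OF slinear_linear[OF sl(1)] V(1,2)])
  ultimately have "int (FV.dim N) \<le> int (FV.dim V) - int (FV.dim V')" using k by linarith
  \<comment> \<open>The assumption \<open>\<alpha> \<ge> d - 1\<close> keeps all degrees at or above
    \<open>- 2\<close>, where \<open>hilb\<close> counts monomials.\<close>
  also have "int (FV.dim V) = 3 * hilb (\<alpha> - d) + hilb (\<alpha> - 1)"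
    unfolding V_def using \<alpha> d_pos by (intro dim_vsp) auto
  also have "int (FV.dim V') = hilb (\<alpha> - d - 1)"
    unfolding V'_def using \<alpha> d_pos by (subst dim_vsp) (auto simp: hilb_def)
  finally show ?thesis .
qed

end

context prime_form begin

text \<open>\<open>T0\<close> is the map \<open>(a, e) \<mapsto> a \<cdot> \<nabla>g + e g\<close> and \<open>K\<close> its kernel. Since \<open>e\<close> is determined by \<open>a\<close>, the dimension of \<open>K\<close>
  is bounded in terms of the space \<open>K'\<close> of all \<open>(a, t)\<close> with \<open>a \<times> (x, y, z) = t \<nabla>g\<close> modulo \<open>g\<close>.\<close>

lemma jacobian_degree_bound:
  assumes M: "\<And>m. m \<in> mons (int M) \<Longrightarrow> mon m 1 \<in> jac" and i0: "\<not> g dvd pd i0 g"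
    and k: "k \<ge> 3 * d - 5" "k \<ge> 2 * d - 2" and s: "ihom k s"
  shows "\<exists>a b c e. ihom (k - d + 1) a \<and> ihom (k - d + 1) b \<and> ihom (k - d + 1) c \<and> ihom (k - d) e \<and>
     s = a * pd 0 g + b * pd 1 g + c * pd 2 g + e * g"
proof -
  \<comment> \<open>\<open>\<alpha>\<close> is the degree of the coefficients of the partial
    derivatives and \<open>\<tau>\<close> that of the factor \<open>t\<close>; they satisfy
    \<open>\<alpha> + 1 = \<tau> + (d - 1)\<close>. The two bounds on \<open>k\<close> amount to
    \<open>\<tau> \<ge> d - 2\<close> and \<open>\<alpha> \<ge> d - 1\<close>.\<close>
  define \<alpha> where "\<alpha> = k - d + 1"
  define \<tau> where "\<tau> = k - 2 * d + 3"
  have \<alpha>: "\<alpha> \<ge> d - 1" and \<tau>: "\<tau> \<ge> d - 2" "\<tau> \<ge> 1" using k by (auto simp: \<alpha>_def \<tau>_def)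
  define V where "V = (vsp \<alpha> (k - d) :: (nat \<Rightarrow> 'a mpoly3) set)"
  define W where "W = (vsp (- 1) k :: (nat \<Rightarrow> 'a mpoly3) set)"
  define T0 where "T0 f = (\<lambda>i::nat. if i = 3 then f 0 * pd 0 g + f 1 * pd 1 g + f 2 * pd 2 g + f 3 * g else 0)" for f :: "nat \<Rightarrow> 'a mpoly3"
  \<comment> \<open>\<open>T1\<close> keeps the vector and \<open>T3\<close> the scalar,
    \<open>T6\<close> produces scalars divisible by \<open>g\<close>, and \<open>D\<close> is the
    cross product with the variables minus \<open>t\<close> times the gradient.\<close>
  define T1 where "T1 f = (\<lambda>i. if i < 3 then f i else 0)" for f :: "nat \<Rightarrow> 'a mpoly3"
  define T3 where "T3 f = (\<lambda>i::nat. if i = 3 then f i else 0)" for f :: "nat \<Rightarrow> 'a mpoly3"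
  define T6 where "T6 f = (\<lambda>i::nat. if i = 3 then g * f i else 0)" for f :: "nat \<Rightarrow> 'a mpoly3"
  define D where "D f = (\<lambda>i::nat. if i = 0 then f 1 * Var 2 - f 2 * Var 1 - f 3 * pd 0 g else 
      if i = 1 then f 2 * Var 0 - f 0 * Var 2 - f 3 * pd 1 g else 
      if i = 2 then f 0 * Var 1 - f 1 * Var 0 - f 3 * pd 2 g else 0)" for f :: "nat \<Rightarrow> 'a mpoly3"
  define K where "K = {f \<in> V. T0 f = 0}"
  define K' where "K' = vsp \<alpha> \<tau> \<inter> {f. \<forall>i. g dvd D f i}"
  have sl: "slinear T0" "slinear T1" "slinear T3" "slinear T6" "slinear D"
    by (auto intro!: slinearI simp: T0_def T1_def T3_def T6_def D_def algebra_simps)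
  have V: "FV.subspace V" "FV.fdim V" and W: "FV.subspace W" "FV.fdim W"
    unfolding V_def W_def by (rule subspace_vsp fdim_vsp)+
  have K: "FV.subspace K" "FV.fdim K"
    using subspace_ker[OF sl(1) V(1)] FV.fdim_mono[OF _ V(2), of K] by (auto simp: K_def)
  have K': "FV.subspace K'" "FV.fdim K'"
    unfolding K'_def
    by (rule FV.subspace_inter[OF subspace_vsp subspace_dvd[OF sl(5)]], rule FV.fdim_mono[OF Int_lower1 fdim_vsp])
  have cases4: "i = 0 \<or> i = 1 \<or> i = 2 \<or> i = 3 \<or> i \<ge> 4" for i :: nat by linarith
  have Var_comp: "hcomp l (h * Var i) = hcomp (l - 1) h * Var i" for l h i
    using hcomp_mult[OF ihom_Var, of l i h] by (simp add: mult.commute)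
  have pd_comp: "hcomp l (h * pd i g) = hcomp (l - (d - 1)) h * pd i g" for l h i
    using hcomp_mult[OF ihom_pd_g, of l i h] by (simp add: mult.commute)

  \<comment> \<open>By \<open>syzygy_parallel\<close> the vector part of a syzygy extends to an
    element of \<open>K'\<close>. On \<open>K\<close> itself \<open>T1\<close> is injective.\<close>
  have "T1 ` K \<subseteq> T1 ` K'"
  proof
    fix h assume "h \<in> T1 ` K"
    then obtain f where f: "f \<in> V" "T0 f = 0" "h = T1 f" by (auto simp: K_def)
    have fh: "ihom \<alpha> (f 0)" "ihom \<alpha> (f 1)" "ihom \<alpha> (f 2)" using f(1) by (auto simp: V_def vsp_mem)
    have "T0 f 3 = 0" using f(2) by simp
    then have "f 0 * pd 0 g + f 1 * pd 1 g + f 2 * pd 2 g = g * (- f 3)"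
      by (simp add: T0_def eq_neg_iff_add_eq_0 mult.commute)
    then have "g dvd f 0 * pd 0 g + f 1 * pd 1 g + f 2 * pd 2 g" by simp
    from syzygy_parallel[OF M i0 this]
    obtain t where t: "g dvd (f 1 * Var 2 - f 2 * Var 1) - t * pd 0 g" "g dvd (f 2 * Var 0 - f 0 * Var 2) - t * pd 1 g"
      "g dvd (f 0 * Var 1 - f 1 * Var 0) - t * pd 2 g" by blast
    define F where "F = (\<lambda>i::nat. if i < 3 then f i else if i = 3 then hcomp \<tau> t else 0)"
    have e: "\<alpha> + 1 - (d - 1) = \<tau>" by (simp add: \<alpha>_def \<tau>_def)
    have hf: "hcomp \<alpha> (f 0) = f 0" "hcomp \<alpha> (f 1) = f 1" "hcomp \<alpha> (f 2) = f 2" using fh by (auto simp: hcomp_ihom)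
    have "g dvd (f 1 * Var 2 - f 2 * Var 1) - hcomp \<tau> t * pd 0 g" "g dvd (f 2 * Var 0 - f 0 * Var 2) - hcomp \<tau> t * pd 1 g"
      "g dvd (f 0 * Var 1 - f 1 * Var 0) - hcomp \<tau> t * pd 2 g"
      using t[THEN hcomp_dvd, of "\<alpha> + 1"] e hf by (simp_all add: Var_comp pd_comp)
    then have "\<forall>i. g dvd D F i" by (simp add: D_def F_def)
    moreover have "F \<in> vsp \<alpha> \<tau>" using fh by (simp add: vsp_mem F_def)
    ultimately have "F \<in> K'" by (simp add: K'_def)
    moreover have "h = T1 F" by (auto simp: f(3) T1_def F_def)
    ultimately show "h \<in> T1 ` K'" by blast
  qed
  moreover have "FV.dim (T1 ` K) = FV.dim K"
  proof (rule FV.dim_image_inj[OF slinear_linear[OF sl(2)] K])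
    fix v assume v: "v \<in> K" "T1 v = 0"
    have v0: "v i = 0" if "i < 3" for i using fun_cong[OF v(2), of i] that by (simp add: T1_def)
    have "T0 v 3 = 0" using v(1) by (simp add: K_def)
    then have "v 3 = 0" using v0 g_nonzero by (simp add: T0_def)
    show "v = 0"
    proof
      fix i :: nat
      show "v i = 0 i" using cases4[of i] v0 \<open>v 3 = 0\<close> v(1) by (auto simp: K_def V_def vsp_mem)
    qed
  qed
  ultimately have "FV.dim K \<le> FV.dim (T1 ` K')"
    using FV.fdim_dim_mono[OF _ FV.fdim_image[OF slinear_linear[OF sl(2)] K'(2)]] by metis
  moreover have "FV.dim K' = FV.dim (T1 ` K') + FV.dim {f \<in> K'. T1 f = 0}"
    by (rule FV.rank_nullity[OF slinear_linear[OF sl(2)] K'])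
  \<comment> \<open>With vector part zero, every scalar divisible by \<open>g\<close> lies in
    \<open>K'\<close>.\<close>
  moreover have "hilb (\<tau> - d) \<le> int (FV.dim {f \<in> K'. T1 f = 0})"
  proof -
    let ?S = "vsp (- 1) (\<tau> - d) :: (nat \<Rightarrow> 'a mpoly3) set"
    have "T6 ` ?S \<subseteq> {f \<in> K'. T1 f = 0}"
    proof
      fix h assume "h \<in> T6 ` ?S"
      then obtain f where f: "h = T6 f" "ihom (\<tau> - d) (f 3)" by (auto simp: vsp_mem)
      have "ihom \<tau> (g * f 3)" by (rule ihom_mult'[OF ihom_g f(2)]) simp
      then show "h \<in> {f \<in> K'. T1 f = 0}"
        by (auto simp: K'_def vsp_mem f(1) T6_def T1_def D_def fun_eq_iff)
    qed
    then have "FV.dim (T6 ` ?S) \<le> FV.dim {f \<in> K'. T1 f = 0}"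
      by (rule FV.fdim_dim_mono) (rule FV.fdim_mono[OF _ K'(2)], blast)
    moreover have "FV.dim (T6 ` ?S) = FV.dim ?S"
    proof (rule FV.dim_image_inj[OF slinear_linear[OF sl(4)] subspace_vsp fdim_vsp])
      fix v assume v: "v \<in> ?S" "T6 v = 0"
      then have "T6 v 3 = 0" by simp
      then have "v 3 = 0" using g_nonzero by (simp add: T6_def)
      show "v = 0"
      proof
        fix i :: nat
        show "v i = 0 i" using cases4[of i] \<open>v 3 = 0\<close> v(1) by (auto simp: vsp_mem ihom_neg1)
      qed
    qed
    moreover have "int (FV.dim ?S) = hilb (\<tau> - d)"
      using \<tau> by (subst dim_vsp) (auto simp: hilb_def)
    ultimately show ?thesis by simp
  qed
  moreover have "FV.dim K' = FV.dim (T3 ` K') + FV.dim {f \<in> K'. T3 f = 0}"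
    by (rule FV.rank_nullity[OF slinear_linear[OF sl(3)] K'])
  moreover have "int (FV.dim (T3 ` K')) \<le> hilb \<tau>"
  proof -
    let ?S = "vsp (- 1) \<tau> :: (nat \<Rightarrow> 'a mpoly3) set"
    have "T3 ` K' \<subseteq> ?S" by (auto simp: K'_def vsp_mem T3_def)
    then have "FV.dim (T3 ` K') \<le> FV.dim ?S" by (rule FV.fdim_dim_mono[OF _ fdim_vsp])
    moreover have "int (FV.dim ?S) = hilb \<tau>"
      using \<tau> by (subst dim_vsp) (auto simp: hilb_def)
    ultimately show ?thesis by simp
  qed
  moreover have "int (FV.dim {f \<in> K'. T3 f = 0}) \<le> 3 * hilb (\<alpha> - d) + hilb (\<alpha> - 1) - hilb (\<alpha> - d - 1)"
  proof (rule dim_parallel[OF \<alpha>])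
    show "{f \<in> K'. T3 f = 0} \<subseteq> vsp \<alpha> (- 1)"
      by (auto simp: K'_def vsp_mem T3_def fun_eq_iff)
    fix f assume f: "f \<in> {f \<in> K'. T3 f = 0}"
    then have "T3 f 3 = 0" by simp
    then have "f 3 = 0" by (simp add: T3_def)
    moreover have "g dvd D f 0" "g dvd D f 1" "g dvd D f 2" using f by (auto simp: K'_def)
    ultimately show "g dvd f 0 * Var 1 - f 1 * Var 0 \<and> g dvd f 2 * Var 0 - f 0 * Var 2 \<and> g dvd f 1 * Var 2 - f 2 * Var 1"
      by (simp add: D_def)
  qed
  ultimately have "int (FV.dim K) \<le> hilb \<tau> + 3 * hilb (\<alpha> - d) + hilb (\<alpha> - 1) - hilb (\<alpha> - d - 1) - hilb (\<tau> - d)"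
    by linarith
  moreover have "int (FV.dim V) = int (FV.dim (T0 ` V)) + int (FV.dim K)"
    using FV.rank_nullity[OF slinear_linear[OF sl(1)] V] unfolding K_def by linarith
  moreover have "int (FV.dim V) = 3 * hilb \<alpha> + hilb (k - d)"
    unfolding V_def using \<alpha> d_pos by (intro dim_vsp) (auto simp: \<alpha>_def)
  moreover have "int (FV.dim W) = hilb k"
    unfolding W_def using k d_pos by (subst dim_vsp) (auto simp: hilb_def)
  \<comment> \<open>The upper bound for the dimension of \<open>K\<close> is exactly
    \<open>dim V - dim W\<close>, so the image of \<open>T0\<close> fills \<open>W\<close>. Doubling
    avoids the division in \<open>hilb\<close>.\<close>
  moreover have "2 * (3 * hilb \<alpha> + hilb (k - d)) - 2 * (hilb \<tau> + 3 * hilb (\<alpha> - d) + hilb (\<alpha> - 1) - hilb (\<alpha> - d - 1) - hilb (\<tau> - d)) = 2 * hilb k"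
    unfolding right_diff_distrib distrib_left mult.left_commute[of 2 3] hilb_double
    by (simp add: \<alpha>_def \<tau>_def algebra_simps)
  moreover have "w \<le> t" if "x \<le> b" "v = t + x" "v = a" "w = h" "2 * a - 2 * b = 2 * h" for x b v t a w h :: int
    using that by linarith
  ultimately have "int (FV.dim W) \<le> int (FV.dim (T0 ` V))" by blast
  then have "FV.dim W \<le> FV.dim (T0 ` V)" by simp
  moreover have "T0 ` V \<subseteq> W"
  proof
    fix h assume "h \<in> T0 ` V"
    then obtain f where f: "f \<in> V" "h = T0 f" by blast
    then have fh: "ihom \<alpha> (f 0)" "ihom \<alpha> (f 1)" "ihom \<alpha> (f 2)" "ihom (k - d) (f 3)" by (auto simp: V_def vsp_mem)
    have "ihom k (f 0 * pd 0 g + f 1 * pd 1 g + f 2 * pd 2 g + f 3 * g)"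
      by (intro ihom_add ihom_mult'[OF fh(1) ihom_pd_g] ihom_mult'[OF fh(2) ihom_pd_g] ihom_mult'[OF fh(3) ihom_pd_g] ihom_mult'[OF fh(4) ihom_g])
         (simp_all add: \<alpha>_def)
    then show "h \<in> W" by (simp add: W_def vsp_mem f(2) T0_def)
  qed
  moreover have "FV.subspace (T0 ` V)"
  proof -
    interpret T0: Vector_Spaces.linear fscale fscale T0 by (rule slinear_linear[OF sl(1)])
    show ?thesis by (rule T0.subspace_image[OF V(1)])
  qed
  ultimately have "T0 ` V = W" using FV.fdim_dim_eq[OF _ W(2)] by blast
  moreover have "(\<lambda>i. if i = 3 then s else 0) \<in> W" using s by (simp add: W_def vsp_mem)
  ultimately have "(\<lambda>i. if i = 3 then s else 0) \<in> T0 ` V" by simp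
  then obtain f where f: "f \<in> V" "(\<lambda>i. if i = 3 then s else 0) = T0 f" by (elim imageE)
  from fun_cong[OF f(2), of 3] have "s = f 0 * pd 0 g + f 1 * pd 1 g + f 2 * pd 2 g + f 3 * g"
    by (simp add: T0_def)
  then show ?thesis using f(1) unfolding V_def vsp_mem \<alpha>_def by blast
qed

end

section \<open>Substitution and evaluation\<close>

lemma prod_UNIV_3: "(\<Prod>i\<in>UNIV. f i) = f 0 * f 1 * f (2::3)"
  for f :: "3 \<Rightarrow> 'b::comm_monoid_mult"
  unfolding UNIV_3 by (simp add: neq_3 mult.assoc)

definition subst3 :: "(3 \<Rightarrow> 'a::comm_ring_1 mpoly3) \<Rightarrow> 'a mpoly3 \<Rightarrow> 'a mpoly3" where
  "subst3 \<theta> = mext (\<lambda>m c. const c * (\<Prod>i\<in>UNIV. \<theta> i ^ cexp m i))"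

lemma subst3_add: "subst3 \<theta> (f + h) = subst3 \<theta> f + subst3 \<theta> h"
  unfolding subst3_def by (rule mext_add) (auto simp: single_add algebra_simps)

lemmas subst3_additive [simp] = additive_uminus[of "subst3 \<theta>" for \<theta>, OF subst3_add]

lemma subst3_mon: "subst3 \<theta> (mon m c) = const c * (\<Prod>i\<in>UNIV. \<theta> i ^ cexp m i)"
  unfolding subst3_def by (rule mext_mon) auto

lemma subst3_mult: "subst3 \<theta> (f * h) = subst3 \<theta> f * subst3 \<theta> h"
proof (induction f rule: mpoly3_induct)
  case (single m c)
  show ?case
  proof (induction h rule: mpoly3_induct)
    case (single n e)
    have cc: "const (c * e) = const c * const e" by (simp add: mult_single)
    have mm: "mon m c * mon n e = mon (m + n) (c * e)" by (rule mult_single)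
    show ?case
      unfolding mm subst3_mon cc lookup_add power_add prod.distrib by (simp only: mult_ac)
  qed (auto simp: subst3_add algebra_simps)
qed (auto simp: subst3_add algebra_simps)

lemma prod_UNIV_single: "(\<Prod>j\<in>UNIV. f j ^ cexp (Poly_Mapping.single i 1) j) = (f i :: 'b::comm_monoid_mult)"
proof -
  have "(\<Prod>j\<in>UNIV. f j ^ cexp (Poly_Mapping.single i 1) j) = (\<Prod>j\<in>UNIV. if j = i then f j else 1)"
    by (rule prod.cong) (auto simp: lookup_single when_def)
  then show ?thesis by simp
qed

lemma subst3_Var: "subst3 \<theta> (Var i) = \<theta> i"
  unfolding Var_def subst3_mon prod_UNIV_single by simp

lemma subst3_const: "subst3 \<theta> (const c) = const c"
  by (simp add: subst3_mon)

lemma mon_eq_prod: "mon m c = const c * (\<Prod>i\<in>UNIV. Var i ^ cexp m i)"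
proof -
  have "Var i ^ n = mon (Poly_Mapping.single i n) (1::'a::comm_ring_1)" for i n
    by (induction n) (auto simp: Var_def mult_single simp flip: single_add)
  then have "(\<Prod>i\<in>UNIV. Var i ^ cexp m i) = mon (\<Sum>i\<in>UNIV. Poly_Mapping.single i (cexp m i)) (1::'a)"
    by (simp add: prod_UNIV_3 sum_UNIV_3 mult_single)
  also have "(\<Sum>i\<in>UNIV. Poly_Mapping.single i (cexp m i)) = m"
    by (rule cexp_eqI) (simp add: lookup_sum lookup_single when_def)
  finally show ?thesis by (simp add: mult_single)
qed

lemma mideal_power_diff: "mideal J \<Longrightarrow> a - b \<in> J \<Longrightarrow> a ^ n - b ^ n \<in> J"
proof (induction n)
  case (Suc n)
  have "a ^ Suc n - b ^ Suc n = a * (a ^ n - b ^ n) + (a - b) * b ^ n" by (simp add: algebra_simps)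
  then show ?case using Suc by (metis mideal_add mideal_mult mideal_mult_right)
qed (simp add: mideal_zero)

lemma mideal_mult_diff: "mideal J \<Longrightarrow> a - b \<in> J \<Longrightarrow> c - e \<in> J \<Longrightarrow> a * c - b * e \<in> J"
proof -
  assume *: "mideal J" "a - b \<in> J" "c - e \<in> J"
  have "a * c - b * e = a * (c - e) + (a - b) * e" by (simp add: algebra_simps)
  then show ?thesis using * by (metis mideal_add mideal_mult mideal_mult_right)
qed

lemma subst3_diff_in:
  assumes J: "mideal J" and "\<And>i. Var i - \<theta> i \<in> J"
  shows "f - subst3 \<theta> f \<in> J"
proof (induction f rule: mpoly3_induct)
  case (single m c)
  have pw: "Var i ^ n - \<theta> i ^ n \<in> J" for i n by (rule mideal_power_diff[OF assms])
  have "(\<Prod>i\<in>UNIV. Var i ^ cexp m i) - (\<Prod>i\<in>UNIV. \<theta> i ^ cexp m i) \<in> J"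
    unfolding prod_UNIV_3 by (intro mideal_mult_diff[OF J] pw)
  then have "const c * ((\<Prod>i\<in>UNIV. Var i ^ cexp m i) - (\<Prod>i\<in>UNIV. \<theta> i ^ cexp m i)) \<in> J"
    by (rule mideal_mult[OF J])
  then show ?case unfolding right_diff_distrib by (simp only: subst3_mon flip: mon_eq_prod)
next
  case (add f h)
  have "(f + h) - subst3 \<theta> (f + h) = (f - subst3 \<theta> f) + (h - subst3 \<theta> h)" by (simp add: subst3_add)
  then show ?case using add mideal_add[OF J] by metis
qed (simp add: mideal_zero[OF J])

definition ev :: "(3 \<Rightarrow> 'a::comm_ring_1) \<Rightarrow> 'a mpoly3 \<Rightarrow> 'a" where
  "ev P = mext (\<lambda>m c. c * (\<Prod>i\<in>UNIV. P i ^ cexp m i))"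

lemma ev_add: "ev P (f + h) = ev P f + ev P h"
  unfolding ev_def by (rule mext_add) (auto simp: algebra_simps)

lemmas ev_additive [simp] = additive_uminus[of "ev P" for P, OF ev_add]

lemma ev_mon: "ev P (mon m c) = c * (\<Prod>i\<in>UNIV. P i ^ cexp m i)"
  unfolding ev_def by (rule mext_mon) auto

lemma ev_mult: "ev P (f * h) = ev P f * ev P h"
proof (induction f rule: mpoly3_induct)
  case (single m c)
  show ?case
  proof (induction h rule: mpoly3_induct)
    case (single n e)
    then show ?case
      by (simp add: mult_single ev_mon lookup_add power_add prod.distrib mult_ac)
  qed (auto simp: ev_add algebra_simps)
qed (auto simp: ev_add algebra_simps)

lemma ev_Var: "ev P (Var i) = P i"
  unfolding Var_def ev_mon prod_UNIV_single by simp

lemma ev_const: "ev P (const c) = c"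
  by (simp add: ev_mon)

lemma ev_one [simp]: "ev P 1 = 1"
  using ev_const[of P 1] by simp

lemma subst3_line:
  assumes "ihom (int k) f"
  shows "subst3 (\<lambda>i. const (P i) * Var l) f = const (ev P f) * Var l ^ k"
proof -
  have *: "subst3 (\<lambda>i. const (P i) * Var l) (mon m c) = const (ev P (mon m c)) * Var l ^ monom_deg m" for m c
  proof -
    have cm: "const (a * b) = const a * const b" for a b :: 'a by (simp add: mult_single)
    have pw: "const (a ^ n) = const a ^ n" for a :: 'a and n
      by (induction n) (auto simp: cm)
    show ?thesis
      by (simp add: subst3_mon ev_mon power_mult_distrib prod_UNIV_3 monom_deg_3 power_add mult_ac cm pw)
  qed
  \<comment> \<open>The induction runs over arbitrary polynomials and cuts out the part of degree
    \<open>k\<close>.\<close>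
  have "subst3 (\<lambda>i. const (P i) * Var l) (hcomp (int k) h) = const (ev P (hcomp (int k) h)) * Var l ^ k" for h
    by (induction h rule: mpoly3_induct) (auto simp: hcomp_add hcomp_mon subst3_add ev_add * single_add distrib_right)
  from this[of f] show ?thesis using assms by (simp add: hcomp_ihom)
qed

lemma lookup_pd: "Poly_Mapping.lookup (pd l f) m = of_nat (Suc (cexp m l)) * Poly_Mapping.lookup f (m + Poly_Mapping.single l 1)"
proof (induction f rule: mpoly3_induct)
  case (single n c)
  show ?case
  proof (cases "n = m + Poly_Mapping.single l 1")
    case False
    have "of_nat (cexp n l) * c = 0" if "n - Poly_Mapping.single l 1 = m"
    proof (cases "cexp n l = 0")
      case False
      then have "n = (n - Poly_Mapping.single l 1) + Poly_Mapping.single l 1"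
        by (intro cexp_eqI) (auto simp: lookup_add lookup_minus lookup_single when_def)
      then show ?thesis using that \<open>n \<noteq> _\<close> by simp
    qed simp
    then show ?thesis using False by (auto simp: pd_mon lookup_single when_def simp del: One_nat_def)
  qed (simp add: pd_mon lookup_add)
qed (auto simp: pd_add lookup_add algebra_simps)

section \<open>Normal cones are smooth away from the vertex\<close>

definition pencil :: "'b::comm_ring_1 \<Rightarrow> 'b \<Rightarrow> 'b set" where
  "pencil u v = {a * u + b * v | a b. True}"

lemma mideal_pencil: "mideal (pencil u v)"
  unfolding mideal_def
proof (intro conjI ballI allI)
  show "0 \<in> pencil u v" unfolding pencil_def by (rule CollectI, rule exI[of _ 0], rule exI[of _ 0]) simp
  fix x assume "x \<in> pencil u v"
  then obtain a b where x: "x = a * u + b * v" by (auto simp: pencil_def)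
  {
    fix y assume "y \<in> pencil u v"
    then obtain a' b' where y: "y = a' * u + b' * v" by (auto simp: pencil_def)
    have "x + y = (a + a') * u + (b + b') * v" by (simp add: x y algebra_simps)
    then show "x + y \<in> pencil u v" unfolding pencil_def by blast
  }
  fix r
  have "r * x = (r * a) * u + (r * b) * v" by (simp add: x algebra_simps)
  then show "r * x \<in> pencil u v" unfolding pencil_def by blast
qed

lemma ihom_line: "ihom 1 (Var i - const c * Var l)"
  by (intro ihom_diff ihom_Var ihom_mult'[OF ihom_const ihom_Var]) simp

text \<open>For a point with \<open>P l = 1\<close> these are lines through the point; the two with
  index other than \<open>l\<close> generate its ideal.\<close>

definition line_form :: "(3 \<Rightarrow> 'a::comm_ring_1) \<Rightarrow> 3 \<Rightarrow> 3 \<Rightarrow> 'a mpoly3" where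
  "line_form P l i = Var i - const (P i) * Var l"

context
  fixes i j l :: 3 and P :: "3 \<Rightarrow> 'a::field"
  assumes ijl: "UNIV = {i, j, l}" "i \<noteq> j" "i \<noteq> l" "j \<noteq> l" and Pl: "P l = 1"
begin

abbreviation "lin1 \<equiv> line_form P l i"
abbreviation "lin2 \<equiv> line_form P l j"

lemma lin_coords:
  assumes "mideal J" "lin1 \<in> J" "lin2 \<in> J"
  shows "Var k - const (P k) * Var l \<in> J"
proof -
  have "k \<in> {i, j, l}" using ijl(1) by blast
  then consider "k = i" | "k = j" | "k = l" by blast
  then show ?thesis
    using assms Pl mideal_zero by cases (auto simp: line_form_def)
qed

text \<open>Modulo the two lines each \<open>Var k\<close> is \<open>P k\<close> times
  \<open>Var l\<close>, which reduces a form to its value at the point.\<close>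

lemma homogeneous_mod_lines:
  assumes "mideal J" "lin1 \<in> J" "lin2 \<in> J" "ihom (int k) f"
  shows "f - const (ev P f) * Var l ^ k \<in> J"
  using subst3_diff_in[OF assms(1), of "\<lambda>k. const (P k) * Var l" f] lin_coords[OF assms(1-3)] subst3_line[OF assms(4), of P l]
  by simp

lemma vanish_at_point:
  assumes f: "ihom (int k) f" and P: "ev P f = 0"
  obtains A B where "f = A * lin1 + B * lin2" "ihom (int k - 1) A" "ihom (int k - 1) B"
proof -
  have "lin1 = 1 * lin1 + 0 * lin2" "lin2 = 0 * lin1 + 1 * lin2" by auto
  then have "lin1 \<in> pencil lin1 lin2" "lin2 \<in> pencil lin1 lin2"
    unfolding pencil_def by blast+
  from homogeneous_mod_lines[OF mideal_pencil this f] have "f \<in> pencil lin1 lin2" using P by simp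
  then obtain A B where AB: "f = A * lin1 + B * lin2" by (auto simp: pencil_def)
  have hc: "hcomp (int k) (A * (Var i - const c * Var l)) = hcomp (int k - 1) A * (Var i - const c * Var l)" for A i and c :: 'a
    by (metis hcomp_mult[OF ihom_line] mult.commute)
  have "f = hcomp (int k) f" using f by (simp add: hcomp_ihom)
  also have "\<dots> = hcomp (int k - 1) A * lin1 + hcomp (int k - 1) B * lin2"
    unfolding AB line_form_def by (simp only: hcomp_add hc)
  finally show ?thesis using that by simp
qed

lemma ev_lin: "ev P lin1 = 0" "ev P lin2 = 0"
  using Pl by (simp_all add: line_form_def ev_mult ev_Var ev_const)

lemma pd_lin: "pd i lin1 = 1" "pd j lin1 = 0" "pd i lin2 = 0" "pd j lin2 = 1"
  using ijl by (simp_all add: line_form_def pd_mult pd_Var)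

end

text \<open>Normality enters through quadratic equations, cleared of denominators: a fraction
  \<open>s / y\<close> that is a root of a monic quadratic polynomial lies in the ring.\<close>

locale normal_form = prime_form g d for g :: "'a::field mpoly3" and d +
  assumes normal: "\<And>s y b c. \<not> g dvd y \<Longrightarrow> g dvd s ^ 2 - b * s * y + c * y ^ 2 \<Longrightarrow> \<exists>w. g dvd s - w * y"
begin

text \<open>At a singular point \<open>g = aX\<^sup>2 + bXY + cY\<^sup>2\<close> for linear forms \<open>X\<close>, \<open>Y\<close> through that point, and the fraction
  \<open>u = (aX + bY)/Y\<close> satisfies \<open>u\<^sup>2 - bu + ac = 0\<close>, but it is not in the ring.\<close>

lemma nonsingular:
  assumes P: "P l = 1" "ev P g = 0" "\<And>i. ev P (pd i g) = 0"
  shows False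
proof -
  obtain i j where ijl: "UNIV = {i, j, l}" "i \<noteq> j" "i \<noteq> l" "j \<noteq> l" using distinct_triple_3 .
  define x where "x = line_form P l i"
  define y where "y = line_form P l j"
  note vanish = vanish_at_point[where P = P and i = i and j = j and l = l, OF ijl P(1), folded x_def y_def]
  note evxy = ev_lin[where P = P and i = i and j = j and l = l, OF ijl P(1), folded x_def y_def]
  note pdxy = pd_lin[where P = P and i = i and j = j and l = l, OF ijl P(1), folded x_def y_def]
  have d: "int (nat d) = d" "int (nat (d - 1)) = d - 1" using d_pos by auto
  obtain A B where g: "g = A * x + B * y" and AB: "ihom (d - 1) A" "ihom (d - 1) B"
    using vanish[of "nat d" g] ihom_g P(2) d by auto
  \<comment> \<open>As \<open>x\<close> and \<open>y\<close> vanish at the point, the values of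
    \<open>A\<close> and \<open>B\<close> there are those of the partial derivatives of
    \<open>g\<close>.\<close>
  have "ev P A = 0" "ev P B = 0"
    using P(3)[of i] P(3)[of j] unfolding g by (simp_all add: pd_add pd_mult ev_add ev_mult evxy pdxy)
  then obtain a b1 b2 c where A: "A = a * x + b1 * y" and B: "B = b2 * x + c * y"
    using vanish[of "nat (d - 1)" A] vanish[of "nat (d - 1)" B] AB d by metis
  let ?b = "b1 + b2"
  have geq: "g = a * x ^ 2 + ?b * x * y + c * y ^ 2"
    unfolding g A B by (simp add: algebra_simps power2_eq_square)
  \<comment> \<open>Otherwise \<open>pd j y = 1\<close> would vanish at the singular point.\<close>
  have Yd: "\<not> g dvd y"
  proof
    assume "g dvd y"
    then obtain h where h: "y = g * h" by (elim dvdE)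
    have "ev P (pd j y) = ev P (pd j (g * h))" using h by simp
    then show False using P(2,3) pdxy by (simp add: pd_mult ev_add ev_mult)
  qed
  have "(a * x + ?b * y) ^ 2 - ?b * (a * x + ?b * y) * y + (a * c) * y ^ 2 = g * a"
    unfolding geq by (simp add: algebra_simps power2_eq_square)
  then have "g dvd (a * x + ?b * y) ^ 2 - ?b * (a * x + ?b * y) * y + (a * c) * y ^ 2" by simp
  from normal[OF Yd this] obtain w v where wv: "(a * x + ?b * y) - w * y = g * v" by (elim exE dvdE)
  \<comment> \<open>Restriction to the line \<open>y = 0\<close>. There the relation reads
    \<open>a * x = a * x ^ 2 * v\<close>, and \<open>1 - x * v\<close> is nonzero because
    \<open>x\<close> vanishes at the point. So \<open>a\<close> vanishes on the line, that is,
    \<open>y\<close> divides \<open>a\<close>.\<close>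
  define \<theta> where "\<theta> k = (if k = j then const (P j) * Var l else Var k)" for k
  have \<theta>y: "subst3 \<theta> y = 0"
    unfolding y_def line_form_def using ijl by (simp add: subst3_mult subst3_Var subst3_const \<theta>_def)
  have \<theta>x: "subst3 \<theta> x = x"
    unfolding x_def line_form_def using ijl by (simp add: subst3_mult subst3_Var subst3_const \<theta>_def)
  have \<theta>g: "subst3 \<theta> g = subst3 \<theta> a * x ^ 2"
    unfolding geq by (simp add: subst3_add subst3_mult \<theta>x \<theta>y power2_eq_square)
  have "subst3 \<theta> ((a * x + ?b * y) - w * y) = subst3 \<theta> (g * v)" using wv by simp
  then have "subst3 \<theta> a * x = subst3 \<theta> a * x ^ 2 * subst3 \<theta> v"
    by (simp add: subst3_add subst3_mult \<theta>x \<theta>y \<theta>g)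
  then have "subst3 \<theta> a * (x * (1 - x * subst3 \<theta> v)) = 0"
    by (simp add: algebra_simps power2_eq_square)
  moreover have "x \<noteq> 0" using pdxy(1) by auto
  moreover have "1 - x * subst3 \<theta> v \<noteq> 0"
  proof
    assume "1 - x * subst3 \<theta> v = 0"
    then have "ev P (1 - x * subst3 \<theta> v) = 0" by simp
    then show False by (simp add: ev_mult evxy)
  qed
  ultimately have "subst3 \<theta> a = 0" by simp
  moreover have "a - subst3 \<theta> a \<in> pencil y 0"
  proof (rule subst3_diff_in[OF mideal_pencil])
    fix k
    have "Var k - \<theta> k = (if k = j then 1 else 0) * y + 0 * 0"
      unfolding y_def line_form_def \<theta>_def by simp
    then show "Var k - \<theta> k \<in> pencil y 0" unfolding pencil_def by blast
  qed
  ultimately obtain a' where a': "a = a' * y" by (auto simp: pencil_def)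
  \<comment> \<open>Now \<open>y\<close> divides \<open>g\<close>, and primality makes
    \<open>y\<close> a unit although it vanishes at the point.\<close>
  have gY: "g = y * (a' * x ^ 2 + ?b * x + c * y)"
    unfolding geq a' by (simp add: algebra_simps power2_eq_square)
  then have "g dvd y * (a' * x ^ 2 + ?b * x + c * y)" by simp
  then obtain h where h: "a' * x ^ 2 + ?b * x + c * y = g * h" using Yd dvd_cancel by (metis dvdE)
  have "g * 1 = g * (y * h)" using gY unfolding h by (simp add: algebra_simps)
  then have "y * h = 1" using g_nonzero by (metis mult_left_cancel)
  then have "ev P (y * h) = 1" by simp
  then show False by (simp add: ev_mult evxy)
qed

end

section \<open>A homogeneous Nullstellensatz\<close>

text \<open>Homogenization of a polynomial in one variable to degree \<open>n\<close>. When
  \<open>n\<close> exceeds \<open>degree q\<close>, the excess appears as a power of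
  \<open>Var l\<close>.\<close>

definition binary_form :: "3 \<Rightarrow> 3 \<Rightarrow> nat \<Rightarrow> 'a::comm_ring_1 poly \<Rightarrow> 'a mpoly3" where
  "binary_form i l n q = (\<Sum>k\<le>n. const (coeff q k) * (Var i ^ k * Var l ^ (n - k)))"

lemma binary_form_add: "binary_form i l n (q + r) = binary_form i l n q + binary_form i l n r"
  by (simp add: binary_form_def single_add distrib_right sum.distrib)

lemma binary_form_smult: "binary_form i l n (smult c q) = const c * binary_form i l n q"
proof -
  have "const (c * e) = const c * const e" for e by (simp add: mult_single)
  then show ?thesis unfolding binary_form_def coeff_smult sum_distrib_left by (simp only: mult.assoc)
qed

lemma binary_form_shift:
  assumes "degree q \<le> n"
  shows "binary_form i l (Suc n) q = Var l * binary_form i l n q"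
proof -
  have "coeff q (Suc n) = 0" using assms by (intro coeff_eq_0) simp
  then have "binary_form i l (Suc n) q = (\<Sum>k\<le>n. const (coeff q k) * (Var i ^ k * Var l ^ (Suc n - k)))"
    by (simp add: binary_form_def)
  also have "\<dots> = (\<Sum>k\<le>n. Var l * (const (coeff q k) * (Var i ^ k * Var l ^ (n - k))))"
    by (intro sum.cong refl) (simp add: Suc_diff_le mult_ac)
  finally show ?thesis by (simp add: binary_form_def sum_distrib_left)
qed

lemma binary_form_shift_power:
  "degree q \<le> n \<Longrightarrow> binary_form i l (N + n) q = Var l ^ N * binary_form i l n q"
  by (induction N) (auto simp: binary_form_shift mult_ac)

lemma binary_form_root:
  assumes "degree q \<le> n"
  shows "binary_form i l (Suc n) ([:- a, 1:] * q) = (Var i - const a * Var l) * binary_form i l n q"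
proof -
  have "binary_form i l (Suc n) (pCons 0 q) = (\<Sum>k\<le>n. const (coeff q k) * (Var i ^ Suc k * Var l ^ (n - k)))"
    unfolding binary_form_def by (subst sum.atMost_Suc_shift) simp
  also have "\<dots> = Var i * binary_form i l n q"
    by (simp add: binary_form_def sum_distrib_left mult_ac)
  finally have 1: "binary_form i l (Suc n) (pCons 0 q) = Var i * binary_form i l n q" .
  have 2: "binary_form i l (Suc n) (smult (- a) q) = - const a * Var l * binary_form i l n q"
    unfolding binary_form_smult binary_form_shift[OF assms] by (simp add: single_uminus mult_ac)
  have "[:- a, 1:] * q = smult (- a) q + pCons 0 q" by simp
  then show ?thesis by (simp only: binary_form_add 1 2) (simp add: algebra_simps)
qed

lemma binary_formI:
  fixes f :: "'a::comm_ring_1 mpoly3"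
  assumes ijl: "UNIV = {i, j, l::3}" "i \<noteq> j" "i \<noteq> l" "j \<noteq> l"
    and f: "ihom (int n) f" "free_of {j} f"
  obtains q where "degree q \<le> n" "f = binary_form i l n q"
proof -
  have "\<exists>q. degree q \<le> n \<and> f = binary_form i l n q"
  proof (rule sum_mon_induct[where g = f and P = "\<lambda>h. \<exists>q. degree q \<le> n \<and> h = binary_form i l n q"])
    show "\<exists>q. degree q \<le> n \<and> 0 = binary_form i l n q"
      by (rule exI[of _ 0]) (simp add: binary_form_def)
  next
    fix m and h :: "'a mpoly3" assume mf: "m \<in> Poly_Mapping.keys f" and "\<exists>q. degree q \<le> n \<and> h = binary_form i l n q"
    then obtain q where q: "degree q \<le> n" "h = binary_form i l n q" by blast
    have "monom_deg m = n" "cexp m j = 0"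
      using mf f by (auto simp: ihom_def free_of_def)
    then have m: "cexp m i + cexp m l = n" "cexp m j = 0"
      using sum_triple[OF ijl, of "cexp m"] by (simp_all add: monom_deg_def)
    have "mon m c = const c * (Var i ^ cexp m i * Var l ^ cexp m l)" for c :: 'a
    proof -
      have "(\<Prod>k\<in>UNIV. Var k ^ cexp m k) = (\<Prod>k\<in>{i, j, l}. Var k ^ cexp m k :: 'a mpoly3)" by (simp only: ijl(1))
      then show ?thesis using ijl(2-4) m(2) by (simp add: mon_eq_prod[of m c])
    qed
    moreover have "binary_form i l n (monom e (cexp m i)) = const e * (Var i ^ cexp m i * Var l ^ (n - cexp m i))" for e :: 'a
    proof -
      have "binary_form i l n (monom e (cexp m i)) = (\<Sum>k\<le>n. if k = cexp m i then const e * (Var i ^ k * Var l ^ (n - k)) else 0)"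
        unfolding binary_form_def by (rule sum.cong) auto
      then show ?thesis using m(1) by simp
    qed
    moreover have "n - cexp m i = cexp m l" using m(1) by simp
    ultimately have "mon m (Poly_Mapping.lookup f m) = binary_form i l n (monom (Poly_Mapping.lookup f m) (cexp m i))"
      by simp
    then have "mon m (Poly_Mapping.lookup f m) + h = binary_form i l n (monom (Poly_Mapping.lookup f m) (cexp m i) + q)"
      using q(2) by (simp add: binary_form_add)
    moreover have "degree (monom (Poly_Mapping.lookup f m) (cexp m i) + q) \<le> n"
      using q(1) m(1) by (intro degree_add_le order_trans[OF degree_monom_le]) auto
    ultimately show "\<exists>q. degree q \<le> n \<and> mon m (Poly_Mapping.lookup f m) + h = binary_form i l n q" by blast
  qed
  then show ?thesis using that by blast
qed

lemma mideal_const_cancel: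
  fixes c :: "'a::field"
  assumes "mideal J" "c \<noteq> 0" "const c * f \<in> J"
  shows "f \<in> J"
proof -
  have "const (inverse c) * (const c * f) = f"
    using assms(2) by (simp add: mult_single flip: mult.assoc)
  then show ?thesis using mideal_mult[OF assms(1,3)] by metis
qed

definition plus_principal :: "'b::comm_ring_1 set \<Rightarrow> 'b \<Rightarrow> 'b set" where
  "plus_principal J v = {f + h * v | f h. f \<in> J}"

lemma plus_principal:
  assumes J: "mideal J"
  shows "mideal (plus_principal J v)" "J \<subseteq> plus_principal J v" "v \<in> plus_principal J v"
proof -
  show "J \<subseteq> plus_principal J v"
  proof
    fix f assume "f \<in> J"
    moreover have "f = f + 0 * v" by simp
    ultimately show "f \<in> plus_principal J v" unfolding plus_principal_def by blast
  qed
  have "v = 0 + 1 * v" by simp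
  then show "v \<in> plus_principal J v" unfolding plus_principal_def using mideal_zero[OF J] by blast
  show "mideal (plus_principal J v)"
    unfolding mideal_def
  proof (intro conjI ballI allI)
    show "0 \<in> plus_principal J v" using \<open>J \<subseteq> _\<close> mideal_zero[OF J] by blast
    fix x assume "x \<in> plus_principal J v"
    then obtain f h where x: "x = f + h * v" "f \<in> J" by (auto simp: plus_principal_def)
    {
      fix y assume "y \<in> plus_principal J v"
      then obtain f' h' where y: "y = f' + h' * v" "f' \<in> J" by (auto simp: plus_principal_def)
      have "x + y = (f + f') + (h + h') * v" by (simp add: x y algebra_simps)
      then show "x + y \<in> plus_principal J v" unfolding plus_principal_def using mideal_add[OF J x(2) y(2)] by blast
    }
    fix r
    have "r * x = r * f + (r * h) * v" by (simp add: x algebra_simps)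
    then show "r * x \<in> plus_principal J v" unfolding plus_principal_def using mideal_mult[OF J x(2)] by blast
  qed
qed

text \<open>Roots of \<open>q\<close> are split off one at a time. If adding the line of a root
  creates a power of \<open>Var l\<close>, then that power times the remaining factor lies in
  \<open>J\<close>, and the induction continues with one root fewer. Without roots left,
  \<open>J\<close> would contain a power of \<open>Var l\<close>.\<close>

lemma plus_line:
  fixes J :: "'a::alg_closed_field mpoly3 set"
  assumes J: "mideal J" "\<And>N. Var l ^ N \<notin> J"
    and q: "q \<noteq> 0" "degree q \<le> n" "binary_form i l n q \<in> J"
  shows "\<exists>a. \<forall>N. Var l ^ N \<notin> plus_principal J (Var i - const a * Var l)"
  using q
proof (induction "degree q" arbitrary: q n)
  case 0
  then obtain c where c: "q = [:c:]" "c \<noteq> 0" by (metis degree_eq_zeroE pCons_0_0)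
  have "binary_form i l n q = (\<Sum>k\<le>n. if k = 0 then const c * Var l ^ n else 0)"
    unfolding binary_form_def c by (rule sum.cong) (auto simp: coeff_pCons split: nat.splits)
  then have "const c * Var l ^ n \<in> J" using 0 by simp
  then have "Var l ^ n \<in> J" by (rule mideal_const_cancel[OF J(1) c(2)])
  then show ?case using J by blast
next
  case (Suc D)
  obtain a where a: "poly q a = 0" using alg_closed_imp_poly_has_root[of q] Suc.hyps(2) by auto
  then obtain q' where q': "q = [:- a, 1:] * q'" using poly_eq_0_iff_dvd by (metis dvdE)
  have "q' \<noteq> 0" using Suc.prems q' by auto
  then have deg: "degree q = Suc (degree q')" unfolding q' by (subst degree_mult_eq) auto
  obtain n' where n': "n = Suc n'" using deg Suc.prems(2) by (cases n) auto
  have dn: "degree q' \<le> n'" using deg Suc.prems(2) n' by simp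
  show ?case
  proof (cases "\<forall>N. Var l ^ N \<notin> plus_principal J (Var i - const a * Var l)")
    case False
    then obtain N f h where N: "Var l ^ N = f + h * (Var i - const a * Var l)" "f \<in> J"
      by (auto simp: plus_principal_def)
    have "binary_form i l (N + n') q' = Var l ^ N * binary_form i l n' q'" by (rule binary_form_shift_power[OF dn])
    also have "\<dots> = f * binary_form i l n' q' + h * binary_form i l n q"
      unfolding N(1) n' q' binary_form_root[OF dn] by (simp add: algebra_simps)
    also have "\<dots> \<in> J" using N(2) Suc.prems(3) J(1) by (intro mideal_add mideal_mult mideal_mult_right)
    finally show ?thesis using Suc.hyps deg \<open>q' \<noteq> 0\<close> dn by (intro Suc.hyps(1)[of q' "N + n'"]) auto
  qed blast
qed

section \<open>Smooth cones over an algebraically closed field of positive characteristic\<close>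

locale normal_form_char = pos_char p ty + normal_form g d
  for p :: nat and ty :: "'a::alg_closed_field itself" and g :: "'a mpoly3" and d :: int
begin

lemma mideal_jac: "mideal jac"
  unfolding mideal_def
proof (intro conjI ballI allI)
  have "0 = 0 * pd 0 g + 0 * pd 1 g + 0 * pd 2 g + 0 * g" by simp
  then show "0 \<in> jac" unfolding jac_def by blast
  fix x assume "x \<in> jac"
  then obtain a b c e where x: "x = a * pd 0 g + b * pd 1 g + c * pd 2 g + e * g" by (auto simp: jac_def)
  {
    fix y assume "y \<in> jac"
    then obtain a' b' c' e' where y: "y = a' * pd 0 g + b' * pd 1 g + c' * pd 2 g + e' * g" by (auto simp: jac_def)
    have "x + y = (a + a') * pd 0 g + (b + b') * pd 1 g + (c + c') * pd 2 g + (e + e') * g"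
      by (simp add: x y algebra_simps)
    then show "x + y \<in> jac" unfolding jac_def by blast
  }
  fix r
  have "r * x = (r * a) * pd 0 g + (r * b) * pd 1 g + (r * c) * pd 2 g + (r * e) * g"
    by (simp add: x algebra_simps)
  then show "r * x \<in> jac" unfolding jac_def by blast
qed

lemma g_in_jac: "g \<in> jac" and pd_in_jac: "pd i g \<in> jac"
proof -
  have "g = 0 * pd 0 g + 0 * pd 1 g + 0 * pd 2 g + 1 * g" by simp
  then show "g \<in> jac" unfolding jac_def by blast
  have "pd 0 g = 1 * pd 0 g + 0 * pd 1 g + 0 * pd 2 g + 0 * g"
    "pd 1 g = 0 * pd 0 g + 1 * pd 1 g + 0 * pd 2 g + 0 * g"
    "pd 2 g = 0 * pd 0 g + 0 * pd 1 g + 1 * pd 2 g + 0 * g" by simp_all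
  then have "pd 0 g \<in> jac" "pd 1 g \<in> jac" "pd 2 g \<in> jac" unfolding jac_def by blast+
  moreover have "i \<in> {0, 1, 2}" using UNIV_3 by auto
  ultimately show "pd i g \<in> jac" by auto
qed

lemma jac_least: 
  assumes "mideal J" "g \<in> J" "\<And>i. pd i g \<in> J"
  shows "jac \<subseteq> J"
proof
  fix s assume "s \<in> jac"
  then obtain a b c e where "s = a * pd 0 g + b * pd 1 g + c * pd 2 g + e * g" by (auto simp: jac_def)
  then show "s \<in> J" using assms by (simp add: mideal_add mideal_mult)
qed

text \<open>A multiple of \<open>g\<close> of degree \<open>d - 1\<close> is zero, so otherwise all
  partial derivatives vanish. Then all exponents are divisible by \<open>p\<close>, and over a
  perfect field \<open>g\<close> is a p-th power, which is not prime.\<close>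

lemma pd_not_dvd: obtains i where "\<not> g dvd pd i g"
proof (rule ccontr)
  assume "\<not> thesis"
  then have all: "g dvd pd i g" for i using that by blast
  have pd0: "pd i g = 0" for i
  proof -
    obtain h where h: "pd i g = g * h" using all[of i] by (elim dvdE)
    have "pd i g = hcomp (d - 1) (pd i g)" using hcomp_ihom[OF ihom_pd_g[of i], of "d - 1"] by simp
    also have "\<dots> = g * hcomp (- 1) h" unfolding h by (simp add: hcomp_g_mult)
    also have "hcomp (- 1) h = 0" using ihom_neg1 ihom_hcomp by blast
    finally show ?thesis by simp
  qed
  have pdvd: "p dvd cexp m i" if m: "m \<in> Poly_Mapping.keys g" for m i
  proof (cases "cexp m i = 0")
    case False
    then have e: "(m - Poly_Mapping.single i 1) + Poly_Mapping.single i 1 = m"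
      by (intro cexp_eqI) (auto simp: lookup_add lookup_minus lookup_single when_def)
    have "Suc (cexp (m - Poly_Mapping.single i 1) i) = cexp m i" using False by (simp add: lookup_minus)
    then have "of_nat (cexp m i) * Poly_Mapping.lookup g m = 0"
      using lookup_pd[of i g "m - Poly_Mapping.single i 1"] unfolding e pd0 by simp
    then have "of_nat (cexp m i) = (0::'a)" using m by (simp add: in_keys_iff)
    then show ?thesis using CHAR_eq of_nat_eq_0_iff_char_dvd by metis
  qed simp
  have "\<exists>h. g = h ^ p"
  proof (rule sum_mon_induct[where g = g and P = "\<lambda>f. \<exists>h. f = h ^ p"])
    show "\<exists>h :: 'a mpoly3. 0 = h ^ p" by (rule exI[of _ 0]) (simp add: zero_power[OF p_pos])
  next
    fix m and f :: "'a mpoly3" assume mg: "m \<in> Poly_Mapping.keys g" and "\<exists>h :: 'a mpoly3. f = h ^ p"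
    then obtain h where h: "f = h ^ p" by blast
    have "vec3 (\<lambda>i. p * (cexp m i div p)) = m"
      using pdvd[OF mg] by (intro cexp_eqI) simp
    then have "mon m (Poly_Mapping.lookup g m) = mon (vec3 (\<lambda>i. cexp m i div p)) (proot (Poly_Mapping.lookup g m)) ^ p"
      by (simp add: mon_power)
    then show "\<exists>h. mon m (Poly_Mapping.lookup g m) + f = h ^ p" using mfrob_add h by metis
  qed
  then obtain h where h: "g = h ^ p" by blast
  have dvd_root: "g dvd h" if "g dvd h ^ n" for n
    using that by (induction n) (use g_nonunit g_prime in auto)
  have "g dvd h" by (rule dvd_root[of p]) (simp flip: h)
  then obtain k where k: "h = g * k" by (elim dvdE)
  obtain q where q: "p = Suc (Suc q)" using p_ge_2 by (metis add_2_eq_Suc le_Suc_ex)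
  have "g * 1 = g * (g * (g ^ q * k ^ p))"
    using h unfolding k by (simp add: q power_mult_distrib mult_ac)
  then have "1 = g * (g ^ q * k ^ p)" using g_nonzero by (metis mult_left_cancel)
  then show False using g_nonunit by (metis dvd_triv_left)
qed

text \<open>Elimination against a partial derivative that \<open>g\<close> does not divide, followed
  by the choice of a nonzero component.\<close>

lemma homogeneous_elimination:
  obtains r n where "r \<noteq> 0" "r \<in> jac" "free_of {j} r" "ihom (int n) r"
proof -
  obtain i where i: "\<not> g dvd pd i g" by (rule pd_not_dvd)
  obtain r u v where r: "r \<noteq> 0" "free_of {j} r" "r = u * g + v * pd i g"
    using elimination[OF i] by blast
  obtain k where k: "hcomp k r \<noteq> 0" using hcomp_nonzero[OF r(1)] .
  then have "k \<ge> 0" using ihom_neg[OF ihom_hcomp, of k r] by linarith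
  have "hcomp k r = g * hcomp (k - d) u + pd i g * hcomp (k - (d - 1)) v"
    unfolding r(3) hcomp_add mult.commute[of _ g] mult.commute[of _ "pd i g"]
    by (simp only: hcomp_g_mult hcomp_mult[OF ihom_pd_g])
  then have "hcomp k r \<in> jac"
    using mideal_jac g_in_jac pd_in_jac by (simp add: mideal_add mideal_mult_right)
  moreover have "free_of {j} (hcomp k r)"
    using r(2) by (auto simp: free_of_def in_keys_iff lookup_hcomp split: if_splits)
  moreover have "ihom (int (nat k)) (hcomp k r)" using \<open>k \<ge> 0\<close> by simp
  ultimately show ?thesis using that k by blast
qed

text \<open>Otherwise, elimination gives binary forms in \<open>jac\<close>, and
  \<open>plus_line\<close> provides two lines that can be added to \<open>jac\<close> without
  creating a power of \<open>Var l\<close>. All forms in \<open>jac\<close> vanish where these lines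
  meet, against \<open>nonsingular\<close>.\<close>

lemma Var_power_in_jac: "\<exists>N. Var l ^ N \<in> jac"
proof (rule ccontr)
  assume "\<not> ?thesis"
  then have l: "Var l ^ N \<notin> jac" for N by blast
  obtain i j where ijl: "UNIV = {i, j, l}" "i \<noteq> j" "i \<noteq> l" "j \<noteq> l" using distinct_triple_3 .
  have jil: "UNIV = {j, i, l}" "j \<noteq> i" "j \<noteq> l" "i \<noteq> l" using ijl by auto
  obtain r n where r: "r \<noteq> 0" "r \<in> jac" "free_of {j} r" "ihom (int n) r" by (rule homogeneous_elimination)
  obtain q where q: "degree q \<le> n" "r = binary_form i l n q" using binary_formI[OF ijl r(4,3)] .
  have "q \<noteq> 0" using r(1) q(2) by (auto simp: binary_form_def)
  then obtain a where a: "\<And>N. Var l ^ N \<notin> plus_principal jac (Var i - const a * Var l)"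
    using plus_line[OF mideal_jac l _ q(1)] r(2) q(2) by metis
  let ?J1 = "plus_principal jac (Var i - const a * Var l)"
  note J1 = plus_principal[OF mideal_jac, of "Var i - const a * Var l"]
  obtain r' n' where r': "r' \<noteq> 0" "r' \<in> jac" "free_of {i} r'" "ihom (int n') r'" by (rule homogeneous_elimination)
  obtain q' where q': "degree q' \<le> n'" "r' = binary_form j l n' q'" using binary_formI[OF jil r'(4,3)] .
  have "q' \<noteq> 0" using r'(1) q'(2) by (auto simp: binary_form_def)
  moreover have "binary_form j l n' q' \<in> ?J1" using r'(2) q'(2) J1(2) by auto
  ultimately obtain b where b: "\<And>N. Var l ^ N \<notin> plus_principal ?J1 (Var j - const b * Var l)"
    using plus_line[OF J1(1) a _ q'(1)] by metis
  let ?J2 = "plus_principal ?J1 (Var j - const b * Var l)"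
  note J2 = plus_principal[OF J1(1), of "Var j - const b * Var l"]
  define P where "P k = (if k = i then a else if k = j then b else 1)" for k
  have P: "P l = 1" "P i = a" "P j = b" using ijl by (auto simp: P_def)
  have lines: "line_form P l i \<in> ?J2" "line_form P l j \<in> ?J2"
    using J1(3) J2(2,3) P by (auto simp: line_form_def)
  \<comment> \<open>Modulo \<open>?J2\<close> a form is its value at the point times a power of
    \<open>Var l\<close>, and \<open>?J2\<close> contains no such power.\<close>
  have vanish: "ev P f = 0" if f: "ihom k f" "f \<in> jac" "k \<ge> 0" for f k
  proof (rule ccontr)
    assume ne: "ev P f \<noteq> 0"
    have "f \<in> ?J2" using f(2) J1(2) J2(2) by blast
    moreover have "f - const (ev P f) * Var l ^ nat k \<in> ?J2"
      using homogeneous_mod_lines[where P = P and i = i and j = j and l = l, OF ijl P(1) J2(1) lines, of "nat k" f] f by simp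
    ultimately have "f - (f - const (ev P f) * Var l ^ nat k) \<in> ?J2" by (rule mideal_diff[OF J2(1)])
    then have "const (ev P f) * Var l ^ nat k \<in> ?J2" by simp
    then have "Var l ^ nat k \<in> ?J2" by (rule mideal_const_cancel[OF J2(1) ne])
    then show False using b by blast
  qed
  show False
    by (rule nonsingular[of P l]) (use P(1) vanish[OF ihom_g g_in_jac] vanish[OF ihom_pd_g pd_in_jac] d_pos in auto)
qed

text \<open>By the pigeonhole principle a monomial of degree \<open>N 0 + N 1 + N 2\<close> is
  divisible by some \<open>Var l ^ N l\<close>.\<close>

lemma jac_irrelevant: "\<exists>M. \<forall>m\<in>mons (int M). mon m 1 \<in> jac"
proof -
  obtain N where N: "\<And>l. Var l ^ N l \<in> jac" using Var_power_in_jac by metis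
  have "mon m 1 \<in> jac" if m: "m \<in> mons (int (N 0 + N 1 + N 2))" for m
  proof -
    have "\<exists>l. N l \<le> cexp m l"
    proof (rule ccontr)
      assume "\<nexists>l. N l \<le> cexp m l"
      then have "cexp m l < N l" for l by (meson not_le)
      from this[of 0] this[of 1] this[of 2] show False using m by (simp add: mons_def monom_deg_3)
    qed
    then obtain l where l: "N l \<le> cexp m l" by blast
    have "Var l ^ n = mon (Poly_Mapping.single l n) (1::'a)" for n
      by (induction n) (auto simp: Var_def mult_single simp flip: single_add)
    moreover have "Poly_Mapping.single l (N l) + (m - Poly_Mapping.single l (N l)) = m"
      using l by (intro cexp_eqI) (auto simp: lookup_add lookup_minus lookup_single when_def)
    ultimately have "mon m 1 = Var l ^ N l * mon (m - Poly_Mapping.single l (N l)) (1::'a)"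
      by (simp add: mult_single)
    then show ?thesis using mideal_mult_right[OF mideal_jac N] by metis
  qed
  then show ?thesis by blast
qed

lemma jac_degree_bound:
  assumes "k \<ge> 3 * d - 5" "k \<ge> 2 * d - 2" "ihom k s"
  shows "\<exists>a e. (\<forall>i. ihom (k - d + 1) (a i)) \<and> ihom (k - d) e \<and> s = (\<Sum>i\<in>UNIV. a i * pd i g) + e * g"
proof -
  obtain M where M: "\<And>m. m \<in> mons (int M) \<Longrightarrow> mon m 1 \<in> jac" using jac_irrelevant by blast
  obtain i where i: "\<not> g dvd pd i g" by (rule pd_not_dvd)
  obtain a b c e where *: "ihom (k - d + 1) a" "ihom (k - d + 1) b" "ihom (k - d + 1) c" "ihom (k - d) e"
     "s = a * pd 0 g + b * pd 1 g + c * pd 2 g + e * g"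
    using jacobian_degree_bound[OF M i assms] by blast
  show ?thesis
    by (rule exI[of _ "\<lambda>i. if i = 0 then a else if i = 1 then b else c"], rule exI[of _ e])
       (use * neq_3 in \<open>auto simp: sum_UNIV_3\<close>)
qed

text \<open>Modulo derivatives, which the Cartier operator kills, \<open>g\<^sup>j pd i g\<close> can be traded for a multiple of
  \<open>g\<^sup>j\<^sup>+\<^sup>1\<close>. The degree is large enough for this exactly because \<open>p > d - 3\<close>.\<close>

lemma cartier_power_surj:
  assumes w: "ihom k w" and n: "k + 3 - d \<ge> 1" and p: "int p > d - 3" and j: "j \<le> p - 1"
  shows "\<exists>s. ihom (int p * k + 3 * (int p - 1) - int j * d) s \<and> cartier (g ^ j * s) = w"
  using j
proof (induction j)
  case 0
  have "ihom (int p * k + 3 * (int p - 1)) (w ^ p * allX)"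
    by (intro ihom_mult ihom_power w ihom_allX)
  then show ?case using cartier_surj[of w] by (intro exI[of _ "w ^ p * allX"]) simp
next
  case (Suc j)
  let ?K = "int p * k + 3 * (int p - 1) - int j * d"
  obtain s where s: "ihom ?K s" "cartier (g ^ j * s) = w" using Suc by auto
  \<comment> \<open>From \<open>j \<le> p - 2\<close> and \<open>k + 3 - d \<ge> 1\<close> follows
    \<open>?K \<ge> p + 2 * d - 3\<close>. Then \<open>p \<ge> d - 2\<close> gives the first bound
    of \<open>jac_degree_bound\<close>, and \<open>p \<ge> 1\<close> the second.\<close>
  have "int j \<le> int p - 2" using Suc.prems by linarith
  then have "int j * d \<le> (int p - 2) * d" using d_pos by (intro mult_right_mono) auto
  moreover have "int p * 1 \<le> int p * (k + 3 - d)" using n by (intro mult_left_mono) auto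
  ultimately have "?K \<ge> int p + 2 * d - 3" by (simp add: algebra_simps)
  then have "?K \<ge> 3 * d - 5" "?K \<ge> 2 * d - 2" using p p_pos by linarith+
  from jac_degree_bound[OF this s(1)]
  obtain a e where "\<forall>i. ihom (?K - d + 1) (a i)" and e: "ihom (?K - d) e" "s = (\<Sum>i\<in>UNIV. a i * pd i g) + e * g"
    by blast
  then have a: "ihom (?K - d + 1) (a i)" for i by blast
  have "of_nat (Suc j) \<noteq> (0::'a)"
    using Suc.prems CHAR_eq of_nat_eq_0_iff_char_dvd[of "Suc j", where ?'a = 'a] nat_dvd_not_less[of "Suc j" p] by auto
  \<comment> \<open>The inverse of \<open>j + 1\<close>, which is nonzero in the field because
    \<open>j + 1 < p\<close>. It makes \<open>g ^ j * pd i g\<close> the derivative of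
    \<open>q * g ^ Suc j\<close>.\<close>
  define q :: "'a mpoly3" where "q = const (inverse (of_nat (Suc j)))"
  have q: "q * of_nat (Suc j) = 1"
  proof -
    have "q * of_nat (Suc j) = const (inverse (of_nat (Suc j)) * of_nat (Suc j))"
      unfolding q_def by (metis mult_single add_0 single_of_nat)
    then show ?thesis using \<open>of_nat (Suc j) \<noteq> 0\<close> by simp
  qed
  have pdq: "pd i q = 0" for i by (simp add: q_def)
  have pdg: "q * pd i (g ^ Suc j) = g ^ j * pd i g" for i
  proof -
    have "q * pd i (g ^ Suc j) = (q * of_nat (Suc j)) * (g ^ j * pd i g)"
      unfolding pd_power diff_Suc_1 by (simp only: mult_ac)
    then show ?thesis unfolding q by simp
  qed
  \<comment> \<open>Integration by parts moves the derivative from \<open>g ^ Suc j\<close> to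
    \<open>a i\<close>; this is the resulting cofactor of \<open>g ^ Suc j\<close>.\<close>
  define s' where "s' = e - q * (\<Sum>i\<in>UNIV. pd i (a i))"
  have tr: "g ^ j * (a i * pd i g) = pd i (q * a i * g ^ Suc j) - g ^ Suc j * (q * pd i (a i))" for i
  proof -
    have "pd i (q * a i * g ^ Suc j) = q * pd i (a i) * g ^ Suc j + a i * (q * pd i (g ^ Suc j))"
      by (simp only: pd_mult pdq) (simp add: algebra_simps)
    then show ?thesis unfolding pdg by (simp add: algebra_simps)
  qed
  have "g ^ j * s = (\<Sum>i\<in>UNIV. g ^ j * (a i * pd i g)) + g ^ j * (e * g)"
    unfolding e(2) by (simp add: distrib_left sum_distrib_left)
  also have "\<dots> = (\<Sum>i\<in>UNIV. pd i (q * a i * g ^ Suc j)) + g ^ Suc j * s'"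
    unfolding tr s'_def by (simp add: sum_subtractf sum_distrib_left right_diff_distrib mult_ac)
  finally have "cartier (g ^ Suc j * s') = w"
    using s(2) by (simp add: cartier_add cartier_pd)
  moreover have "ihom (int p * k + 3 * (int p - 1) - int (Suc j) * d) s'"
  proof -
    have "ihom (?K - d) (pd i (a i))" for i using ihom_pd[OF a[of i], of i] by (simp only: add_diff_cancel_right')
    then have "ihom (?K - d) (q * (\<Sum>i\<in>UNIV. pd i (a i)))"
      unfolding q_def by (intro ihom_mult'[OF ihom_const] ihom_sum) auto
    moreover have "int p * k + 3 * (int p - 1) - int (Suc j) * d = ?K - d" by (simp add: algebra_simps)
    ultimately show ?thesis unfolding s'_def using e(1) ihom_diff by metis
  qed
  ultimately show ?case by blast
qed

lemma stable_ideal_contains: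
  assumes J: "mideal J" "g \<in> J" "c \<in> J" "\<not> g dvd c"
    and stable: "\<And>s. s \<in> J \<Longrightarrow> cartier (g ^ (p - 1) * s) \<in> J"
    and p: "int p > d - 3" and w: "ihom k w" "k \<ge> d - 2"
  shows "w \<in> J"
proof -
  have "pd l g \<in> J" for l
  proof -
    obtain r u v where r: "r \<noteq> 0" "free_of {l} r" "r = u * g + v * c"
      using elimination[OF J(4)] by blast
    then have "r \<in> J" using J by (simp add: mideal_add mideal_mult)
    then show ?thesis using cartier_stable_pd[OF J(1) stable _ r(1,2)] by blast
  qed
  then have jac: "jac \<subseteq> J" using jac_least J by blast
  \<comment> \<open>From this degree on, \<open>jac_degree_bound\<close> puts all forms into
    \<open>jac\<close>.\<close>
  define B where "B = max (3 * d - 5) (2 * d - 2)"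
  have big: "s \<in> J" if s: "ihom k s" "k \<ge> B" for k s
  proof -
    obtain a e where "s = (\<Sum>i\<in>UNIV. a i * pd i g) + e * g"
      using jac_degree_bound[of k s] s unfolding B_def by auto
    then show "s \<in> J" using jac g_in_jac pd_in_jac
      by (auto intro!: mideal_add[OF J(1)] mideal_sum[OF J(1)] mideal_mult[OF J(1)])
  qed
  show ?thesis using w
  proof (induction "nat (B - k)" arbitrary: k w rule: less_induct)
    case less
    show ?case
    proof (cases "k \<ge> B")
      case False
      \<comment> \<open>The degree of the preimage \<open>s\<close>. It exceeds \<open>k\<close>
        because \<open>p \<ge> 2\<close> and \<open>k + 3 - d \<ge> 1\<close>, so the distance to
        \<open>B\<close> decreases.\<close>
      let ?k = "k + (int p - 1) * (k + 3 - d)"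
      obtain s where s: "ihom (int p * k + 3 * (int p - 1) - int (p - 1) * d) s" "cartier (g ^ (p - 1) * s) = w"
        using cartier_power_surj[OF less.prems(1) _ p, of "p - 1"] less.prems(2) by auto
      have "int p * k + 3 * (int p - 1) - int (p - 1) * d = ?k"
        using p_pos by (simp add: of_nat_diff algebra_simps)
      then have "ihom ?k s" using s(1) by simp
      moreover have "1 * 1 \<le> (int p - 1) * (k + 3 - d)"
        using p_ge_2 less.prems(2) by (intro mult_mono) auto
      ultimately have "s \<in> J" using False less.prems(2) by (intro less.hyps[of ?k s]) auto
      then show ?thesis using stable s(2) by blast
    qed (use big less.prems in blast)
  qed
qed

end

section \<open>Passing to the quotient ring\<close>

lemma mpoly3_ring_simps [simp]:
  "carrier mpoly3_ring = UNIV" "a \<otimes>\<^bsub>mpoly3_ring\<^esub> b = a * b" "\<one>\<^bsub>mpoly3_ring\<^esub> = 1"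
  "\<zero>\<^bsub>mpoly3_ring\<^esub> = 0" "a \<oplus>\<^bsub>mpoly3_ring\<^esub> b = a + b"
  by (auto simp: mpoly3_ring_def ring_of_type_algebra_def)

lemma cring_mpoly3: "cring (mpoly3_ring :: 'a::comm_ring_1 mpoly3 ring)"
  unfolding mpoly3_ring_def by (rule cring_from_type_algebra)

lemma a_inv_mpoly3: "\<ominus>\<^bsub>mpoly3_ring\<^esub> a = - (a :: 'a::comm_ring_1 mpoly3)"
proof -
  interpret cring "mpoly3_ring :: 'a mpoly3 ring" by (rule cring_mpoly3)
  show ?thesis using minus_equality[of "- a" a] by simp
qed

lemma ideal_zero_mem: "ideal Q R \<Longrightarrow> \<zero>\<^bsub>R\<^esub> \<in> Q"
  and ideal_add_mem: "ideal Q R \<Longrightarrow> a \<in> Q \<Longrightarrow> b \<in> Q \<Longrightarrow> a \<oplus>\<^bsub>R\<^esub> b \<in> Q"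
  by (auto intro: additive_subgroup.zero_closed additive_subgroup.a_closed ideal.axioms(1))

lemma ideal_mpoly3_iff: "ideal J mpoly3_ring \<longleftrightarrow> mideal (J :: 'a::comm_ring_1 mpoly3 set)"
proof
  assume J: "ideal J mpoly3_ring"
  interpret ideal J "mpoly3_ring :: 'a mpoly3 ring" by (rule J)
  show "mideal J" unfolding mideal_def
    using ideal_zero_mem[OF J] ideal_add_mem[OF J] I_l_closed by auto
next
  assume J: "mideal J"
  interpret cring "mpoly3_ring :: 'a mpoly3 ring" by (rule cring_mpoly3)
  show "ideal J mpoly3_ring"
  proof (rule idealI)
    show "ring (mpoly3_ring :: 'a mpoly3 ring)" by (rule ring_axioms)
    have "- a \<in> J" if "a \<in> J" for a using mideal_mult[OF J that, of "- 1"] by simp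
    then show "subgroup J (add_monoid mpoly3_ring)"
      by (intro add.subgroupI) (use J in \<open>auto simp: mideal_add a_inv_mpoly3 intro: mideal_zero\<close>)
  qed (use J in \<open>auto intro: mideal_mult mideal_mult_right\<close>)
qed

definition coset :: "'a::comm_ring_1 mpoly3 \<Rightarrow> 'a mpoly3 \<Rightarrow> 'a mpoly3 set" where
  "coset g h = PIdl\<^bsub>mpoly3_ring\<^esub> g +>\<^bsub>mpoly3_ring\<^esub> h"

lemma cgenideal_mpoly3: "PIdl\<^bsub>mpoly3_ring\<^esub> g = {h. g dvd h}"
  by (auto simp: cgenideal_def dvd_def mult.commute)

lemma ideal_cgenideal_mpoly3: "ideal (PIdl\<^bsub>mpoly3_ring\<^esub> g) (mpoly3_ring :: 'a::comm_ring_1 mpoly3 ring)"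
  by (rule cring.cgenideal_ideal[OF cring_mpoly3]) simp

lemma coset_hom: "ring_hom_ring mpoly3_ring (hypersurface_ring g) (coset g)"
proof -
  have "coset g = (+>\<^bsub>mpoly3_ring\<^esub>) (PIdl\<^bsub>mpoly3_ring\<^esub> g)" by (rule ext) (simp add: coset_def)
  then show ?thesis
    unfolding hypersurface_ring_def using ideal.rcos_ring_hom_ring[OF ideal_cgenideal_mpoly3] by metis
qed

lemma carrier_hypersurface: "carrier (hypersurface_ring g) = range (coset g)"
  by (auto simp: hypersurface_ring_def FactRing_def A_RCOSETS_def' coset_def)

lemma coset_eq: "coset g a = coset g b \<longleftrightarrow> g dvd a - b"
proof
  have mem: "x \<in> coset g y \<longleftrightarrow> g dvd x - y" for x y
  proof -
    have "x \<in> coset g y \<longleftrightarrow> (\<exists>h. g dvd h \<and> x = h + y)"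
      by (auto simp: coset_def a_r_coset_def' cgenideal_mpoly3)
    also have "\<dots> \<longleftrightarrow> g dvd x - y" by (metis add_diff_cancel_right' diff_add_cancel)
    finally show ?thesis .
  qed
  {
    assume "coset g a = coset g b"
    moreover have "a \<in> coset g a" by (simp add: mem)
    ultimately show "g dvd a - b" by (simp add: mem)
  }
  assume ab: "g dvd a - b"
  show "coset g a = coset g b"
  proof (rule Set.set_eqI)
    fix x
    have "x - b = (x - a) + (a - b)" by simp
    then show "x \<in> coset g a \<longleftrightarrow> x \<in> coset g b"
      unfolding mem using ab by (metis dvd_add_left_iff)
  qed
qed

lemma coset_simps:
  "coset g a \<otimes>\<^bsub>hypersurface_ring g\<^esub> coset g b = coset g (a * b)"
  "coset g a \<oplus>\<^bsub>hypersurface_ring g\<^esub> coset g b = coset g (a + b)"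
  "\<zero>\<^bsub>hypersurface_ring g\<^esub> = coset g 0" "\<one>\<^bsub>hypersurface_ring g\<^esub> = coset g 1"
  "coset g a [^]\<^bsub>hypersurface_ring g\<^esub> (n::nat) = coset g (a ^ n)"
proof -
  interpret ring_hom_ring mpoly3_ring "hypersurface_ring g" "coset g" by (rule coset_hom)
  show mult: "coset g a \<otimes>\<^bsub>hypersurface_ring g\<^esub> coset g b = coset g (a * b)" for a b
    using hom_mult[of a b] by simp
  show "coset g a \<oplus>\<^bsub>hypersurface_ring g\<^esub> coset g b = coset g (a + b)"
    using hom_add[of a b] by simp
  show "\<zero>\<^bsub>hypersurface_ring g\<^esub> = coset g 0" using hom_zero by simp
  show one: "\<one>\<^bsub>hypersurface_ring g\<^esub> = coset g 1" using hom_one by simp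
  show "coset g a [^]\<^bsub>hypersurface_ring g\<^esub> (n::nat) = coset g (a ^ n)"
    by (induction n) (simp_all add: S.nat_pow_0 S.nat_pow_Suc one mult mult.commute)
qed

lemma coset_carrier [simp]: "coset g a \<in> carrier (hypersurface_ring g)"
  by (simp add: carrier_hypersurface)

lemma ideal_coset_image: "mideal D \<Longrightarrow> ideal (coset g ` D) (hypersurface_ring g)"
proof -
  assume "mideal D"
  then have "ideal D mpoly3_ring" by (simp add: ideal_mpoly3_iff)
  then have "ideal ((+>\<^bsub>mpoly3_ring\<^esub>) (PIdl\<^bsub>mpoly3_ring\<^esub> g) ` D) (hypersurface_ring g)"
    unfolding hypersurface_ring_def
    by (rule ring.ring_ideal_imp_quot_ideal[OF cring.axioms(1)[OF cring_mpoly3] ideal_cgenideal_mpoly3])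
  then show ?thesis by (simp add: coset_def[abs_def])
qed

text \<open>This is the preimage of the colon ideal of \<open>Q\<close> by the class of
  \<open>t\<close>.\<close>

lemma mideal_coset_vimage:
  assumes "ideal Q (hypersurface_ring g)"
  shows "mideal {s. coset g (s * t) \<in> Q}"
proof -
  interpret ideal Q "hypersurface_ring g" by (rule assms)
  show ?thesis unfolding mideal_def
  proof (intro conjI ballI allI)
    show "0 \<in> {s. coset g (s * t) \<in> Q}" using ideal_zero_mem[OF assms] by (simp add: coset_simps)
    fix a assume a: "a \<in> {s. coset g (s * t) \<in> Q}"
    {
      fix b assume "b \<in> {s. coset g (s * t) \<in> Q}"
      then show "a + b \<in> {s. coset g (s * t) \<in> Q}"
        using a ideal_add_mem[OF assms, of "coset g (a * t)" "coset g (b * t)"] by (simp add: coset_simps distrib_right)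
    }
    fix r show "r * a \<in> {s. coset g (s * t) \<in> Q}"
      using a I_l_closed[of "coset g (a * t)" "coset g r"] by (simp add: coset_simps mult.assoc)
  qed
qed

text \<open>The fraction \<open>s / y\<close> is a root of the monic polynomial with coefficients
  \<open>1\<close>, \<open>b\<close>, \<open>c\<close>, so normality puts it into the ring.\<close>

lemma (in domain) normal_quadratic:
  assumes normal: "normal_domain R"
    and c: "s \<in> carrier R" "y \<in> carrier R" "b \<in> carrier R" "c \<in> carrier R" and y: "y \<noteq> \<zero>"
    and eq: "s \<otimes> s \<oplus> b \<otimes> (s \<otimes> y) \<oplus> c \<otimes> (y \<otimes> y) = \<zero>"
  shows "\<exists>w\<in>carrier R. s = w \<otimes> y"
proof -
  let ?K = "frac_field R"
  interpret K: Ring.field ?K by (rule field_frac_field)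
  define x where "x = mk_frac R s y"
  have nz: "u \<otimes> v \<noteq> \<zero>" if "u \<in> carrier R" "u \<noteq> \<zero>" "v \<in> carrier R" "v \<noteq> \<zero>" for u v
    using that by (auto simp: integral_iff)
  have x: "x \<in> carrier ?K" using c y by (auto simp: x_def carrier_frac_field)
  have emb: "frac_embed R u \<in> carrier ?K" if "u \<in> carrier R" for u
    using that one_not_zero one_closed unfolding frac_embed_def carrier_frac_field by blast
  have one: "\<one>\<^bsub>?K\<^esub> = frac_embed R \<one>" by (simp add: frac_one frac_embed_def)
  let ?f = "[\<one>\<^bsub>?K\<^esub>, frac_embed R b, frac_embed R c]"
  have poly: "polynomial\<^bsub>?K\<^esub> (frac_embed R ` carrier R) ?f"
    using c one by (auto simp: polynomial_def)
  have "ring.eval ?K ?f x = x \<otimes>\<^bsub>?K\<^esub> x \<oplus>\<^bsub>?K\<^esub> (frac_embed R b \<otimes>\<^bsub>?K\<^esub> x \<oplus>\<^bsub>?K\<^esub> frac_embed R c)"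
    using x emb c by (simp add: numeral_2_eq_2)
  also have "\<dots> = \<zero>\<^bsub>?K\<^esub>"
  proof -
    \<comment> \<open>The numerator of the evaluation over a common denominator is \<open>y\<close>
      times the given relation.\<close>
    have "(s \<otimes> s) \<otimes> (y \<otimes> \<one>) \<oplus> ((b \<otimes> s) \<otimes> \<one> \<oplus> c \<otimes> y) \<otimes> (y \<otimes> y) = y \<otimes> (s \<otimes> s \<oplus> b \<otimes> (s \<otimes> y) \<oplus> c \<otimes> (y \<otimes> y))"
      using c by algebra
    also have "\<dots> = \<zero>" using eq c by simp
    finally have *: "(s \<otimes> s) \<otimes> (y \<otimes> \<one>) \<oplus> ((b \<otimes> s) \<otimes> \<one> \<oplus> c \<otimes> y) \<otimes> (y \<otimes> y) = \<zero>" .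
    show ?thesis
      unfolding x_def frac_embed_def using c y nz *
      by (simp add: mk_frac_mult mk_frac_add frac_zero mk_frac_eq_iff)
  qed
  finally have "integral_over ?K (frac_embed R ` carrier R) x"
    unfolding integral_over_def using poly by (intro exI[of _ ?f]) simp
  then have "x \<in> frac_embed R ` carrier R" using normal x by (auto simp: normal_domain_def)
  then obtain w where w: "w \<in> carrier R" "x = mk_frac R w \<one>" by (auto simp: frac_embed_def)
  then have "s = w \<otimes> y" using c y by (simp add: x_def mk_frac_eq_iff)
  then show ?thesis using w(1) by blast
qed

lemma normal_form_hypersurface:
  fixes g :: "'a::field mpoly3"
  assumes normal: "normal_domain (hypersurface_ring g)" and g: "ihom d g" "g \<noteq> 0"
  shows "normal_form g d"
proof -
  let ?R = "hypersurface_ring g"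
  interpret R: domain ?R using normal by (simp add: normal_domain_def)
  have zero: "coset g h = \<zero>\<^bsub>?R\<^esub> \<longleftrightarrow> g dvd h" for h by (simp add: coset_simps coset_eq)
  show ?thesis
  proof unfold_locales
    show "ihom d g" "g \<noteq> 0" by (rule g)+
  next
    fix a b assume "g dvd a * b"
    then have "coset g a \<otimes>\<^bsub>?R\<^esub> coset g b = \<zero>\<^bsub>?R\<^esub>" by (simp add: coset_simps(1) zero)
    then have "coset g a = \<zero>\<^bsub>?R\<^esub> \<or> coset g b = \<zero>\<^bsub>?R\<^esub>" by (rule R.integral) simp_all
    then show "g dvd a \<or> g dvd b" by (simp add: zero)
  next
    show "\<not> g dvd 1" using R.one_not_zero zero[of 1] by (simp add: coset_simps(4))
  next
    fix s y b c assume y: "\<not> g dvd y" and eq: "g dvd s ^ 2 - b * s * y + c * y ^ 2"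
    have "s ^ 2 - b * s * y + c * y ^ 2 = s * s + (- b) * (s * y) + c * (y * y)"
      by (simp add: algebra_simps power2_eq_square)
    then have "coset g s \<otimes>\<^bsub>?R\<^esub> coset g s \<oplus>\<^bsub>?R\<^esub> coset g (- b) \<otimes>\<^bsub>?R\<^esub> (coset g s \<otimes>\<^bsub>?R\<^esub> coset g y)
      \<oplus>\<^bsub>?R\<^esub> coset g c \<otimes>\<^bsub>?R\<^esub> (coset g y \<otimes>\<^bsub>?R\<^esub> coset g y) = \<zero>\<^bsub>?R\<^esub>"
      using eq unfolding coset_simps(1,2) zero by metis
    moreover have "coset g y \<noteq> \<zero>\<^bsub>?R\<^esub>" using y zero by simp
    ultimately obtain w where "w \<in> carrier ?R" "coset g s = w \<otimes>\<^bsub>?R\<^esub> coset g y"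
      using R.normal_quadratic[OF normal, of "coset g s" "coset g y" "coset g (- b)" "coset g c"] by auto
    then show "\<exists>w. g dvd s - w * y"
      by (auto simp: carrier_hypersurface coset_simps coset_eq)
  qed
qed

text \<open>The ideal \<open>J\<close> of the overview, for a representative \<open>f\<close>. The
  class of \<open>f\<close> is in the tight closure of \<open>I\<close> when this set contains an
  element that \<open>g\<close> does not divide.\<close>

definition multipliers :: "'a::comm_ring_1 mpoly3 \<Rightarrow> nat \<Rightarrow> 'a mpoly3 set set \<Rightarrow> 'a mpoly3 \<Rightarrow> 'a mpoly3 set" where
  "multipliers g p I f = {s. \<forall>e::nat. coset g (s * f ^ (p ^ e)) \<in> frobenius_power (hypersurface_ring g) I (p ^ e)}"

lemma ideal_frobenius_power:
  assumes "ideal I (hypersurface_ring g)"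
  shows "ideal (frobenius_power (hypersurface_ring g) I q) (hypersurface_ring g)"
proof -
  interpret I: ideal I "hypersurface_ring g" by (rule assms)
  show ?thesis unfolding frobenius_power_def
    by (rule I.genideal_ideal) (auto intro: I.Icarr)
qed

lemma mideal_multipliers:
  assumes "ideal I (hypersurface_ring g)"
  shows "mideal (multipliers g p I f)" "g \<in> multipliers g p I f"
proof -
  have "multipliers g p I f = (\<Inter>e. {s. coset g (s * f ^ (p ^ e)) \<in> frobenius_power (hypersurface_ring g) I (p ^ e)})"
    by (auto simp: multipliers_def)
  moreover have "mideal {s. coset g (s * f ^ (p ^ e)) \<in> frobenius_power (hypersurface_ring g) I (p ^ e)}" for e
    by (rule mideal_coset_vimage[OF ideal_frobenius_power[OF assms]])
  ultimately show "mideal (multipliers g p I f)" by (auto simp: mideal_def)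
  have "coset g (g * h) = \<zero>\<^bsub>hypersurface_ring g\<^esub>" for h by (simp add: coset_simps coset_eq)
  then show "g \<in> multipliers g p I f"
    using ideal_zero_mem[OF ideal_frobenius_power[OF assms]]
    by (simp add: multipliers_def)
qed

context pos_char begin

text \<open>The map sending \<open>s\<close> to \<open>cartier (G * s)\<close> releases p-th powers
  and so carries the Frobenius power for \<open>p ^ Suc e\<close> into that for
  \<open>p ^ e\<close>. The assumption on \<open>G\<close> lets it descend to the quotient; it holds
  for \<open>G = g ^ (p - 1)\<close> and, when \<open>g = 0\<close>, for
  \<open>G = 1\<close>.\<close>

lemma multipliers_stable:
  assumes I: "ideal I (hypersurface_ring g)"
    and G: "\<And>h. g dvd cartier (G * (g * h))"
    and s: "s \<in> multipliers g p I f"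
  shows "cartier (G * s) \<in> multipliers g p I f"
proof -
  let ?R = "hypersurface_ring g" and ?FP = "\<lambda>e. frobenius_power (hypersurface_ring g) I (p ^ e)"
  interpret I: ideal I ?R by (rule I)
  have frob_step: "u ^ p ^ Suc e = (u ^ p ^ e) ^ p" for u :: "'a mpoly3" and e
    by (simp only: power_Suc2 power_mult)
  have cong: "coset g (cartier (G * t)) = coset g (cartier (G * t'))" if tt': "coset g t = coset g t'" for t t'
  proof -
    obtain h where "t - t' = g * h" using tt' unfolding coset_eq by (elim dvdE)
    then have "cartier (G * t) - cartier (G * t') = cartier (G * (g * h))"
      by (metis cartier_additive(3) right_diff_distrib)
    then show ?thesis unfolding coset_eq using G by simp
  qed
  have step: "coset g (cartier (G * t)) \<in> ?FP e" if t: "coset g t \<in> ?FP (Suc e)" for t e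
  proof -
    \<comment> \<open>Quantifying over all multiples makes this an ideal although
      \<open>cartier\<close> is not linear over the polynomial ring. It then suffices to test the
      generators of the Frobenius power.\<close>
    define D where "D = {t. \<forall>h. coset g (cartier (G * (t * h))) \<in> ?FP e}"
    have FP: "ideal (?FP e) ?R" by (rule ideal_frobenius_power[OF I])
    interpret FP: ideal "?FP e" ?R by (rule FP)
    have D: "mideal D"
      unfolding mideal_def
    proof (intro conjI ballI allI)
      show "0 \<in> D" using ideal_zero_mem[OF FP] by (simp add: D_def coset_simps)
      fix a assume a: "a \<in> D"
      {
        fix b assume b: "b \<in> D"
        show "a + b \<in> D" unfolding D_def
        proof (intro CollectI allI)
          fix h
          have "coset g (cartier (G * (a * h))) \<oplus>\<^bsub>?R\<^esub> coset g (cartier (G * (b * h))) \<in> ?FP e"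
            using a b by (intro ideal_add_mem[OF FP]) (auto simp: D_def)
          then show "coset g (cartier (G * ((a + b) * h))) \<in> ?FP e"
            by (simp add: coset_simps distrib_left distrib_right cartier_add)
        qed
      }
      fix r show "r * a \<in> D" unfolding D_def
      proof (intro CollectI allI)
        fix h
        have "coset g (cartier (G * (a * (r * h)))) \<in> ?FP e" using a by (auto simp: D_def)
        then show "coset g (cartier (G * (r * a * h))) \<in> ?FP e" by (simp add: mult_ac)
      qed
    qed
    have "?FP (Suc e) \<subseteq> coset g ` D"
      unfolding frobenius_power_def[of ?R I "p ^ Suc e"]
    proof (rule I.genideal_minimal[OF ideal_coset_image[OF D]], intro image_subsetI)
      fix a assume a: "a \<in> I"
      then obtain u where u: "a = coset g u" using I.Icarr[OF a] by (auto simp: carrier_hypersurface)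
      have "u ^ (p ^ Suc e) \<in> D" unfolding D_def
      proof (intro CollectI allI)
        fix h
        have "G * (u ^ p ^ Suc e * h) = (u ^ p ^ e) ^ p * (G * h)"
          unfolding frob_step by (simp only: mult_ac)
        then have "cartier (G * (u ^ p ^ Suc e * h)) = u ^ p ^ e * cartier (G * h)"
          by (simp only: cartier_power_mult)
        moreover have "a [^]\<^bsub>?R\<^esub> (p ^ e) \<in> ?FP e"
          unfolding frobenius_power_def using a by (intro I.genideal_self[THEN subsetD]) (auto intro: I.Icarr)
        then have "coset g (u ^ p ^ e) \<otimes>\<^bsub>?R\<^esub> coset g (cartier (G * h)) \<in> ?FP e"
          by (intro FP.I_r_closed) (simp_all add: u coset_simps)
        ultimately show "coset g (cartier (G * (u ^ p ^ Suc e * h))) \<in> ?FP e"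
          by (simp only: coset_simps)
      qed
      then show "a [^]\<^bsub>?R\<^esub> (p ^ Suc e) \<in> coset g ` D" unfolding u coset_simps(5) by (rule imageI)
    qed
    then obtain t' where t': "t' \<in> D" "coset g t = coset g t'" using t by blast
    then have "coset g (cartier (G * (t' * 1))) \<in> ?FP e" unfolding D_def by blast
    then show ?thesis using cong[OF t'(2)] by simp
  qed
  show ?thesis unfolding multipliers_def
  proof (intro CollectI allI)
    fix e
    have "coset g (s * f ^ p ^ Suc e) \<in> ?FP (Suc e)" using s unfolding multipliers_def by blast
    then have "coset g (cartier (G * (s * f ^ p ^ Suc e))) \<in> ?FP e" by (rule step)
    moreover have "G * (s * f ^ p ^ Suc e) = (f ^ p ^ e) ^ p * (G * s)"
      unfolding frob_step by (simp only: mult_ac)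
    then have "cartier (G * (s * f ^ p ^ Suc e)) = f ^ p ^ e * cartier (G * s)"
      by (simp only: cartier_power_mult)
    ultimately show "coset g (cartier (G * s) * f ^ p ^ e) \<in> ?FP e" by (simp only: mult.commute)
  qed
qed

end

theorem theorem1p6:
  fixes g :: "'a::alg_closed_field mpoly3" and d k p :: nat and w :: "'a mpoly3 set"
  assumes "CHAR('a) = p" and "p > 0"
    and "homogeneous d g"
    and "normal_domain (hypersurface_ring g)"
    and "krull_dim (hypersurface_ring g) = 2"
    and "int p > int d - 3"
    and "w \<in> graded_component g k"
    and "w \<noteq> \<zero>\<^bsub>hypersurface_ring g\<^esub>"
    and "int k \<ge> int d - 2"
  shows "test_element (hypersurface_ring g) p w"
proof -
  let ?R = "hypersurface_ring g"
  interpret pos_char p "TYPE('a)" by unfold_locales (rule assms(1), rule assms(2))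
  obtain h where h: "homogeneous k h" "w = coset g h"
    using assms(7) by (auto simp: graded_component_def coset_def)
  have main: "h \<in> multipliers g p I f"
    if I: "ideal I ?R" and c: "c \<in> multipliers g p I f" "\<not> g dvd c" for I f c
  proof (cases "g = 0")
    \<comment> \<open>The quotient is the polynomial ring here; taking \<open>G = 1\<close> shows
      that the multipliers are stable under \<open>cartier\<close>, so they contain
      \<open>1\<close>.\<close>
    case True
    have "cartier s \<in> multipliers g p I f" if "s \<in> multipliers g p I f" for s
      using multipliers_stable[OF I, of 1 s f] that True by simp
    then have "1 \<in> multipliers g p I f"
      using cartier_stable_one[OF mideal_multipliers(1)[OF I] _ c(1)] c(2) True by auto
    then show ?thesis using mideal_mult[OF mideal_multipliers(1)[OF I], of 1 _ _ h] by simp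
  next
    case False
    interpret normal_form g "int d"
      using assms(3,4) False by (intro normal_form_hypersurface) (simp_all add: ihom_homogeneous)
    interpret normal_form_char p "TYPE('a)" g "int d" ..
    have "g dvd cartier (g ^ (p - 1) * (g * h))" for h
    proof -
      have "g ^ (p - 1) * (g * h) = g ^ p * h"
        unfolding mult.assoc[symmetric] power_minus_mult[OF p_pos] ..
      then have "cartier (g ^ (p - 1) * (g * h)) = g * cartier h" by (simp only: cartier_power_mult)
      then show ?thesis by simp
    qed
    then show ?thesis
      using stable_ideal_contains[OF mideal_multipliers[OF I] c multipliers_stable[OF I] _ _ assms(9)]
        assms(6) h(1) by (auto simp: ihom_homogeneous)
  qed
  show ?thesis unfolding test_element_def
  proof (intro conjI allI impI ballI)
    show "w \<in> carrier ?R" by (simp add: h)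
    fix I f assume I: "ideal I ?R" and f: "f \<in> carrier ?R"
    obtain f0 where f0: "f = coset g f0" using f by (auto simp: carrier_hypersurface)
    have mult: "(\<forall>e::nat. coset g s \<otimes>\<^bsub>?R\<^esub> f [^]\<^bsub>?R\<^esub> (p ^ e) \<in> frobenius_power ?R I (p ^ e)) \<longleftrightarrow>
      s \<in> multipliers g p I f0" for s
      by (simp add: f0 multipliers_def coset_simps)
    show "f \<in> tight_closure ?R p I \<longleftrightarrow>
      (\<forall>e::nat. w \<otimes>\<^bsub>?R\<^esub> f [^]\<^bsub>?R\<^esub> (p ^ e) \<in> frobenius_power ?R I (p ^ e))"
    proof
      assume "f \<in> tight_closure ?R p I"
      then obtain c where c: "c \<in> carrier ?R" "c \<noteq> \<zero>\<^bsub>?R\<^esub>"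
        "\<forall>e::nat. c \<otimes>\<^bsub>?R\<^esub> f [^]\<^bsub>?R\<^esub> (p ^ e) \<in> frobenius_power ?R I (p ^ e)"
        by (auto simp: tight_closure_def)
      obtain c0 where c0: "c = coset g c0" using c(1) by (auto simp: carrier_hypersurface)
      have "c0 \<in> multipliers g p I f0" using c(3) unfolding c0 mult .
      moreover have "\<not> g dvd c0" using c(2) by (simp add: c0 coset_simps coset_eq)
      ultimately have "h \<in> multipliers g p I f0" using main[OF I] by blast
      then show "\<forall>e::nat. w \<otimes>\<^bsub>?R\<^esub> f [^]\<^bsub>?R\<^esub> (p ^ e) \<in> frobenius_power ?R I (p ^ e)"
        unfolding h(2) mult .
    next
      \<comment> \<open>Conversely, \<open>w\<close> is nonzero and itself serves as the multiplier
        \<open>c\<close>.\<close>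
      assume "\<forall>e::nat. w \<otimes>\<^bsub>?R\<^esub> f [^]\<^bsub>?R\<^esub> (p ^ e) \<in> frobenius_power ?R I (p ^ e)"
      then show "f \<in> tight_closure ?R p I"
        unfolding tight_closure_def using f assms(8) h(2) by auto
    qed
  qed
qed

end
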